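(* Let $k$ be an integer, let $G$ be an $n$-vertex mop, and let $n_2$ be the number of vertices of $G$ of degree $2$. (a) If $k\ge 1$ and $n\ge 2k+3$, then \[\iota_k(G)\le \begin{cases}\frac{n+n_2}{k+5} & \text{if } n_2\le \frac{n}{k+4},\\[1mm] \frac{n}{k+4} & \text{if } \frac{n}{k+4}\le n_2\le \frac{2n}{k+4},\\[1mm] \frac{n-n_2}{k+2} & \text{if } n_2\ge \frac{2n}{k+4}.\end{cases}\] (b) If $-1\le k\le 0$ and $n\ge k+5$, then \[\iota_k(G)\le \begin{cases}\frac{n+n_2}{k+5} & \text{if } n_2\le \frac{n}{k+4},\\[1mm] \frac{n-n_2-k\,\mathbf{1}(n,n_2)}{k+3} & \text{if } n_2\ge \frac{n}{k+4}.\end{cases}\] Moreover, the bound is sharp: for each $k \ge -1$ there are infinitely many values of $n$ for which the bound is attained by some $n$-vertex mop.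
   Context: All graphs are finite and simple. A triangulated disc is a plane graph whose interior faces are triangles and whose exterior (unbounded) face is bounded by a simple cycle. A maximal outerplanar graph, or mop, is a triangulated disc $G$ such that the boundary of the exterior face of $G$ contains all the vertices of $G$ (so a mop has at least 3 vertices). For $S\subseteq V(G)$, $N_G[S]$ is the closed neighborhood of $S$, i.e. $S$ together with all vertices adjacent to a vertex of $S$; $G-N_G[S]$ is the subgraph induced by the remaining vertices. For $k\ge -1$, a set $S\subseteq V(G)$ is a $K_{1,k+1}$-isolating set of $G$ if $G-N_G[S]$ contains no copy of the star $K_{1,k+1}$, where $K_{1,0}$ is the one-vertex graph $K_1$. (Equivalently, for $k\ge 0$, every vertex of $G-N_G[S]$ has degree at most $k$ in $G-N_G[S]$; for $k=-1$, $N_G[S]=V(G)$.) $\iota_k(G)$ denotes the minimum size of a $K_{1,k+1}$-isolating set of $G$; in particular $\iota_{-1}(G)$ is the domination number $\gamma(G)$. For positive integers $a,b$, $\mathbf{1}(a,b)=1$ if $b$ is odd and $a=2b$, and $\mathbf{1}(a,b)=0$ otherwise. *)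

theory Defs
  imports "HOL-Analysis.Analysis"
begin

section \<open>Finite simple graphs\<close>

record 'a graph =
  verts :: "'a set"
  edges :: "'a set set"

definition simple_graph :: "'a graph \<Rightarrow> bool" where
  "simple_graph G \<longleftrightarrow> finite (verts G) \<and> (\<forall>e\<in>edges G. e \<subseteq> verts G \<and> card e = 2)"

definition neighbours :: "'a graph \<Rightarrow> 'a \<Rightarrow> 'a set" where
  "neighbours G v = {u \<in> verts G. {u, v} \<in> edges G}"

definition vdegree :: "'a graph \<Rightarrow> 'a \<Rightarrow> nat" where
  "vdegree G v = card (neighbours G v)"

definition closed_nbhd :: "'a graph \<Rightarrow> 'a set \<Rightarrow> 'a set" where
  "closed_nbhd G S = S \<union> (\<Union>v\<in>S. neighbours G v)"

definition induced_subgraph :: "'a graph \<Rightarrow> 'a set \<Rightarrow> 'a graph" where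
  "induced_subgraph G W = \<lparr>verts = verts G \<inter> W, edges = {e \<in> edges G. e \<subseteq> W}\<rparr>"

definition contains_copy :: "'a graph \<Rightarrow> 'b graph \<Rightarrow> bool" where
  "contains_copy G H \<longleftrightarrow>
     (\<exists>f. inj_on f (verts H) \<and> f ` verts H \<subseteq> verts G \<and> (\<forall>e\<in>edges H. f ` e \<in> edges G))"

text \<open>The star \<open>K\<^bsub>1,m\<^esub>\<close> with centre \<open>0\<close> and leaves \<open>1, \<dots>, m\<close>.\<close>

definition star :: "nat \<Rightarrow> nat graph" where
  "star m = \<lparr>verts = {0..m}, edges = (\<lambda>i. {0, i}) ` {1..m}\<rparr>"

text \<open>A \<open>K\<^bsub>1,k+1\<^esub>\<close>-isolating set, meant for integers \<open>k \<ge> -1\<close>.\<close>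

definition star_isolating :: "int \<Rightarrow> 'a graph \<Rightarrow> 'a set \<Rightarrow> bool" where
  "star_isolating k G S \<longleftrightarrow> S \<subseteq> verts G \<and>
     \<not> contains_copy (induced_subgraph G (verts G - closed_nbhd G S)) (star (nat (k + 1)))"

definition iota :: "int \<Rightarrow> 'a graph \<Rightarrow> nat" where
  "iota k G = (LEAST m. \<exists>S. star_isolating k G S \<and> card S = m)"

text \<open>The minimum is over a nonempty set, since the set of all vertices is isolating.\<close>

lemma star_isolating_verts: "star_isolating k G (verts G)"
proof -
  have "verts G - closed_nbhd G (verts G) = {}"
    by (auto simp: closed_nbhd_def)
  moreover have "0 \<in> verts (star m)" for m
    by (simp add: star_def)
  ultimately show ?thesis
    unfolding star_isolating_def contains_copy_def induced_subgraph_def by fastforce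
qed

definition num_deg2 :: "'a graph \<Rightarrow> nat" where
  "num_deg2 G = card {v \<in> verts G. vdegree G v = 2}"

definition is_cycle :: "'a graph \<Rightarrow> 'a list \<Rightarrow> bool" where
  "is_cycle G vs \<longleftrightarrow> length vs \<ge> 3 \<and> distinct vs \<and> set vs \<subseteq> verts G \<and>
     (\<forall>i<length vs. {vs ! i, vs ! (Suc i mod length vs)} \<in> edges G)"

definition cycle_edges :: "'a list \<Rightarrow> 'a set set" where
  "cycle_edges vs = (\<lambda>i. {vs ! i, vs ! (Suc i mod length vs)}) ` {..<length vs}"


section \<open>Plane graphs\<close>

text \<open>
  A plane graph has points of the plane as vertices, and each edge is an arc, represented by its
  point set.  An edge meets the vertex set exactly in its two ends, distinct edges have distinct
  pairs of ends, and two edges meet only in vertices (hence only in common ends).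
\<close>

record plane_graph =
  pverts :: "complex set"
  parcs :: "complex set set"

definition is_plane_graph :: "plane_graph \<Rightarrow> bool" where
  "is_plane_graph P \<longleftrightarrow> finite (pverts P) \<and> finite (parcs P) \<and>
     (\<forall>a\<in>parcs P. \<exists>g. arc g \<and> path_image g = a \<and> a \<inter> pverts P = {pathstart g, pathfinish g}) \<and>
     (\<forall>a\<in>parcs P. \<forall>b\<in>parcs P. a \<noteq> b \<longrightarrow>
        a \<inter> b \<subseteq> pverts P \<and> a \<inter> pverts P \<noteq> b \<inter> pverts P)"

definition abstract_graph :: "plane_graph \<Rightarrow> complex graph" where
  "abstract_graph P = \<lparr>verts = pverts P, edges = (\<lambda>a. a \<inter> pverts P) ` parcs P\<rparr>"

lemma is_plane_graph_arcE:
  assumes "is_plane_graph P" "a \<in> parcs P"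
  obtains g where "arc g" "path_image g = a" "a \<inter> pverts P = {pathstart g, pathfinish g}"
proof -
  have "\<forall>a\<in>parcs P. \<exists>g. arc g \<and> path_image g = a \<and> a \<inter> pverts P = {pathstart g, pathfinish g}"
    using assms(1) unfolding is_plane_graph_def by (elim conjE)
  from bspec[OF this assms(2)] show thesis
    by (elim exE conjE) (rule that)
qed

lemma simple_graph_abstract_graph:
  assumes "is_plane_graph P"
  shows "simple_graph (abstract_graph P)"
proof -
  have "card (a \<inter> pverts P) = 2" if a: "a \<in> parcs P" for a
  proof -
    obtain g where "arc g" "a \<inter> pverts P = {pathstart g, pathfinish g}"
      using is_plane_graph_arcE[OF assms a] by metis
    then show ?thesis
      using arc_distinct_ends[of g] by simp
  qed
  then show ?thesis
    using assms by (auto simp: simple_graph_def abstract_graph_def is_plane_graph_def)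
qed

definition drawing :: "plane_graph \<Rightarrow> complex set" where
  "drawing P = pverts P \<union> \<Union>(parcs P)"

definition faces :: "plane_graph \<Rightarrow> complex set set" where
  "faces P = components (- drawing P)"

text \<open>The exterior face is the unbounded one.\<close>

lemma exterior_face_unique:
  assumes "is_plane_graph P"
  shows "\<exists>!F. F \<in> faces P \<and> \<not> bounded F"
proof -
  have "compact (drawing P)"
    unfolding drawing_def
  proof (intro compact_Un compact_Union)
    show "compact (pverts P)"
      using assms by (simp add: is_plane_graph_def finite_imp_compact)
    show "finite (parcs P)"
      using assms by (simp add: is_plane_graph_def)
    show "compact a" if "a \<in> parcs P" for a
    proof -
      obtain g where "arc g" "path_image g = a"
        using is_plane_graph_arcE[OF assms \<open>a \<in> parcs P\<close>] by metis
      then show ?thesis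
        using compact_arc_image by metis
    qed
  qed
  then have b: "bounded (- (- drawing P))"
    by (simp add: compact_imp_bounded)
  have "\<exists>F. F \<in> faces P \<and> \<not> bounded F"
    using cobounded_unbounded_components[OF b] by (auto simp: faces_def)
  then show ?thesis
    using cobounded_unique_unbounded_components[OF b] by (auto simp: faces_def)
qed

definition bounded_by_cycle :: "plane_graph \<Rightarrow> complex set \<Rightarrow> complex list \<Rightarrow> bool" where
  "bounded_by_cycle P F vs \<longleftrightarrow> is_cycle (abstract_graph P) vs \<and>
     frontier F = \<Union>{a \<in> parcs P. a \<inter> pverts P \<in> cycle_edges vs}"

definition triangulated_disc :: "plane_graph \<Rightarrow> bool" where
  "triangulated_disc P \<longleftrightarrow> is_plane_graph P \<and>
     (\<forall>F\<in>faces P. bounded F \<longrightarrow> (\<exists>vs. length vs = 3 \<and> bounded_by_cycle P F vs)) \<and>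
     (\<forall>F\<in>faces P. \<not> bounded F \<longrightarrow> (\<exists>vs. bounded_by_cycle P F vs))"

definition mop :: "plane_graph \<Rightarrow> bool" where
  "mop P \<longleftrightarrow> triangulated_disc P \<and> (\<forall>F\<in>faces P. \<not> bounded F \<longrightarrow> pverts P \<subseteq> frontier F)"


section \<open>The bound\<close>

definition indic :: "nat \<Rightarrow> nat \<Rightarrow> real" where
  "indic a b = (if odd b \<and> a = 2 * b then 1 else 0)"

definition iota_bound :: "int \<Rightarrow> nat \<Rightarrow> nat \<Rightarrow> real" where
  "iota_bound k n n2 =
     (if k \<ge> 1 then
        (if real n2 \<le> real n / (real_of_int k + 4) then (real n + real n2) / (real_of_int k + 5)
         else if real n2 \<le> 2 * real n / (real_of_int k + 4) then real n / (real_of_int k + 4)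
         else (real n - real n2) / (real_of_int k + 2))
      else
        (if real n2 \<le> real n / (real_of_int k + 4) then (real n + real n2) / (real_of_int k + 5)
         else (real n - real n2 - real_of_int k * indic n n2) / (real_of_int k + 3)))"

text \<open>The pieces agree where their ranges overlap, so all ranges may be taken closed.\<close>

lemma iota_bound_pos:
  assumes "k \<ge> 1"
  shows "real n2 \<le> real n / (real_of_int k + 4) \<Longrightarrow>
           iota_bound k n n2 = (real n + real n2) / (real_of_int k + 5)"
    and "real n / (real_of_int k + 4) \<le> real n2 \<Longrightarrow> real n2 \<le> 2 * real n / (real_of_int k + 4) \<Longrightarrow>
           iota_bound k n n2 = real n / (real_of_int k + 4)"
    and "real n2 \<ge> 2 * real n / (real_of_int k + 4) \<Longrightarrow>
           iota_bound k n n2 = (real n - real n2) / (real_of_int k + 2)"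
proof -
  define x where "x = real n / (real_of_int k + 4)"
  have k: "real_of_int k \<ge> 1" using assms by simp
  have n: "real n = x * (real_of_int k + 4)" and x0: "x \<ge> 0"
    using k by (auto simp: x_def)
  have t: "2 * real n / (real_of_int k + 4) = 2 * x"
    by (simp add: x_def)
  have mid: "(real n + x) / (real_of_int k + 5) = x"
    using k by (simp add: n field_simps)
  have top: "(real n - 2 * x) / (real_of_int k + 2) = x"
    using k by (simp add: n field_simps)
  have eq: "iota_bound k n n2 =
     (if real n2 \<le> x then (real n + real n2) / (real_of_int k + 5)
      else if real n2 \<le> 2 * x then x else (real n - real n2) / (real_of_int k + 2))"
    using assms by (simp add: iota_bound_def x_def)
  show "iota_bound k n n2 = (real n + real n2) / (real_of_int k + 5)"
    if "real n2 \<le> real n / (real_of_int k + 4)"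
    using that unfolding x_def[symmetric] eq by simp
  show "iota_bound k n n2 = real n / (real_of_int k + 4)"
    if "real n / (real_of_int k + 4) \<le> real n2" "real n2 \<le> 2 * real n / (real_of_int k + 4)"
  proof -
    have "real n2 = x \<or> x < real n2 \<and> real n2 \<le> 2 * x"
      using that[unfolded t, folded x_def] by linarith
    then show ?thesis
      unfolding x_def[symmetric] eq using mid by (elim disjE) simp_all
  qed
  show "iota_bound k n n2 = (real n - real n2) / (real_of_int k + 2)"
    if "real n2 \<ge> 2 * real n / (real_of_int k + 4)"
  proof -
    have h: "2 * x \<le> real n2"
      using that t by simp
    consider "real n2 = 2 * x" "x = 0" | "real n2 = 2 * x" "x > 0" | "real n2 > 2 * x"
      using h x0 by linarith
    then show ?thesis
    proof cases
      case 1
      then show ?thesis using eq n by simp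
    next
      case 2
      then show ?thesis using eq top by simp
    next
      case 3
      then show ?thesis using eq x0 by simp
    qed
  qed
qed

lemma iota_bound_nonpos:
  assumes "-1 \<le> k" "k \<le> 0"
  shows "real n2 \<le> real n / (real_of_int k + 4) \<Longrightarrow>
           iota_bound k n n2 = (real n + real n2) / (real_of_int k + 5)"
    and "real n2 \<ge> real n / (real_of_int k + 4) \<Longrightarrow>
           iota_bound k n n2 = (real n - real n2 - real_of_int k * indic n n2) / (real_of_int k + 3)"
proof -
  define x where "x = real n / (real_of_int k + 4)"
  have k: "real_of_int k \<ge> -1" using assms by simp
  have n: "real n = x * (real_of_int k + 4)"
    using k by (auto simp: x_def)
  have eq: "iota_bound k n n2 =
     (if real n2 \<le> x then (real n + real n2) / (real_of_int k + 5)
      else (real n - real n2 - real_of_int k * indic n n2) / (real_of_int k + 3))"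
    using assms by (simp add: iota_bound_def x_def)
  show "iota_bound k n n2 = (real n + real n2) / (real_of_int k + 5)"
    if "real n2 \<le> real n / (real_of_int k + 4)"
    using that unfolding x_def[symmetric] eq by simp
  have mid: "(real n + x) / (real_of_int k + 5) = (real n - x - real_of_int k * indic n n2) / (real_of_int k + 3)"
    if "real n2 = x"
  proof -
    have "indic n n2 = 0"
    proof (rule ccontr)
      assume "indic n n2 \<noteq> 0"
      then have o: "odd n2" "n = 2 * n2"
        by (auto simp: indic_def split: if_splits)
      then have "real n2 * (real_of_int k + 2) = 0"
      proof -
        have "x * (real_of_int k + 4) = 2 * x" using n o(2) that by simp
        then have "x * (real_of_int k + 2) = 0" by (simp only: distrib_left)
        then show ?thesis using that by simp
      qed
      then show False
        using o k by auto
    qed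
    then show ?thesis
      using k by (simp add: n field_simps)
  qed
  show "iota_bound k n n2 = (real n - real n2 - real_of_int k * indic n n2) / (real_of_int k + 3)"
    if "real n2 \<ge> real n / (real_of_int k + 4)"
  proof -
    have "real n2 = x \<or> x < real n2"
      using that[folded x_def] by linarith
    then show ?thesis
    proof
      assume "real n2 = x"
      then show ?thesis using eq mid by simp
    next
      assume "x < real n2"
      then show ?thesis using eq by simp
    qed
  qed
qed

end

theory Submission
  imports Defs "HOL-Library.Tree"
begin

text \<open>
  A maximal outerplanar graph is a triangulated polygon, and a triangulated polygon with a chosen
  base edge is a binary tree: the root is the triangle on the base edge, its two subtrees are the
  triangulations that hang on the other two sides of this triangle, and the leaves are the
  remaining sides of the polygon. The argument has three parts.

  The first part is topological. The frontier of the exterior face is a Jordan curve through all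
  vertices, and every other arc lies inside it. Such an arc cuts the inside into two smaller
  polygons whose faces are again triangles, and by induction \<open>mop_tree_graph\<close> turns every mop into
  a tree. In the other direction, \<open>mop_straight_drawing\<close> draws every tree with its vertices on a
  parabola and straight edges; this is how the extremal examples are obtained.

  The second part gives the upper bounds for trees. Let \<open>n\<close> be the number of vertices and \<open>n\<^sub>2\<close>
  the number of those of degree two. All bounds come from three estimates. The first two,
  \<open>n / (k + 4)\<close> and \<open>(n + n\<^sub>2) / (k + 5)\<close>, are the two instances of one induction in the
  style of Chvatal's proof of the art gallery theorem (\<open>pend_bound\<close>). Give a subtree as weight its
  number of leaves, in the second instance increased by its number of triangles with two sides on
  the boundary, and take a minimal subtree among those of weight at least \<open>k + 4\<close> (respectively
  \<open>k + 5\<close>). Its two halves are light, so a guard at the apex of its root triangle leaves at most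
  \<open>k + 1\<close> undominated vertices in either half, too few for a star \<open>K\<^bsub>1,k+1\<^esub>\<close>. The guard also
  dominates both ends of the base edge of the subtree, and so the subtree can be deleted and its
  base edge contracted; the weight drops by the full weight of the subtree. In the second instance
  the contraction may create a new vertex of degree two, and then a slightly larger piece is cut
  off instead. The third estimate, \<open>(n - n\<^sub>2) / (k + 2)\<close> for \<open>k \<ge> 1\<close> and
  \<open>(n - n\<^sub>2) / 3\<close> for \<open>k = 0\<close>, follows by applying the first one to the triangulation \<open>H\<close> on
  the \<open>n - n\<^sub>2\<close> vertices that remain when the vertices of degree two are deleted. A vertex of
  \<open>H\<close> has lost at most two neighbours, so that for \<open>k \<ge> 1\<close> an isolating set of \<open>H\<close> for \<open>k - 2\<close>
  is one of the whole graph for \<open>k\<close>, and for \<open>k = 0\<close> a dominating set of \<open>H\<close> is enough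
  (\<open>pend_prune_bound\<close>). For \<open>k = -1\<close> every second vertex on the Hamiltonian cycle of \<open>H\<close> is
  taken (\<open>pend_dominate\<close>).

  For sharpness, chain \<open>t\<close> blocks of \<open>k + 4\<close> vertices, each containing a star \<open>K\<^bsub>1,k+1\<^esub>\<close> whose
  vertices have no neighbours outside the block. Every isolating set meets every block, so its
  size is at least \<open>t = n / (k + 4)\<close>, and for such \<open>n\<close> the bound of the theorem is at most
  \<open>t\<close>.
\<close>

section \<open>Triangulated polygons as binary trees\<close>

text \<open>
  The labels of the inner nodes are vertices, and \<open>a\<close>, \<open>b\<close> are the ends of the base edge. A node
  \<open>c\<close> over the edge \<open>ab\<close> stands for the triangle \<open>abc\<close>; its subtrees hang on the edges \<open>ac\<close> and
  \<open>cb\<close>. The list \<open>a # inorder t @ [b]\<close> runs once round the polygon.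
\<close>

fun tedges :: "'a \<Rightarrow> 'a tree \<Rightarrow> 'a \<Rightarrow> 'a set set" where
  "tedges a Leaf b = {{a, b}}"
| "tedges a (Node l c r) b = insert {a, b} (tedges a l c \<union> tedges c r b)"

text \<open>
  A node with two leaves is a triangle with two sides on the boundary, so that its label is a
  vertex of degree two.
\<close>

fun cherries :: "'a tree \<Rightarrow> 'a set" where
  "cherries Leaf = {}"
| "cherries (Node l c r) = (if l = Leaf \<and> r = Leaf then {c} else cherries l \<union> cherries r)"

fun num_cherries :: "'a tree \<Rightarrow> nat" where
  "num_cherries Leaf = 0"
| "num_cherries (Node l c r) = (if l = Leaf \<and> r = Leaf then 1 else num_cherries l + num_cherries r)"

lemma tedges_base: "{a, b} \<in> tedges a t b"
  by (cases t) auto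

lemma tedges_subset: "e \<in> tedges a t b \<Longrightarrow> e \<subseteq> insert a (insert b (set_tree t))"
  by (induction t arbitrary: a b; simp; blast)

lemma tedges_apex:
  assumes "t \<noteq> Leaf"
  shows "{a, value t} \<in> tedges a t b" "{value t, b} \<in> tedges a t b"
  using assms by (cases t; auto simp: tedges_base)+

lemma num_cherries_pos: "t \<noteq> Leaf \<Longrightarrow> num_cherries t \<ge> 1"
  by (induction t) auto

lemma value_in_set: "t \<noteq> Leaf \<Longrightarrow> value t \<in> set_tree t"
  by (cases t) auto

lemma card_set_tree_le: "card (set_tree t) \<le> size t"
  by (metis card_length length_inorder set_inorder)

lemma tedges_map: "tedges (f a) (map_tree f t) (f b) = (\<lambda>e. f ` e) ` tedges a t b"
  by (induction t arbitrary: a b) (auto simp: image_Un)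

lemma tedges_card2:
  assumes "distinct (a # inorder t @ [b])" "e \<in> tedges a t b"
  shows "card e = 2"
  using assms
proof (induction t arbitrary: a b)
  case Leaf then show ?case by (simp add: card_insert_if)
next
  case (Node l c r)
  have "distinct (a # inorder l @ [c])" "distinct (c # inorder r @ [b])" "a \<noteq> b"
    using Node.prems(1) by auto
  then show ?case using Node.IH Node.prems(2) by (auto simp: card_insert_if)
qed

section \<open>Isolating sets and small enclosed parts\<close>

definition dominated :: "'a set set \<Rightarrow> 'a set \<Rightarrow> 'a set" where
  "dominated E S = S \<union> {x. \<exists>s\<in>S. {s, x} \<in> E}"

text \<open>
  For \<open>m = k + 1\<close> the condition forbids a star \<open>K\<^bsub>1,k+1\<^esub>\<close> among the undominated vertices. The
  case \<open>m = 0\<close> is domination, because no cardinality is below \<open>0\<close>; with \<open>m\<close> in place of \<open>k\<close> the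
  case \<open>k = -1\<close> is treated together with the others.
\<close>

definition isolating :: "nat \<Rightarrow> 'a set \<Rightarrow> 'a set set \<Rightarrow> 'a set \<Rightarrow> bool" where
  "isolating m V E S \<longleftrightarrow> S \<subseteq> V \<and>
     (\<forall>x\<in>V - dominated E S. card {y \<in> V - dominated E S. {x, y} \<in> E} < m)"

text \<open>
  Each undominated vertex of \<open>Q\<close> is enclosed, together with at most \<open>m\<close> undominated vertices in
  all, in a set that edges leave only towards dominated vertices. A star \<open>K\<^bsub>1,m\<^esub>\<close> is connected and
  has \<open>m + 1\<close> vertices, so none of its copies fits there.
\<close>

definition scattered :: "nat \<Rightarrow> 'a set set \<Rightarrow> 'a set \<Rightarrow> 'a set \<Rightarrow> bool" where
  "scattered m E D Q \<longleftrightarrow> (\<forall>x\<in>Q - D. \<exists>R. x \<in> R \<and> finite R \<and> card (R - D) \<le> m \<and>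
     (\<forall>u\<in>R - D. \<forall>y. {u, y} \<in> E \<longrightarrow> y \<in> R \<union> D))"

lemma scatteredI:
  assumes "finite R" "card (R - D) \<le> m" "\<And>u y. u \<in> R - D \<Longrightarrow> {u, y} \<in> E \<Longrightarrow> y \<in> R \<union> D"
  shows "scattered m E D R"
  using assms unfolding scattered_def by blast

lemma scattered_Un: "scattered m E D Q \<Longrightarrow> scattered m E D R \<Longrightarrow> scattered m E D (Q \<union> R)"
  unfolding scattered_def by blast

lemma scattered_dominated: "Q \<subseteq> D \<Longrightarrow> scattered m E D Q"
  unfolding scattered_def by blast

text \<open>
  All reductions below obtain an isolating set \<open>S\<close> from an isolating set \<open>S'\<close> of a smaller graph.
  A star of undominated vertices either has its centre in the scattered part, where there is no
  room for it, or lies in the part that both graphs share, where \<open>S'\<close> already excludes it.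
\<close>

lemma isolating_extend:
  assumes iso: "isolating m V' E' S'" and fin: "finite V'" and S: "S \<subseteq> V"
    and loop: "\<And>x. {x} \<notin> E"
    and V: "V \<subseteq> V' \<union> Q"
    and Q: "scattered m E (dominated E S) Q"
    and old: "\<And>x. x \<in> V' \<Longrightarrow> x \<in> dominated E' S' \<Longrightarrow> x \<in> dominated E S"
    and edg: "\<And>x y. x \<in> V' - dominated E S \<Longrightarrow> y \<in> V - dominated E S \<Longrightarrow> x \<notin> Q \<Longrightarrow> {x, y} \<in> E
                \<Longrightarrow> y \<in> V' \<and> {x, y} \<in> E'"
  shows "isolating m V E S"
  unfolding isolating_def
proof (intro conjI ballI S)
  fix x assume x: "x \<in> V - dominated E S"
  let ?N = "{y \<in> V - dominated E S. {x, y} \<in> E}"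
  show "card ?N < m"
  proof (cases "x \<in> Q")
    case True
    then obtain R where R: "x \<in> R" "finite R" "card (R - dominated E S) \<le> m"
        "\<forall>u\<in>R - dominated E S. \<forall>y. {u, y} \<in> E \<longrightarrow> y \<in> R \<union> dominated E S"
      using Q x unfolding scattered_def by blast
    have "?N \<subseteq> R - dominated E S - {x}"
      using R x loop by auto
    then have "card ?N \<le> card (R - dominated E S - {x})"
      using R(2) by (intro card_mono) auto
    also have "\<dots> < card (R - dominated E S)"
      using R x by (intro psubset_card_mono) auto
    finally show ?thesis using R(3) by simp
  next
    case False
    then have xV: "x \<in> V' - dominated E' S'" using x V old by blast
    have "?N \<subseteq> {y \<in> V' - dominated E' S'. {x, y} \<in> E'}"
      using edg[of x] False x xV old by blast
    then have "card ?N \<le> card {y \<in> V' - dominated E' S'. {x, y} \<in> E'}"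
      using fin by (intro card_mono) auto
    also have "\<dots> < m" using iso xV unfolding isolating_def by blast
    finally show ?thesis .
  qed
qed

lemma isolating_scattered:
  assumes "S \<subseteq> V" "\<And>x. {x} \<notin> E" "scattered m E (dominated E S) V"
  shows "isolating m V E S"
proof -
  have "isolating m {} {} {}" by (simp add: isolating_def)
  from isolating_extend[OF this _ assms(1,2) _ assms(3)] show ?thesis by auto
qed

text \<open>
  When both ends of its base edge are dominated, the interior of a subtree is separated from the
  rest of the graph. If the apex of the root triangle is dominated as well, one more inner vertex
  is allowed.
\<close>

lemma scattered_tree:
  assumes "x \<in> D" "y \<in> D"
    and touch: "\<And>e. e \<in> E \<Longrightarrow> e \<inter> set_tree s \<noteq> {} \<Longrightarrow> e \<in> tedges x s y"
    and sz: "size s \<le> m \<or> s \<noteq> Leaf \<and> size s \<le> m + 1 \<and> value s \<in> D"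
  shows "scattered m E D (set_tree s)"
proof (rule scatteredI)
  show "card (set_tree s - D) \<le> m"
  proof (cases "size s \<le> m")
    case True
    have "card (set_tree s - D) \<le> card (set_tree s)" by (intro card_mono) auto
    then show ?thesis using True card_set_tree_le[of s] by linarith
  next
    case False
    then have "s \<noteq> Leaf" "size s \<le> m + 1" "value s \<in> D" using sz by auto
    then have "card (set_tree s - D) < card (set_tree s)"
      using value_in_set[of s] by (intro psubset_card_mono) auto
    then show ?thesis using card_set_tree_le[of s] \<open>size s \<le> m + 1\<close> by linarith
  qed
  fix u w assume "u \<in> set_tree s - D" "{u, w} \<in> E"
  then show "w \<in> set_tree s \<union> D"
    using touch[of "{u, w}"] tedges_subset[of "{u,w}" x s y] assms(1,2) by auto
qed auto

text \<open>
  Once the root triangle is dominated, the two halves are separated from each other and can be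
  treated one by one.
\<close>

lemma scattered_node:
  assumes D: "p \<in> D" "q \<in> D" "c \<in> D"
    and touch: "\<And>e. e \<in> E \<Longrightarrow> e \<inter> set_tree (Node T1 c T2) \<noteq> {} \<Longrightarrow> e \<in> tedges p (Node T1 c T2) q"
    and dist: "distinct (p # inorder (Node T1 c T2) @ [q])"
    and s1: "size T1 \<le> m + 1" and s2: "size T2 \<le> m + 1"
    and v1: "size T1 \<le> m \<or> value T1 \<in> D" and v2: "size T2 \<le> m \<or> value T2 \<in> D"
  shows "scattered m E D (set_tree (Node T1 c T2))"
proof -
  have "set_tree T1 \<inter> ({p,q,c} \<union> set_tree T2) = {}" "set_tree T2 \<inter> ({p,q,c} \<union> set_tree T1) = {}"
    using dist by auto
  note disj = this
  have t1: "e \<in> tedges p T1 c" if "e \<in> E" "e \<inter> set_tree T1 \<noteq> {}" for e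
  proof -
    have "e \<in> tedges p (Node T1 c T2) q" using touch[of e] that by auto
    moreover have "e \<noteq> {p, q}" "e \<notin> tedges c T2 q"
      using that disj tedges_subset[of e c T2 q] by blast+
    ultimately show ?thesis by auto
  qed
  have t2: "e \<in> tedges c T2 q" if "e \<in> E" "e \<inter> set_tree T2 \<noteq> {}" for e
  proof -
    have "e \<in> tedges p (Node T1 c T2) q" using touch[of e] that by auto
    moreover have "e \<noteq> {p, q}" "e \<notin> tedges p T1 c"
      using that disj tedges_subset[of e p T1 c] by blast+
    ultimately show ?thesis by auto
  qed
  have "scattered m E D (set_tree T1)"
    by (rule scattered_tree[OF D(1,3) t1]) (use s1 v1 in \<open>cases "T1 = Leaf"; simp\<close>)+
  moreover have "scattered m E D (set_tree T2)"
    by (rule scattered_tree[OF D(3,2) t2]) (use s2 v2 in \<open>cases "T2 = Leaf"; simp\<close>)+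
  moreover have "scattered m E D {c}" using D by (simp add: scattered_dominated)
  ultimately have "scattered m E D (set_tree T1 \<union> {c} \<union> set_tree T2)"
    by (intro scattered_Un)
  then show ?thesis by (simp add: Un_commute)
qed

section \<open>Adding one guard\<close>

text \<open>
  The positions from which one guard handles all of \<open>T\<close>. The apex is adjacent to the apices of
  both halves; an end of the base edge is adjacent only to the apex of the half next to it, and
  then the other half has to be small by itself.
\<close>

definition guards :: "nat \<Rightarrow> 'a \<Rightarrow> 'a tree \<Rightarrow> 'a \<Rightarrow> 'a \<Rightarrow> bool" where
  "guards m p T q g \<longleftrightarrow> g = value T \<or> g = p \<and> size (right T) \<le> m \<or> g = q \<and> size (left T) \<le> m"

lemma guards_dominates:
  assumes "guards m p (Node T1 c T2) q g" "g \<in> S" "tedges p (Node T1 c T2) q \<subseteq> E"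
  shows "p \<in> dominated E S" "q \<in> dominated E S" "c \<in> dominated E S"
    "T1 \<noteq> Leaf \<Longrightarrow> size T1 \<le> m \<or> value T1 \<in> dominated E S"
    "T2 \<noteq> Leaf \<Longrightarrow> size T2 \<le> m \<or> value T2 \<in> dominated E S"
proof -
  have b: "{p, q} \<in> E" "{p, c} \<in> E" "{c, q} \<in> E"
    using assms(3) tedges_base[of p c T1] tedges_base[of c q T2] by auto
  have v1: "{p, value T1} \<in> E" "{value T1, c} \<in> E" if "T1 \<noteq> Leaf"
    using assms(3) tedges_apex[OF that] by auto
  have v2: "{c, value T2} \<in> E" "{value T2, q} \<in> E" if "T2 \<noteq> Leaf"
    using assms(3) tedges_apex[OF that] by auto
  have sym: "{u, v} \<in> E \<Longrightarrow> u = g \<or> v = g \<Longrightarrow> u \<in> dominated E S \<and> v \<in> dominated E S" for u v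
    using assms(2) unfolding dominated_def by (auto simp: insert_commute)
  have g: "g = c \<or> g = p \<and> size T2 \<le> m \<or> g = q \<and> size T1 \<le> m"
    using assms(1) by (simp add: guards_def)
  show "p \<in> dominated E S" "q \<in> dominated E S" "c \<in> dominated E S"
    using g sym b by blast+
  show "size T1 \<le> m \<or> value T1 \<in> dominated E S" if "T1 \<noteq> Leaf"
    using g sym v1[OF that] by blast
  show "size T2 \<le> m \<or> value T2 \<in> dominated E S" if "T2 \<noteq> Leaf"
    using g sym v2[OF that] by blast
qed

lemma scattered_guarded:
  assumes g: "guards m p (Node T1 c T2) q g" "g \<in> S" "tedges p (Node T1 c T2) q \<subseteq> E"
    and touch: "\<And>e. e \<in> E \<Longrightarrow> e \<inter> set_tree (Node T1 c T2) \<noteq> {} \<Longrightarrow> e \<in> tedges p (Node T1 c T2) q"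
    and dist: "distinct (p # inorder (Node T1 c T2) @ [q])"
    and s: "size T1 \<le> m + 1" "size T2 \<le> m + 1"
  shows "scattered m E (dominated E S) (set_tree (Node T1 c T2))"
proof (rule scattered_node[OF _ _ _ touch dist s])
  show "size T1 \<le> m \<or> value T1 \<in> dominated E S" "size T2 \<le> m \<or> value T2 \<in> dominated E S"
    using guards_dominates(4,5)[OF g] by force+
qed (use guards_dominates[OF g] in auto)

text \<open>
  Cutting off: the interior of the subtree and some further vertices \<open>Z\<close> that the new guard
  dominates are deleted, and the rest of the graph is kept as it is.
\<close>

lemma extend_by_guard:
  assumes iso: "isolating m V' E' S'" and fin: "finite V'"
    and loop: "\<And>x. {x} \<notin> E"
    and V: "V = V' \<union> Z \<union> set_tree (Node T1 c T2)"
    and g: "guards m p (Node T1 c T2) q g" "tedges p (Node T1 c T2) q \<subseteq> E"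
    and pq: "p \<in> V' \<union> Z" "q \<in> V' \<union> Z"
    and touch: "\<And>e. e \<in> E \<Longrightarrow> e \<inter> set_tree (Node T1 c T2) \<noteq> {} \<Longrightarrow> e \<in> tedges p (Node T1 c T2) q"
    and dist: "distinct (p # inorder (Node T1 c T2) @ [q])"
    and s: "size T1 \<le> m + 1" "size T2 \<le> m + 1"
    and Z: "Z \<subseteq> dominated E {g}"
    and E': "E' \<subseteq> E"
    and edg: "\<And>x y. x \<in> V' \<Longrightarrow> y \<in> V' \<Longrightarrow> {x, y} \<in> E \<Longrightarrow> {x, y} \<in> E'"
  shows "isolating m V E (insert g S')"
proof -
  let ?T = "Node T1 c T2" and ?D = "dominated E (insert g S')"
  have mono: "dominated E {g} \<subseteq> ?D" "dominated E' S' \<subseteq> ?D"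
    using E' by (auto simp: dominated_def)
  have D: "p \<in> ?D" "q \<in> ?D"
    using guards_dominates(1,2)[OF g(1) _ g(2)] by auto
  have gV: "g \<in> V" using g(1) pq V by (auto simp: guards_def)
  have QQ: "scattered m E ?D (Z \<union> set_tree ?T)"
    by (rule scattered_Un[OF scattered_dominated scattered_guarded[OF g(1) _ g(2) touch dist s]])
      (use Z mono in auto)
  show ?thesis
  proof (rule isolating_extend[OF iso fin _ loop _ QQ])
    show "insert g S' \<subseteq> V" using gV iso V by (auto simp: isolating_def)
    show "V \<subseteq> V' \<union> (Z \<union> set_tree ?T)" using V by auto
    show "x \<in> V' \<Longrightarrow> x \<in> dominated E' S' \<Longrightarrow> x \<in> ?D" for x using mono by auto
    fix x y assume x: "x \<in> V' - ?D" "x \<notin> Z \<union> set_tree ?T" and y: "y \<in> V - ?D" "{x, y} \<in> E"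
    have "x \<noteq> p" "x \<noteq> q" using D x by auto
    have "y \<notin> set_tree ?T"
    proof
      assume "y \<in> set_tree ?T"
      then have "{x, y} \<in> tedges p ?T q" using touch[OF y(2)] by blast
      then show False using tedges_subset[of "{x,y}" p ?T q] x \<open>x \<noteq> p\<close> \<open>x \<noteq> q\<close> by auto
    qed
    moreover have "y \<notin> Z" using y Z mono by auto
    ultimately have "y \<in> V'" using y V by auto
    then show "y \<in> V' \<and> {x, y} \<in> E'" using edg x y by auto
  qed
qed

text \<open>
  Contracting: the interior of the subtree is deleted and the end \<open>z\<close> of its base edge is merged
  into the other end \<open>k\<close>. If \<open>k\<close> is in \<open>S'\<close>, both ends are taken; together they dominate
  everything that the merged vertex does, and also the apices of both halves. Otherwise the apex
  of the subtree is taken. In either case \<open>k\<close> and \<open>z\<close> are dominated, so that the identification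
  did not hide any undominated vertex.
\<close>

lemma extend_by_contraction:
  assumes iso: "isolating m V' E' S'" and fin: "finite V'"
    and loop: "\<And>x. {x} \<notin> E"
    and V: "V = insert z (V' \<union> set_tree (Node T1 c T2))"
    and k: "k \<in> V'" "{p, q} = {k, z}"
    and T: "tedges p (Node T1 c T2) q \<subseteq> E"
    and touch: "\<And>e. e \<in> E \<Longrightarrow> e \<inter> set_tree (Node T1 c T2) \<noteq> {} \<Longrightarrow> e \<in> tedges p (Node T1 c T2) q"
    and dist: "distinct (p # inorder (Node T1 c T2) @ [q])"
    and s: "size T1 \<le> m + 1" "size T2 \<le> m + 1"
    and e1: "\<And>u w. {u, w} \<in> E' \<Longrightarrow> u \<noteq> k \<Longrightarrow> w \<noteq> k \<Longrightarrow> {u, w} \<in> E"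
    and e2: "\<And>u. {u, k} \<in> E' \<Longrightarrow> {u, k} \<in> E \<or> {u, z} \<in> E"
    and e3: "\<And>u w. {u, w} \<in> E \<Longrightarrow> u \<in> V' - {k} \<Longrightarrow> w \<in> V' - {k} \<Longrightarrow> {u, w} \<in> E'"
  shows "\<exists>g\<in>V. isolating m V E (insert g S')"
proof -
  let ?T = "Node T1 c T2"
  have main: "isolating m V E (insert g S')"
    if g: "g \<in> V" and D: "p \<in> dominated E (insert g S')" "q \<in> dominated E (insert g S')"
      and Q: "scattered m E (dominated E (insert g S')) (set_tree ?T)"
      and kz: "k \<in> S' \<Longrightarrow> g = z" for g
  proof -
    let ?D = "dominated E (insert g S')"
    have kzD: "k \<in> ?D" "z \<in> ?D" using D k(2) by (auto simp: doubleton_eq_iff)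
    have Q': "scattered m E ?D ({k, z} \<union> set_tree ?T)"
      by (rule scattered_Un[OF scattered_dominated Q]) (use kzD in auto)
    have mono: "x \<in> ?D" if xd: "x \<in> dominated E' S'" for x
    proof (cases "x = k \<or> x \<in> S'")
      case True then show ?thesis using kzD by (auto simp: dominated_def)
    next
      case False
      then obtain s where s: "s \<in> S'" "{s, x} \<in> E'" using xd by (auto simp: dominated_def)
      show ?thesis
      proof (cases "s = k")
        case True
        then have "{x, k} \<in> E \<or> {x, z} \<in> E" using e2[of x] s by (simp add: insert_commute)
        moreover have "k \<in> insert g S'" "z \<in> insert g S'" using kz s True by auto
        ultimately show ?thesis by (auto simp: dominated_def insert_commute)
      next
        case nk: False
        then have "{s, x} \<in> E" using e1[OF s(2)] False by auto
        then show ?thesis using s by (auto simp: dominated_def)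
      qed
    qed
    show ?thesis
    proof (rule isolating_extend[OF iso fin _ loop _ Q'])
      show "insert g S' \<subseteq> V" using g iso V by (auto simp: isolating_def)
      show "V \<subseteq> V' \<union> ({k, z} \<union> set_tree ?T)" using V by auto
      show "x \<in> V' \<Longrightarrow> x \<in> dominated E' S' \<Longrightarrow> x \<in> ?D" for x using mono by auto
        fix x y assume x: "x \<in> V' - ?D" "x \<notin> {k, z} \<union> set_tree ?T" and y: "y \<in> V - ?D" "{x, y} \<in> E"
      have "x \<noteq> p" "x \<noteq> q" using D x by auto
      have "y \<notin> set_tree ?T"
      proof
        assume "y \<in> set_tree ?T"
        then have "{x, y} \<in> tedges p ?T q" using touch[OF y(2)] by blast
        then show False using tedges_subset[of "{x,y}" p ?T q] x \<open>x \<noteq> p\<close> \<open>x \<noteq> q\<close> by auto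
      qed
      moreover have "y \<noteq> k" "y \<noteq> z" using y kzD by auto
      ultimately have "y \<in> V' - {k}" using y V by auto
      then show "y \<in> V' \<and> {x, y} \<in> E'" using e3[OF y(2)] x by auto
    qed
  qed
  show ?thesis
  proof (cases "k \<in> S'")
    case True
    let ?D = "dominated E (insert z S')"
    have pq: "p \<in> insert z S'" "q \<in> insert z S'" using True k(2) by (auto simp: doubleton_eq_iff)
    have nb: "y \<in> ?D" if "{x, y} \<in> E" "x \<in> insert z S'" for x y
      using that by (auto simp: dominated_def)
    have "{p, c} \<in> E" using T tedges_base[of p c T1] by auto
    then have c: "c \<in> ?D" using nb pq by blast
    have v1: "size T1 \<le> m \<or> value T1 \<in> ?D"
      using tedges_apex(1)[of T1 p c] T nb[of p] pq by (cases "T1 = Leaf") auto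
    have v2: "size T2 \<le> m \<or> value T2 \<in> ?D"
    proof (cases "T2 = Leaf")
      case False
      then have "{value T2, q} \<in> E"
        using T unfolding tedges.simps by (intro subsetD[OF T]) (simp add: tedges_apex)
      then have "{q, value T2} \<in> E" by (simp add: insert_commute)
      then show ?thesis using nb pq by blast
    qed simp
    have D: "p \<in> ?D" "q \<in> ?D" using pq by (auto simp: dominated_def)
    have "isolating m V E (insert z S')"
      using V by (intro main D scattered_node[OF D c touch dist s v1 v2]) auto
    then show ?thesis using V by blast
  next
    case False
    have g: "guards m p ?T q c" by (simp add: guards_def)
    have "isolating m V E (insert c S')"
      using V False guards_dominates(1,2)[OF g _ T]
      by (intro main scattered_guarded[OF g _ T touch dist s]) auto
    then show ?thesis using V by auto
  qed
qed

section \<open>Positions in a tree\<close>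

text \<open>
  The position of a subtree in a tree is the list of frames met on the way up to the root. Each
  frame records the parent and the sibling. The innermost frame comes first, because the arguments
  look at the parent and the grandparent of the subtree.
\<close>

datatype 'a frame = Is_Left 'a "'a tree" | Is_Right "'a tree" 'a

fun fill :: "'a frame \<Rightarrow> 'a tree \<Rightarrow> 'a tree" where
  "fill (Is_Left z s) t = Node t z s"
| "fill (Is_Right s z) t = Node s z t"

fun sibling :: "'a frame \<Rightarrow> 'a tree" where
  "sibling (Is_Left z s) = s"
| "sibling (Is_Right s z) = s"

fun flabel :: "'a frame \<Rightarrow> 'a" where
  "flabel (Is_Left z s) = z"
| "flabel (Is_Right s z) = z"

fun plug :: "'a frame list \<Rightarrow> 'a tree \<Rightarrow> 'a tree" where
  "plug [] t = t"
| "plug (f # fs) t = plug fs (fill f t)"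

text \<open>
  The base edge of the subtree at a given position joins \<open>lend\<close> and \<open>rend\<close>: the nearest labels to
  its left and to its right.
\<close>

fun lend :: "'a \<Rightarrow> 'a frame list \<Rightarrow> 'a" where
  "lend v [] = v"
| "lend v (Is_Left z s # fs) = lend v fs"
| "lend v (Is_Right s z # fs) = z"

fun rend :: "'a frame list \<Rightarrow> 'a \<Rightarrow> 'a" where
  "rend [] w = w"
| "rend (Is_Left z s # fs) w = z"
| "rend (Is_Right s z # fs) w = rend fs w"

fun outer_edges :: "'a \<Rightarrow> 'a frame list \<Rightarrow> 'a \<Rightarrow> 'a set set" where
  "outer_edges v [] w = {}"
| "outer_edges v (Is_Left z s # fs) w =
     insert {lend v fs, rend fs w} (outer_edges v fs w \<union> tedges z s (rend fs w))"
| "outer_edges v (Is_Right s z # fs) w =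
     insert {lend v fs, rend fs w} (outer_edges v fs w \<union> tedges (lend v fs) s z)"

definition outer_labels :: "'a frame list \<Rightarrow> 'a set" where
  "outer_labels fs = (\<Union>f\<in>set fs. insert (flabel f) (set_tree (sibling f)))"

lemma outer_labels_simps [simp]:
  "outer_labels [] = {}"
  "outer_labels (f # fs) = insert (flabel f) (set_tree (sibling f) \<union> outer_labels fs)"
  by (auto simp: outer_labels_def)

lemma tedges_plug: "tedges v (plug fs t) w = outer_edges v fs w \<union> tedges (lend v fs) t (rend fs w)"
proof (induction fs arbitrary: t)
  case (Cons f fs)
  then show ?case by (cases f) auto
qed simp

lemma set_plug: "set_tree (plug fs t) = outer_labels fs \<union> set_tree t"
proof (induction fs arbitrary: t)
  case (Cons f fs)
  then show ?case by (cases f) auto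
qed simp

lemma size_plug: "size (plug fs t) + size s = size (plug fs s) + size t"
proof (induction fs arbitrary: s t)
  case (Cons f fs)
  have "size (plug fs (fill f t)) + size (fill f s) = size (plug fs (fill f s)) + size (fill f t)"
    by (rule Cons)
  then show ?case by (cases f) auto
qed simp

lemma fill_not_Leaf [simp]: "fill f t \<noteq> Leaf" "Leaf \<noteq> fill f t"
  by (cases f; simp)+

lemma num_cherries_fill:
  "t \<noteq> Leaf \<Longrightarrow> num_cherries (fill f t) = num_cherries t + num_cherries (sibling f)"
  by (cases f) auto

lemma num_cherries_fill_Leaf:
  "num_cherries (fill f Leaf) = (if sibling f = Leaf then 1 else num_cherries (sibling f))"
  by (cases f) auto

lemma num_cherries_plug:
  assumes "t \<noteq> Leaf" "s \<noteq> Leaf"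
  shows "num_cherries (plug fs t) + num_cherries s = num_cherries (plug fs s) + num_cherries t"
  using assms
proof (induction fs arbitrary: s t)
  case (Cons f fs)
  have "num_cherries (plug fs (fill f t)) + num_cherries (fill f s)
      = num_cherries (plug fs (fill f s)) + num_cherries (fill f t)"
    by (rule Cons) auto
  then show ?case using Cons.prems by (simp add: num_cherries_fill)
qed simp

text \<open>
  Replacing a subtree by a leaf creates a cherry exactly when the sibling is a leaf, too.
\<close>

lemma num_cherries_plug_Leaf:
  assumes "t \<noteq> Leaf"
  shows "num_cherries (plug fs Leaf) + num_cherries t \<le>
    num_cherries (plug fs t) + (if fs \<noteq> [] \<and> sibling (hd fs) = Leaf then 1 else 0)"
proof (cases fs)
  case (Cons f gs)
  have "num_cherries (plug gs (fill f t)) + num_cherries (fill f Leaf)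
      = num_cherries (plug gs (fill f Leaf)) + num_cherries (fill f t)"
    by (rule num_cherries_plug) auto
  then show ?thesis using assms Cons
    by (auto simp: num_cherries_fill num_cherries_fill_Leaf)
qed simp

lemma plug_distinct:
  assumes "distinct (v # inorder (plug fs t) @ [w])"
  shows "distinct (lend v fs # inorder t @ [rend fs w])
    \<and> lend v fs \<in> insert v (insert w (outer_labels fs)) \<and> rend fs w \<in> insert v (insert w (outer_labels fs))
    \<and> set_tree t \<inter> insert v (insert w (outer_labels fs)) = {}"
  using assms
proof (induction fs arbitrary: t)
  case (Cons f fs)
  have IH: "distinct (lend v fs # inorder (fill f t) @ [rend fs w])
    \<and> lend v fs \<in> insert v (insert w (outer_labels fs)) \<and> rend fs w \<in> insert v (insert w (outer_labels fs))
    \<and> set_tree (fill f t) \<inter> insert v (insert w (outer_labels fs)) = {}"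
    by (rule Cons.IH) (use Cons.prems in simp)
  show ?case
  proof (cases f)
    case (Is_Left z s)
    then show ?thesis using IH by auto
  next
    case (Is_Right s z)
    then show ?thesis using IH by auto
  qed
qed auto

lemma outer_edges_subset:
  "e \<in> outer_edges v fs w \<Longrightarrow> e \<subseteq> insert v (insert w (outer_labels fs))"
proof (induction fs)
  case (Cons f fs)
  have "lend v fs \<in> insert v (insert w (outer_labels fs))"
    by (induction v fs rule: lend.induct) auto
  moreover have "rend fs w \<in> insert v (insert w (outer_labels fs))"
    by (induction fs w rule: rend.induct) auto
  ultimately show ?case
    using Cons tedges_subset[of e "lend v fs"] tedges_subset[of e _ _ "rend fs w"]
    by (cases f) fastforce+
qed simp

section \<open>Minimal heavy subtrees\<close>

text \<open>
  Here \<open>size t + 1\<close> is the number of leaves. The case \<open>e = 0\<close> serves the bound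
  \<open>n / (k + 4)\<close>, the case \<open>e = 1\<close> the bound \<open>(n + n\<^sub>2) / (k + 5)\<close>.
\<close>

definition weight :: "nat \<Rightarrow> 'a tree \<Rightarrow> nat" where
  "weight e t = size t + 1 + e * num_cherries t"

text \<open>
  Going down to a heavy child as long as there is one ends at a heavy subtree with light halves.
\<close>

lemma minimal_heavy_subtree:
  assumes "weight e t \<ge> M" "M > 1"
  shows "\<exists>fs T1 c T2. t = plug fs (Node T1 c T2) \<and> weight e (Node T1 c T2) \<ge> M
    \<and> weight e T1 < M \<and> weight e T2 < M"
proof -
  have "\<exists>gs T1 c T2. plug fs t = plug gs (Node T1 c T2) \<and> weight e (Node T1 c T2) \<ge> M
    \<and> weight e T1 < M \<and> weight e T2 < M" if "weight e t \<ge> M" for fs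
    using that
  proof (induction t arbitrary: fs)
    case Leaf
    then show ?case using assms(2) by (simp add: weight_def)
  next
    case (Node l c r)
    show ?case
    proof (cases "weight e l \<ge> M")
      case True
      then show ?thesis using Node.IH(1)[of "Is_Left c r # fs"] by simp
    next
      case l: False
      show ?thesis
      proof (cases "weight e r \<ge> M")
        case True
        then show ?thesis using Node.IH(2)[of "Is_Right l c # fs"] by simp
      next
        case False
        then show ?thesis using l Node.prems
          by (intro exI[of _ fs] exI[of _ l] exI[of _ c] exI[of _ r]) auto
      qed
    qed
  qed
  from this[of "[]"] assms(1) show ?thesis by simp
qed

lemma weight_Node:
  "weight e (Node T1 c T2) = weight e T1 + weight e T2 + (if T1 = Leaf \<and> T2 = Leaf then e else 0)"
  by (auto simp: weight_def algebra_simps)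

text \<open>
  A tree other than a leaf has a cherry, which makes up for the larger threshold in the case
  \<open>e = 1\<close>.
\<close>

lemma weight_light_size:
  assumes "weight e T < m + 3 + e" "e \<le> 1"
  shows "size T \<le> m + 1"
proof (cases "T = Leaf")
  case False
  then have "e \<le> e * num_cherries T" using num_cherries_pos[of T] by simp
  then show ?thesis using assms unfolding weight_def by linarith
qed simp

text \<open>
  At the threshold there is not enough weight for both halves to have more than \<open>m\<close> inner
  vertices.
\<close>

lemma end_guards:
  assumes "weight e (Node T1 c T2) = m + 3 + e" "e \<le> 1"
  shows "guards m p (Node T1 c T2) q p \<or> guards m p (Node T1 c T2) q q"
proof (rule ccontr)
  assume "\<not> ?thesis"
  then have s: "size T1 > m" "size T2 > m" by (auto simp: guards_def)
  then have "T1 \<noteq> Leaf" "T2 \<noteq> Leaf" by auto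
  then have "e \<le> e * num_cherries T1" "e \<le> e * num_cherries T2" using num_cherries_pos by auto
  moreover have "weight e T1 + weight e T2 = m + 3 + e"
    using assms(1) \<open>T1 \<noteq> Leaf\<close> by (simp add: weight_Node)
  ultimately show False using s unfolding weight_def by linarith
qed

lemma plug_touch:
  assumes dist: "distinct (x # v # inorder (plug fs t) @ [w])"
    and e: "e \<in> {{x, v}, {x, w}} \<union> tedges v (plug fs t) w" "e \<inter> set_tree t \<noteq> {}"
  shows "e \<in> tedges (lend v fs) t (rend fs w)"
proof -
  have d: "set_tree t \<inter> insert v (insert w (outer_labels fs)) = {}"
    using plug_distinct[of v fs t w] dist by auto
  moreover have "x \<notin> set_tree (plug fs t)" using dist by simp
  then have "x \<notin> set_tree t" unfolding set_plug by blast
  ultimately show ?thesis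
    using e outer_edges_subset[of e v fs w] unfolding tedges_plug by blast
qed

section \<open>Triangulations with a distinguished vertex of degree two\<close>

text \<open>
  A triangulation with a distinguished vertex \<open>x\<close> of degree two, adjacent to the ends \<open>v\<close> and \<open>w\<close>
  of the base edge of \<open>t\<close>. The vertex \<open>x\<close> shields the base edge: unless \<open>t\<close> is a leaf, the
  vertices of degree two are exactly \<open>x\<close> and the cherries of \<open>t\<close> (\<open>pend_degree2\<close>), so that they
  can be counted without looking at the root.
\<close>

definition pend_verts :: "'a \<Rightarrow> 'a \<Rightarrow> 'a tree \<Rightarrow> 'a \<Rightarrow> 'a set" where
  "pend_verts x v t w = {x, v, w} \<union> set_tree t"

definition pend_edges :: "'a \<Rightarrow> 'a \<Rightarrow> 'a tree \<Rightarrow> 'a \<Rightarrow> 'a set set" where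
  "pend_edges x v t w = {{x, v}, {x, w}} \<union> tedges v t w"

text \<open>
  The next four lemmas describe the merging of \<open>z\<close> into the opposite end of a base edge: the
  sibling subtree keeps its shape and only one end of its base edge gets another name.
\<close>

lemma tedges_change_left:
  "{u, u'} \<in> tedges a t b \<Longrightarrow> u \<noteq> a \<Longrightarrow> u' \<noteq> a \<Longrightarrow> {u, u'} \<in> tedges a' t b"
  by (induction t arbitrary: b) (auto simp: doubleton_eq_iff)

lemma tedges_change_right:
  "{u, u'} \<in> tedges a t b \<Longrightarrow> u \<noteq> b \<Longrightarrow> u' \<noteq> b \<Longrightarrow> {u, u'} \<in> tedges a t b'"
  by (induction t arbitrary: a) (auto simp: doubleton_eq_iff)

lemma tedges_move_left:
  "{u, a} \<in> tedges a t b \<Longrightarrow> a \<noteq> b \<Longrightarrow> a \<notin> set_tree t \<Longrightarrow> {u, a'} \<in> tedges a' t b"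
proof (induction t arbitrary: b)
  case Leaf then show ?case by (auto simp: doubleton_eq_iff)
next
  case (Node l c r)
  have "{u, a} \<notin> tedges c r b" using tedges_subset[of "{u, a}" c r b] Node.prems by auto
  then show ?case using Node.prems Node.IH(1)[of c] by (auto simp: doubleton_eq_iff)
qed

lemma tedges_move_right:
  "{u, b} \<in> tedges a t b \<Longrightarrow> a \<noteq> b \<Longrightarrow> b \<notin> set_tree t \<Longrightarrow> {u, b'} \<in> tedges a t b'"
proof (induction t arbitrary: a)
  case Leaf then show ?case by (auto simp: doubleton_eq_iff)
next
  case (Node l c r)
  have "{u, b} \<notin> tedges a l c" using tedges_subset[of "{u, b}" a l c] Node.prems by auto
  then show ?case using Node.prems Node.IH(2)[of c] by (auto simp: doubleton_eq_iff)
qed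

text \<open>
  The third vertex of the triangle on the far side of the base edge.
\<close>

lemma outer_common_neighbour:
  assumes "distinct (v # inorder (plug fs t) @ [w])" "fs \<noteq> []"
  shows "\<exists>y\<in>insert v (insert w (outer_labels fs)). y \<noteq> lend v fs \<and> y \<noteq> rend fs w \<and> y \<notin> set_tree t \<and>
    {lend v fs, y} \<in> outer_edges v fs w \<and> {y, rend fs w} \<in> outer_edges v fs w"
proof -
  obtain f gs where fs: "fs = f # gs" using assms(2) by (cases fs) auto
  have d: "distinct (lend v gs # inorder (fill f t) @ [rend gs w])"
    "lend v gs \<in> insert v (insert w (outer_labels gs))" "rend gs w \<in> insert v (insert w (outer_labels gs))"
    using plug_distinct[of v gs "fill f t" w] assms(1) fs by auto
  show ?thesis
  proof (cases f)
    case (Is_Left z s)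
    have "{z, rend gs w} \<in> tedges z s (rend gs w)" by (rule tedges_base)
    then show ?thesis using d fs Is_Left by (intro bexI[of _ "rend gs w"]) (auto simp: insert_commute)
  next
    case (Is_Right s z)
    have "{lend v gs, z} \<in> tedges (lend v gs) s z" by (rule tedges_base)
    then show ?thesis using d fs Is_Right by (intro bexI[of _ "lend v gs"]) (auto simp: insert_commute)
  qed
qed

lemma num_cherries_mono_plug: "t \<noteq> Leaf \<Longrightarrow> num_cherries t \<le> num_cherries (plug fs t)"
proof (induction fs arbitrary: t)
  case (Cons f fs)
  have "num_cherries t \<le> num_cherries (fill f t)" using Cons.prems by (simp add: num_cherries_fill)
  also have "\<dots> \<le> num_cherries (plug fs (fill f t))" by (rule Cons.IH) simp
  finally show ?case by simp
qed simp

lemma card_insert_le_Suc: "card (insert g S) \<le> card S + 1"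
  by (cases "finite S") (auto simp: card_insert_if)

lemma pend_loop:
  assumes "distinct (x # v # inorder t @ [w])"
  shows "{y} \<notin> pend_edges x v t w"
proof -
  have "card e = 2" if "e \<in> tedges v t w" for e
    using tedges_card2[OF _ that] assms by simp
  then have "{y} \<notin> tedges v t w" by (metis One_nat_def Suc_1 card_1_singleton_iff n_not_Suc_n)
  moreover have "{y} \<noteq> {x, v}" "{y} \<noteq> {x, w}" using assms by auto
  ultimately show ?thesis by (simp add: pend_edges_def)
qed

lemma pend_edges_subset: "e \<in> pend_edges x v t w \<Longrightarrow> e \<subseteq> pend_verts x v t w"
  using tedges_subset[of e v t w] by (auto simp: pend_edges_def pend_verts_def)

lemma card_pend_verts:
  assumes "distinct (x # v # inorder t @ [w])"
  shows "card (pend_verts x v t w) = size t + 3"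
proof -
  have "pend_verts x v t w = set (x # v # inorder t @ [w])"
    by (auto simp: pend_verts_def)
  then have "card (pend_verts x v t w) = length (x # v # inorder t @ [w])"
    using distinct_card[OF assms] by simp
  then show ?thesis by simp
qed

section \<open>Induction over heavy subtrees\<close>

text \<open>
  Apart from the ends of its base edge, at most \<open>m + 1\<close> vertices lie outside a heavy subtree,
  and at most \<open>m\<close> unless its weight is exactly the threshold. In the exceptional case the guard is
  placed at an end of the base edge and dominates one of the \<open>m + 1\<close> vertices, the one just
  beyond the base edge.
\<close>

lemma pend_bound_small:
  assumes dist: "distinct (x # v # inorder t @ [w])" and e: "e \<le> 1"
    and small: "size t + 3 + e * (num_cherries t + 1) < 2 * (m + 3 + e)"
  shows "\<exists>g\<in>pend_verts x v t w. isolating m (pend_verts x v t w) (pend_edges x v t w) {g}"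
proof (cases "weight e t < m + 3 + e")
  case True
  let ?E = "pend_edges x v t w" and ?D = "dominated (pend_edges x v t w) {v}"
  have D: "x \<in> ?D" "v \<in> ?D" "w \<in> ?D"
    using tedges_base[of v w t] by (auto simp: dominated_def pend_edges_def insert_commute)
  have "scattered m ?E ?D (set_tree t)"
  proof (rule scattered_tree[OF D(2,3)])
    show "e' \<in> tedges v t w" if "e' \<in> ?E" "e' \<inter> set_tree t \<noteq> {}" for e'
      using that dist by (auto simp: pend_edges_def)
    show "size t \<le> m \<or> t \<noteq> Leaf \<and> size t \<le> m + 1 \<and> value t \<in> ?D"
    proof (cases "t = Leaf")
      case False
      then have "value t \<in> ?D" using tedges_apex(1)[of t v w] by (auto simp: dominated_def pend_edges_def)
      then show ?thesis using weight_light_size[OF True e] False by simp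
    qed simp
  qed
  then have "scattered m ?E ?D ({x, v, w} \<union> set_tree t)"
    using D by (intro scattered_Un[OF scattered_dominated]) auto
  then have "isolating m (pend_verts x v t w) ?E {v}"
    by (intro isolating_scattered pend_loop[OF dist]) (auto simp: pend_verts_def)
  then show ?thesis by (auto simp: pend_verts_def)
next
  case False
  then obtain fs T1 c T2 where t: "t = plug fs (Node T1 c T2)" and W: "weight e (Node T1 c T2) \<ge> m + 3 + e"
    and W1: "weight e T1 < m + 3 + e" and W2: "weight e T2 < m + 3 + e"
    using minimal_heavy_subtree[of "m + 3 + e" e t] by auto
  let ?T = "Node T1 c T2" and ?E = "pend_edges x v t w" and ?V = "pend_verts x v t w"
  define p q where "p = lend v fs" and "q = rend fs w"
  note s = weight_light_size[OF W1 e] weight_light_size[OF W2 e]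
  have pd: "distinct (p # inorder ?T @ [q])"
    "p \<in> insert v (insert w (outer_labels fs))" "q \<in> insert v (insert w (outer_labels fs))"
    "set_tree ?T \<inter> insert v (insert w (outer_labels fs)) = {}"
    using plug_distinct[of v fs ?T w] dist unfolding t p_def q_def by auto
  have TE: "tedges p ?T q \<subseteq> ?E" unfolding pend_edges_def t tedges_plug p_def q_def by blast
  have touch: "e' \<in> tedges p ?T q" if "e' \<in> ?E" "e' \<inter> set_tree ?T \<noteq> {}" for e'
    using plug_touch[of x v fs ?T w e'] dist that unfolding t p_def q_def pend_edges_def by auto
  have setV: "?V = {x, v, w} \<union> outer_labels fs \<union> set_tree ?T"
    unfolding pend_verts_def t set_plug by blast
  define Q where "Q = ?V - insert p (insert q (set_tree ?T))"
  have "x \<notin> set_tree t" using dist by simp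
  then have xT: "x \<notin> set_tree ?T" unfolding t set_plug by blast
  have pqV: "p \<in> ?V" "q \<in> ?V" using pd setV by auto
  have cardT: "card (set_tree ?T) = size ?T"
    using pd(1) distinct_card[of "inorder ?T"] by (simp del: inorder.simps)
  have "card (insert p (insert q (set_tree ?T))) = size ?T + 2"
    using pd(1) cardT by (simp del: tree.set tree.size inorder.simps)
  moreover have sub: "insert p (insert q (set_tree ?T)) \<subseteq> ?V" using pqV setV by auto
  moreover have "finite ?V" by (simp add: pend_verts_def)
  then have "card Q = card ?V - card (insert p (insert q (set_tree ?T)))"
    "card (insert p (insert q (set_tree ?T))) \<le> card ?V"
    unfolding Q_def using sub by (intro card_Diff_subset card_mono; auto)+
  ultimately have cardQ: "card Q + size ?T + 2 = size t + 3"
    using card_pend_verts[OF dist] by linarith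
  have "num_cherries ?T \<le> num_cherries t" unfolding t by (rule num_cherries_mono_plug) simp
  then have ech: "e * num_cherries ?T \<le> e * num_cherries t" by (rule mult_le_mono2)
  \<comment> \<open>The weight of the subtree beyond the threshold is missing outside.\<close>
  have cQ: "card Q + weight e ?T \<le> 2 * m + 4 + e"
    using cardQ small ech unfolding weight_def add_mult_distrib2 by linarith
  \<comment> \<open>Only a subtree of exactly the threshold weight leaves \<open>m + 1\<close> vertices outside, and then one of
    the ends of its base edge is a possible position of the guard.\<close>
  obtain g where g: "guards m p ?T q g" "card Q \<le> m \<or> card Q \<le> m + 1 \<and> g \<in> {p, q}"
  proof (cases "card Q \<le> m")
    case True
    then show ?thesis by (intro that[of c]) (auto simp: guards_def)
  next
    case False
    then have "weight e ?T = m + 3 + e" "card Q \<le> m + 1" using W cQ by auto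
    then show ?thesis using that end_guards[of e T1 c T2 m p q] e by blast
  qed
  have gV: "g \<in> ?V" using g(1) pqV setV by (auto simp: guards_def)
  let ?D = "dominated ?E {g}"
  have D: "p \<in> ?D" "q \<in> ?D" using guards_dominates(1,2)[OF g(1) _ TE] by auto
  have sT: "scattered m ?E ?D (set_tree ?T)"
    by (rule scattered_guarded[OF g(1) _ TE touch pd(1) s]) simp
  have sQ: "scattered m ?E ?D Q"
  proof (rule scatteredI)
    show "finite Q" by (simp add: Q_def pend_verts_def)
    show "card (Q - ?D) \<le> m"
    proof (cases "card Q \<le> m")
      case True
      then show ?thesis using card_mono[of Q "Q - ?D"] \<open>finite Q\<close> by auto
    next
      case False
      then have g': "card Q \<le> m + 1" "g \<in> {p, q}" using g(2) by auto
      obtain y where y: "y \<in> Q" "{p, y} \<in> ?E" "{y, q} \<in> ?E"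
      proof (cases "fs = []")
        case True
        then have "p = v" "q = w" by (auto simp: p_def q_def)
        then have "{p, x} \<in> ?E" "{x, q} \<in> ?E" "x \<in> Q"
          using dist xT by (auto simp: pend_edges_def insert_commute Q_def pend_verts_def)
        then show ?thesis using that by blast
      next
        case False
        obtain y where "y\<in>insert v (insert w (outer_labels fs))" "y \<noteq> p" "y \<noteq> q" "y \<notin> set_tree ?T"
          "{p, y} \<in> outer_edges v fs w" "{y, q} \<in> outer_edges v fs w"
          using outer_common_neighbour[of v fs ?T w] False dist unfolding p_def q_def t by auto
        then show ?thesis
          using that[of y] setV by (auto simp: Q_def pend_edges_def t tedges_plug simp del: tree.set)
      qed
      then have "y \<in> ?D" using g'(2) by (auto simp: dominated_def insert_commute)
      then have "card (Q - ?D) < card Q" using y(1) \<open>finite Q\<close> by (intro psubset_card_mono) auto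
      then show ?thesis using g' by simp
    qed
    fix u y assume u: "u \<in> Q - ?D" "{u, y} \<in> ?E"
    have "y \<notin> set_tree ?T"
    proof
      assume "y \<in> set_tree ?T"
      then have "{u, y} \<in> tedges p ?T q" using touch[OF u(2)] by blast
      then show False using tedges_subset[of "{u,y}" p ?T q] u by (auto simp: Q_def)
    qed
    moreover have "y \<in> ?V" using pend_edges_subset[OF u(2)] by simp
    ultimately show "y \<in> Q \<union> ?D" using D by (auto simp: Q_def)
  qed
  have "scattered m ?E ?D ({p, q} \<union> (set_tree ?T \<union> Q))"
    by (intro scattered_Un[OF scattered_dominated scattered_Un[OF sT sQ]]) (use D in auto)
  moreover have "?V = {p, q} \<union> (set_tree ?T \<union> Q)" using pqV setV by (auto simp: Q_def)
  ultimately have "isolating m ?V ?E {g}"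
    using gV by (intro isolating_scattered pend_loop[OF dist]) auto
  then show ?thesis using gV by blast
qed

text \<open>
  If the minimal heavy subtree is the whole tree below \<open>x\<close>, there is nothing to contract, but then
  two guards are affordable.
\<close>

lemma pend_reduce_guard_both:
  assumes dist: "distinct (x # v # inorder (Node T1 c T2) @ [w])"
    and s: "size T1 \<le> m + 1" "size T2 \<le> m + 1"
  shows "\<exists>S. isolating m (pend_verts x v (Node T1 c T2) w) (pend_edges x v (Node T1 c T2) w) S \<and> card S \<le> 2"
proof -
  let ?T = "Node T1 c T2"
  let ?E = "pend_edges x v ?T w"
  have g: "guards m v ?T w c" by (simp add: guards_def)
  have TE: "tedges v ?T w \<subseteq> ?E" by (auto simp: pend_edges_def)
  have "isolating m {x} {} {x}" by (simp add: isolating_def dominated_def)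
  then have "isolating m (pend_verts x v ?T w) ?E (insert c {x})"
  proof (rule extend_by_guard[where Z = "{v, w}", OF _ _ pend_loop[OF dist] _ g TE _ _ _ _ s])
    show "e \<in> tedges v ?T w" if "e \<in> ?E" "e \<inter> set_tree ?T \<noteq> {}" for e
      using that dist by (auto simp: pend_edges_def)
    show "{v, w} \<subseteq> dominated ?E {c}"
      using guards_dominates(1,2)[OF g _ TE, of "{c}"] by simp
    show "{x', y'} \<in> {}" if "x' \<in> {x}" "y' \<in> {x}" "{x', y'} \<in> ?E" for x' y'
      using that pend_loop[OF dist, of x] by auto
  qed (use dist in \<open>auto simp: pend_verts_def\<close>)
  then show ?thesis
    by (intro exI[of _ "{c, x}"]) (auto simp: card_insert_if)
qed

text \<open>
  Deleting the subtree and contracting its base edge means to replace the parent by the sibling.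
\<close>

lemma pend_reduce_contract:
  assumes dist: "distinct (x # v # inorder (plug (f # gs) (Node T1 c T2)) @ [w])"
    and s: "size T1 \<le> m + 1" "size T2 \<le> m + 1"
    and iso: "isolating m (pend_verts x v (plug gs (sibling f)) w) (pend_edges x v (plug gs (sibling f)) w) S'"
  shows "\<exists>S. isolating m (pend_verts x v (plug (f # gs) (Node T1 c T2)) w)
      (pend_edges x v (plug (f # gs) (Node T1 c T2)) w) S \<and> card S \<le> card S' + 1"
proof -
  define T where "T = Node T1 c T2"
  define a b where "a = lend v gs" and "b = rend gs w"
  define E where "E = pend_edges x v (plug (f # gs) T) w"
  define V where "V = pend_verts x v (plug (f # gs) T) w"
  define E' where "E' = pend_edges x v (plug gs (sibling f)) w"
  define Q where "Q = {{x, v}, {x, w}} \<union> outer_edges v gs w"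
  define V' where "V' = pend_verts x v (plug gs (sibling f)) w"
  have fin: "finite V'" by (simp add: V'_def pend_verts_def)
  have loop: "{y} \<notin> E" for y unfolding E_def by (rule pend_loop) (use dist in \<open>simp add: T_def\<close>)
  have pd: "distinct (a # inorder (fill f T) @ [b])"
    "a \<in> insert v (insert w (outer_labels gs))" "b \<in> insert v (insert w (outer_labels gs))"
    "set_tree (fill f T) \<inter> insert v (insert w (outer_labels gs)) = {}"
    using plug_distinct[of v gs "fill f T" w] dist unfolding a_def b_def T_def by auto
  have xd: "x \<notin> set_tree (plug gs (fill f T))" using dist by (simp add: T_def)
  have xT: "x \<notin> set_tree (fill f T)" using xd unfolding set_plug by blast
  have touch: "e \<in> tedges (lend v (f # gs)) T (rend (f # gs) w)" if "e \<in> E" "e \<inter> set_tree T \<noteq> {}" for e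
    using plug_touch[of x v "f # gs" T w e] dist that unfolding E_def T_def pend_edges_def by auto
  have V'eq: "V' = {x, v, w} \<union> outer_labels gs \<union> set_tree (sibling f)"
    unfolding V'_def pend_verts_def set_plug by blast
  have E'eq: "E' = Q \<union> tedges a (sibling f) b"
    unfolding E'_def Q_def pend_edges_def tedges_plug a_def b_def by blast
  obtain k z p q N M where kz: "{p, q} = {k, z}" "k \<in> {a, b}" "k \<noteq> z" "z \<notin> V'"
    and Eeq: "E = Q \<union> {{a, b}} \<union> N \<union> tedges p T q" and E'': "E' = Q \<union> M"
    and V: "V = insert z (V' \<union> set_tree T)"
    and pq: "p = lend v (f # gs)" "q = rend (f # gs) w"
    and NM: "\<And>u y. {u, y} \<in> M \<Longrightarrow> u \<noteq> k \<Longrightarrow> y \<noteq> k \<Longrightarrow> {u, y} \<in> N"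
      "\<And>u. {u, k} \<in> M \<Longrightarrow> {u, z} \<in> N"
      "\<And>u y. {u, y} \<in> N \<Longrightarrow> u \<noteq> z \<Longrightarrow> y \<noteq> z \<Longrightarrow> {u, y} \<in> M"
  proof (cases f)
    case (Is_Left z s)
    have d: "a \<noteq> b" "a \<noteq> z" "a \<notin> set_tree s" "z \<notin> V'" using pd xT by (auto simp: Is_Left V'eq)
    show ?thesis
    proof (rule that[of a z a z "tedges z s b" "tedges a s b"])
      show "E = Q \<union> {{a, b}} \<union> tedges z s b \<union> tedges a T z"
        unfolding E_def Q_def pend_edges_def plug.simps tedges_plug a_def b_def Is_Left by auto
      show "V = insert z (V' \<union> set_tree T)"
        unfolding V_def V'eq pend_verts_def plug.simps set_plug by (auto simp: Is_Left)
      show "{u, a} \<in> tedges a s b \<Longrightarrow> {u, z} \<in> tedges z s b" for u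
        using tedges_move_left[of u a s b z] d by blast
    qed (use d E'eq tedges_change_left in \<open>auto simp: Is_Left a_def\<close>)
  next
    case (Is_Right s z)
    have d: "a \<noteq> b" "b \<noteq> z" "b \<notin> set_tree s" "z \<notin> V'" using pd xT by (auto simp: Is_Right V'eq)
    show ?thesis
    proof (rule that[of z b b z "tedges a s z" "tedges a s b"])
      show "E = Q \<union> {{a, b}} \<union> tedges a s z \<union> tedges z T b"
        unfolding E_def Q_def pend_edges_def plug.simps tedges_plug a_def b_def Is_Right by auto
      show "V = insert z (V' \<union> set_tree T)"
        unfolding V_def V'eq pend_verts_def plug.simps set_plug by (auto simp: Is_Right)
      show "{u, b} \<in> tedges a s b \<Longrightarrow> {u, z} \<in> tedges a s z" for u
        using tedges_move_right[of u b a s z] d by blast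
    qed (use d E'eq tedges_change_right in \<open>auto simp: Is_Right b_def\<close>)
  qed
  have "a \<in> V'" "b \<in> V'" using pd(2,3) unfolding V'eq by auto
  moreover have "set_tree T \<inter> V' = {}" using pd(1,4) xT unfolding V'eq by (cases f) auto
  moreover have "distinct (p # inorder T @ [q])"
    using plug_distinct[of v "f # gs" T w] dist unfolding pq T_def by auto
  ultimately have d: "set_tree T \<inter> V' = {}" "k \<in> V'" "distinct (p # inorder T @ [q])"
    using kz(2) by auto
  have T': "tedges p T q \<subseteq> E" using Eeq by blast
  have "\<exists>g\<in>V. isolating m V E (insert g S')"
    unfolding T_def
  proof (rule extend_by_contraction[OF iso[folded V'_def E'_def] fin loop V[unfolded T_def] d(2) kz(1)
          T'[unfolded T_def] touch[folded pq, unfolded T_def] d(3)[unfolded T_def] s])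
    show "{u, y} \<in> E" if "{u, y} \<in> E'" "u \<noteq> k" "y \<noteq> k" for u y
      using that NM(1) unfolding E'' Eeq by blast
    show "{u, k} \<in> E \<or> {u, z} \<in> E" if "{u, k} \<in> E'" for u
      using that NM(2) unfolding E'' Eeq by blast
    show "{u, y} \<in> E'" if uy: "{u, y} \<in> E" "u \<in> V' - {k}" "y \<in> V' - {k}" for u y
    proof -
      have "u \<notin> set_tree T" "u \<noteq> z" "u \<noteq> k" "y \<noteq> z" "y \<noteq> k" using uy(2,3) d(1) kz(4) by auto
      moreover then have "{u, y} \<notin> tedges p T q"
        using tedges_subset[of "{u, y}" p T q] kz(1) by blast
      moreover have "{u, y} \<noteq> {a, b}" using kz(2) \<open>u \<noteq> k\<close> \<open>y \<noteq> k\<close> by (auto simp: doubleton_eq_iff)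
      ultimately show ?thesis using uy(1) NM(3) unfolding Eeq E'' by blast
    qed
  qed auto
  then obtain g where "isolating m V E (insert g S')" by blast
  then show ?thesis unfolding V_def E_def T_def
    by (intro exI[of _ "insert g S'"] conjI card_insert_le_Suc)
qed

text \<open>
  If the sibling and the sibling of the parent are leaves, the contraction would turn the label of
  the grandparent into a vertex of degree two. Here the whole grandparent is replaced by a leaf.
  The two vertices lost in addition are the labels of the parent and of the grandparent, and each
  end of the base edge of the subtree dominates them both.
\<close>

lemma pend_reduce_cut:
  assumes dist: "distinct (x # v # inorder (plug (f # h # gs) (Node T1 c T2)) @ [w])"
    and s: "size T1 \<le> m + 1" "size T2 \<le> m + 1"
    and sib: "sibling f = Leaf" "sibling h = Leaf"
    and g: "guards m (lend v (f # h # gs)) (Node T1 c T2) (rend (f # h # gs) w) g"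
      "g \<in> {lend v (f # h # gs), rend (f # h # gs) w}"
    and iso: "isolating m (pend_verts x v (plug gs Leaf) w) (pend_edges x v (plug gs Leaf) w) S'"
  shows "\<exists>S. isolating m (pend_verts x v (plug (f # h # gs) (Node T1 c T2)) w)
      (pend_edges x v (plug (f # h # gs) (Node T1 c T2)) w) S \<and> card S \<le> card S' + 1"
proof -
  define T where "T = Node T1 c T2"
  define a b where "a = lend v gs" and "b = rend gs w"
  define p q where "p = lend v (f # h # gs)" and "q = rend (f # h # gs) w"
  define E where "E = pend_edges x v (plug (f # h # gs) T) w"
  define V where "V = pend_verts x v (plug (f # h # gs) T) w"
  define E' where "E' = pend_edges x v (plug gs Leaf) w"
  define Q where "Q = {{x, v}, {x, w}} \<union> outer_edges v gs w"
  define V' where "V' = pend_verts x v (plug gs Leaf) w"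
  define Z where "Z = {flabel f, flabel h}"
  have fin: "finite V'" by (simp add: V'_def pend_verts_def)
  have loop: "{y} \<notin> E" for y unfolding E_def by (rule pend_loop) (use dist in \<open>simp add: T_def\<close>)
  have pd: "distinct (a # inorder (fill h (fill f T)) @ [b])"
    "a \<in> insert v (insert w (outer_labels gs))" "b \<in> insert v (insert w (outer_labels gs))"
    "set_tree (fill h (fill f T)) \<inter> insert v (insert w (outer_labels gs)) = {}"
    using plug_distinct[of v gs "fill h (fill f T)" w] dist unfolding a_def b_def T_def by auto
  have xd: "x \<notin> set_tree (plug gs (fill h (fill f T)))" using dist by (simp add: T_def)
  have xT: "x \<notin> set_tree (fill h (fill f T))" using xd unfolding set_plug by blast
  have touch: "e \<in> tedges p T q" if "e \<in> E" "e \<inter> set_tree T \<noteq> {}" for e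
    using plug_touch[of x v "f # h # gs" T w e] dist that unfolding E_def T_def pend_edges_def p_def q_def by auto
  have V'eq: "V' = {x, v, w} \<union> outer_labels gs"
    unfolding V'_def pend_verts_def set_plug by auto
  have E'eq: "E' = Q \<union> {{a, b}}"
    unfolding E'_def Q_def pend_edges_def tedges_plug a_def b_def by auto
  have Eeq: "E = Q \<union> tedges a (fill h (fill f T)) b"
    unfolding E_def Q_def pend_edges_def plug.simps tedges_plug a_def b_def by blast
  have ab: "{a, b} \<in> E" unfolding Eeq by (simp add: tedges_base)
  have Veq: "V = V' \<union> Z \<union> set_tree T"
    unfolding V_def V'eq pend_verts_def plug.simps set_plug Z_def using sib by (cases f; cases h) auto
  have pq: "p \<in> insert a (insert b Z)" "q \<in> insert a (insert b Z)"
    unfolding p_def q_def Z_def a_def b_def by (cases f; cases h; auto)+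
  have dT: "distinct (p # inorder T @ [q])"
    using plug_distinct[of v "f # h # gs" T w] dist unfolding p_def q_def T_def by auto
  have TE: "tedges p T q \<subseteq> E"
    unfolding E_def pend_edges_def tedges_plug p_def q_def by blast
  have abV: "a \<in> V'" "b \<in> V'" using pd by (auto simp: V'eq)
  have disj: "(Z \<union> set_tree T) \<inter> V' = {}"
    using pd(4) xT unfolding V'eq Z_def by (cases f; cases h) auto
  have ZD: "Z \<subseteq> dominated E {g}"
  proof -
    have pqE: "{p, q} \<in> E" using TE tedges_base[of p q T] by blast
    \<comment> \<open>The parent is itself an end of the base edge, and the grandparent is at one end of the triangle beyond.\<close>
    have f: "flabel f \<in> {p, q}"
      unfolding p_def q_def by (cases f) auto
    have h: "flabel h \<in> {p, q} \<or> {p, flabel h} \<in> E \<and> {q, flabel h} \<in> E"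
    proof (cases f)
      case f: (Is_Left z t)
      show ?thesis
      proof (cases h)
        case (Is_Left y t')
        then have "p = a" "q = z" "{a, y} \<in> E" "{z, y} \<in> E"
          using f sib by (auto simp: p_def q_def a_def Eeq)
        then show ?thesis using Is_Left by simp
      qed (use f in \<open>simp add: p_def\<close>)
    next
      case f: (Is_Right t z)
      show ?thesis
      proof (cases h)
        case (Is_Right t' y)
        then have "q = b" "p = z" "{y, b} \<in> E" "{y, z} \<in> E"
          using f sib by (auto simp: p_def q_def b_def Eeq)
        then show ?thesis using Is_Right by (simp add: insert_commute)
      qed (use f in \<open>simp add: q_def\<close>)
    qed
    have gpq: "g \<in> {p, q}" using g(2) by (simp add: p_def q_def)
    have "y = g \<or> {g, y} \<in> E" if "y \<in> {p, q} \<or> {p, y} \<in> E \<and> {q, y} \<in> E" for y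
      using that pqE gpq by (auto simp: insert_commute)
    then have "flabel f = g \<or> {g, flabel f} \<in> E" "flabel h = g \<or> {g, flabel h} \<in> E"
      using f h by blast+
    then show ?thesis by (auto simp: Z_def dominated_def)
  qed
  have "isolating m V E (insert g S')"
    unfolding T_def
  proof (rule extend_by_guard[OF iso[folded V'_def E'_def] fin loop Veq[unfolded T_def]
          g(1)[folded p_def q_def] TE[unfolded T_def] _ _ touch[unfolded T_def] dT[unfolded T_def] s ZD])
    show "p \<in> V' \<union> Z" "q \<in> V' \<union> Z" using pq abV by auto
    show "E' \<subseteq> E" using ab unfolding E'eq Eeq by blast
    show "{u, y} \<in> E'" if "u \<in> V'" "y \<in> V'" "{u, y} \<in> E" for u y
    proof (cases "{u, y} \<in> tedges a (fill h (fill f T)) b")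
      case True
      have "u \<noteq> y" using loop[of u] that(3) by auto
      moreover have "flabel f \<in> {p, q}" unfolding p_def q_def by (cases f) auto
      moreover have uy: "u \<notin> Z \<union> set_tree T" "y \<notin> Z \<union> set_tree T" using that(1,2) disj by auto
      ultimately have "{u, y} \<notin> tedges p T q"
        using tedges_subset[of "{u, y}" p T q] by (auto simp: Z_def)
      then have "{u, y} = {a, b}"
        using True sib uy unfolding p_def q_def a_def b_def Z_def
        by (cases f; cases h) (auto simp: doubleton_eq_iff)
      then show ?thesis by (simp add: E'eq)
    next
      case False
      then show ?thesis using that(3) unfolding Eeq E'eq by blast
    qed
  qed auto
  then show ?thesis unfolding V_def E_def T_def
    by (intro exI[of _ "insert g S'"] conjI card_insert_le_Suc)
qed

lemma inorder_plug: "\<exists>xs ys. \<forall>t. inorder (plug fs t) = xs @ inorder t @ ys"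
proof (induction fs)
  case Nil
  show ?case by (rule exI[of _ "[]"], rule exI[of _ "[]"]) simp
next
  case (Cons f fs)
  then obtain xs ys where "\<forall>t. inorder (plug fs t) = xs @ inorder t @ ys" by blast
  then show ?case
    by (cases f) (force intro: exI[of _ "xs"] exI[of _ "xs @ inorder _ @ [_]"])+
qed

lemma distinct_plug:
  "distinct (inorder (plug fs t)) \<longleftrightarrow>
    distinct (inorder (plug fs Leaf)) \<and> distinct (inorder t) \<and> set_tree t \<inter> outer_labels fs = {}"
proof -
  obtain xs ys where i: "\<forall>t. inorder (plug fs t) = xs @ inorder t @ ys" using inorder_plug[of fs] by blast
  have "set_tree (plug fs Leaf) = set xs \<union> set ys"
    using i by (metis set_inorder set_append inorder.simps(1) append_Nil)
  then have "outer_labels fs = set xs \<union> set ys" by (simp add: set_plug)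
  then show ?thesis using i by auto
qed

text \<open>
  Each step costs one guard and reduces \<open>n\<close>, or \<open>n\<close> plus the number of vertices of degree two, by
  at least the threshold \<open>m + 3 + e\<close>.
\<close>

lemma pend_bound:
  assumes "distinct (x # v # inorder t @ [w])" "e \<le> 1"
  shows "\<exists>S. isolating m (pend_verts x v t w) (pend_edges x v t w) S \<and>
    card S \<le> max 1 ((size t + 3 + e * (num_cherries t + 1)) div (m + 3 + e))"
  using assms(1)
proof (induction "size t" arbitrary: t rule: less_induct)
  case less
  define M where "M = m + 3 + e"
  define \<Phi> where "\<Phi> s = size s + 3 + e * (num_cherries s + 1)" for s :: "'a tree"
  note dist = less.prems
  have "\<exists>S. isolating m (pend_verts x v t w) (pend_edges x v t w) S \<and> card S \<le> max 1 (\<Phi> t div M)"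
  proof (cases "\<Phi> t < 2 * M")
    case True
    then obtain g where "isolating m (pend_verts x v t w) (pend_edges x v t w) {g}"
      using pend_bound_small[OF dist assms(2), of m] by (auto simp: \<Phi>_def M_def)
    then show ?thesis by (intro exI[of _ "{g}"]) auto
  next
    case False
    then have big: "\<Phi> t \<ge> 2 * M" by simp
    have M0: "M > 0" by (simp add: M_def)
    have two: "2 \<le> \<Phi> t div M" using big M0 by (metis div_le_mono nonzero_mult_div_cancel_right not_gr0)
    have step: "card S \<le> max 1 (\<Phi> t div M)"
      if "card S \<le> card S' + 1" "card S' \<le> max 1 (\<Phi> t' div M)" "\<Phi> t' + M \<le> \<Phi> t" for S S' :: "'a set" and t'
    proof -
      have "\<Phi> t' div M + 1 = (\<Phi> t' + M) div M" using M0 by (simp add: div_add_self2)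
      also have "\<dots> \<le> \<Phi> t div M" using that(3) by (rule div_le_mono)
      finally show ?thesis using that two by linarith
    qed
    have "weight e t + 2 + e = \<Phi> t" by (simp add: weight_def \<Phi>_def)
    then have "weight e t \<ge> M" using big by (simp add: M_def)
    then obtain fs T1 c T2 where t: "t = plug fs (Node T1 c T2)" and W: "weight e (Node T1 c T2) \<ge> M"
      and W1: "weight e T1 < M" and W2: "weight e T2 < M"
      using minimal_heavy_subtree[of M e t] by (auto simp: M_def)
    let ?T = "Node T1 c T2"
    note s = weight_light_size[OF W1[unfolded M_def] assms(2)] weight_light_size[OF W2[unfolded M_def] assms(2)]
    have WT: "size ?T + 1 + e * num_cherries ?T = weight e ?T" by (simp only: weight_def)
    show ?thesis
    proof (cases fs)
      case Nil
      then show ?thesis using pend_reduce_guard_both[OF dist[unfolded t Nil plug.simps] s] two t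
        by auto
    next
      case (Cons f gs)
      have szT: "size t = size (plug gs (sibling f)) + size ?T + 1"
        using size_plug[of gs "fill f ?T" "sibling f"] by (cases f) (auto simp: t Cons)
      show ?thesis
      \<comment> \<open>The contraction reduces the count by less than \<open>M\<close> only if the subtree has weight exactly \<open>M\<close> and
        a new cherry arises.\<close>
      proof (cases "e = 1 \<and> weight e ?T = M \<and> sibling f = Leaf \<and> gs \<noteq> [] \<and> sibling (hd gs) = Leaf")
        case False
        let ?t' = "plug gs (sibling f)"
        have nT: "num_cherries (fill f ?T) = num_cherries ?T + num_cherries (sibling f)"
          by (rule num_cherries_fill) simp
        have "\<Phi> ?t' + M \<le> \<Phi> t"
        proof (cases "sibling f = Leaf")
          case False
          then have "num_cherries t = num_cherries ?t' + num_cherries ?T"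
            using num_cherries_plug[of "fill f ?T" "sibling f" gs] nT unfolding t Cons by simp
          then show ?thesis using szT W WT by (simp add: \<Phi>_def algebra_simps del: num_cherries.simps tree.size)
        next
          case True
          then have *: "num_cherries ?t' + num_cherries ?T \<le> num_cherries t
              + (if gs \<noteq> [] \<and> sibling (hd gs) = Leaf then 1 else 0)"
            using num_cherries_plug_Leaf[of "fill f ?T" gs] nT unfolding t Cons by simp
          show ?thesis
          proof (cases "e = 0")
            case True
            then show ?thesis using szT W WT by (simp add: \<Phi>_def del: num_cherries.simps tree.size)
          next
            case e: False
            then have "e = 1" using assms(2) by simp
            then show ?thesis using szT W WT * False \<open>sibling f = Leaf\<close>
              by (auto simp: \<Phi>_def simp del: num_cherries.simps tree.size split: if_splits)
          qed
        qed
        moreover have dt: "distinct (x # v # inorder ?t' @ [w])"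
          using dist distinct_plug[of gs "fill f ?T"] distinct_plug[of gs "sibling f"] unfolding t Cons
          by (cases f) (auto simp: set_plug)
        ultimately have "\<Phi> ?t' + M \<le> \<Phi> t" by simp
        obtain S' where S': "isolating m (pend_verts x v ?t' w) (pend_edges x v ?t' w) S'"
          "card S' \<le> max 1 (\<Phi> ?t' div M)"
          using less.hyps[of ?t'] szT dt unfolding \<Phi>_def M_def by auto
        obtain S where S: "isolating m (pend_verts x v t w) (pend_edges x v t w) S" "card S \<le> card S' + 1"
          using pend_reduce_contract[OF dist[unfolded t Cons] s S'(1)] unfolding t Cons by blast
        then show ?thesis using step[OF S(2) S'(2) \<open>\<Phi> ?t' + M \<le> \<Phi> t\<close>] by blast
      next
        case True
        then obtain h hs where gs: "gs = h # hs" by (cases gs) auto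
        have sib: "sibling f = Leaf" "sibling h = Leaf" and e: "e = 1" and Weq: "weight e ?T = M"
          using True gs by auto
        let ?t' = "plug hs Leaf"
        have sz: "size t = size ?t' + size ?T + 2"
          using size_plug[of hs "fill h (fill f ?T)" Leaf] sib by (cases f; cases h) (auto simp: t Cons gs)
        have "num_cherries (fill h (fill f ?T)) = num_cherries ?T"
          using num_cherries_fill[of ?T f] num_cherries_fill[of "fill f ?T" h] sib by simp
        then have "num_cherries ?t' + num_cherries ?T \<le> num_cherries t + 1"
          using num_cherries_plug_Leaf[of "fill h (fill f ?T)" hs] unfolding t Cons gs
          by (auto split: if_splits)
        then have \<Phi>: "\<Phi> ?t' + M \<le> \<Phi> t"
          using sz Weq WT by (auto simp: \<Phi>_def e simp del: num_cherries.simps tree.size)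
        have dt: "distinct (x # v # inorder ?t' @ [w])"
          using dist distinct_plug[of hs "fill h (fill f ?T)"] unfolding t Cons gs
          by (auto simp: set_plug)
        obtain S' where S': "isolating m (pend_verts x v ?t' w) (pend_edges x v ?t' w) S'"
          "card S' \<le> max 1 (\<Phi> ?t' div M)"
          using less.hyps[of ?t'] sz dt unfolding \<Phi>_def M_def by auto
        obtain g where g: "guards m (lend v (f # h # hs)) ?T (rend (f # h # hs) w) g"
          "g \<in> {lend v (f # h # hs), rend (f # h # hs) w}"
          using end_guards[OF Weq[unfolded M_def] assms(2)] by blast
        obtain S where S: "isolating m (pend_verts x v t w) (pend_edges x v t w) S" "card S \<le> card S' + 1"
          using pend_reduce_cut[OF dist[unfolded t Cons gs] s sib g S'(1)] unfolding t Cons gs by blast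
        then show ?thesis using step[OF S(2) S'(2) \<Phi>] by blast
      qed
    qed
  qed
  then show ?case by (simp add: \<Phi>_def M_def)
qed

section \<open>Changing the base edge\<close>

text \<open>
  Two trees \<open>t\<close> and \<open>u\<close> are glued along \<open>ab\<close>. Replacing the base edge of \<open>t\<close> by another side of
  its root triangle shifts this triangle, and what hangs on its third side, from \<open>t\<close> to \<open>u\<close>. When
  \<open>t\<close> has shrunk to a single triangle, the apex of this triangle serves as \<open>x\<close>.
\<close>

lemma reroot:
  assumes "distinct (a # inorder t @ b # inorder u)" "t \<noteq> Leaf"
  shows "\<exists>x v s w. distinct (x # v # inorder s @ [w]) \<and>
    tedges a t b \<union> tedges b u a = pend_edges x v s w \<and>
    {a, b} \<union> set_tree t \<union> set_tree u = pend_verts x v s w"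
  using assms
proof (induction t arbitrary: a b u)
  case (Node l c r)
  have ab: "{a, b} \<in> tedges b u a" using tedges_base[of b a u] by (simp add: insert_commute)
  consider "l \<noteq> Leaf" | "l = Leaf" "r \<noteq> Leaf" | "l = Leaf" "r = Leaf" by blast
  then show ?case
  proof cases
    case 1
    have "\<exists>x v s w. distinct (x # v # inorder s @ [w]) \<and>
      tedges a l c \<union> tedges c (Node r b u) a = pend_edges x v s w \<and>
      {a, c} \<union> set_tree l \<union> set_tree (Node r b u) = pend_verts x v s w"
      by (rule Node.IH(1)) (use Node.prems 1 in auto)
    moreover have "tedges a (Node l c r) b \<union> tedges b u a = tedges a l c \<union> tedges c (Node r b u) a"
      using ab tedges_base[of a c l] by (auto simp: insert_commute)
    moreover have "{a, b} \<union> set_tree (Node l c r) \<union> set_tree u = {a, c} \<union> set_tree l \<union> set_tree (Node r b u)"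
      by auto
    ultimately show ?thesis by metis
  next
    case 2
    have "\<exists>x v s w. distinct (x # v # inorder s @ [w]) \<and>
      tedges c r b \<union> tedges b (Node u a Leaf) c = pend_edges x v s w \<and>
      {c, b} \<union> set_tree r \<union> set_tree (Node u a Leaf) = pend_verts x v s w"
      by (rule Node.IH(2)) (use Node.prems 2 in auto)
    moreover have "tedges a (Node l c r) b \<union> tedges b u a = tedges c r b \<union> tedges b (Node u a Leaf) c"
      using ab tedges_base[of c b r] 2 by (auto simp: insert_commute)
    moreover have "{a, b} \<union> set_tree (Node l c r) \<union> set_tree u = {c, b} \<union> set_tree r \<union> set_tree (Node u a Leaf)"
      using 2 by auto
    ultimately show ?thesis by metis
  next
    case 3
    then show ?thesis using Node.prems ab
      by (intro exI[of _ c] exI[of _ b] exI[of _ u] exI[of _ a])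
        (auto simp: pend_edges_def pend_verts_def insert_commute)
  qed
qed simp

lemma reroot_pend:
  assumes "distinct (a # inorder t @ [b])" "t \<noteq> Leaf"
  obtains x v s w where "distinct (x # v # inorder s @ [w])"
    "tedges a t b = pend_edges x v s w" "insert a (insert b (set_tree t)) = pend_verts x v s w"
proof -
  have "tedges a t b \<union> tedges b Leaf a = tedges a t b"
    using tedges_base[of a b t] by (auto simp: insert_commute)
  then show thesis using reroot[of a t b Leaf] assms that by auto
qed

lemma tree_bound:
  assumes dist: "distinct (a # inorder t @ [b])"
  shows "\<exists>S. isolating m (insert a (insert b (set_tree t))) (tedges a t b) S \<and>
    card S \<le> max 1 ((size t + 2) div (m + 3))"
proof (cases "t = Leaf")
  case True
  then have "isolating m (insert a (insert b (set_tree t))) (tedges a t b) {a}"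
    by (auto simp: isolating_def dominated_def)
  then show ?thesis by (intro exI[of _ "{a}"]) auto
next
  case False
  obtain x v s w where r: "distinct (x # v # inorder s @ [w])"
    "tedges a t b = pend_edges x v s w" "insert a (insert b (set_tree t)) = pend_verts x v s w"
    using reroot_pend[OF dist False] .
  have "insert a (insert b (set_tree t)) = set (a # inorder t @ [b])" by auto
  then have "card (insert a (insert b (set_tree t))) = size t + 2"
    using distinct_card[OF dist] by simp
  then have sz: "size t + 2 = size s + 3" using card_pend_verts[OF r(1)] r(3) by simp
  show ?thesis using pend_bound[OF r(1), of 0 m] unfolding r(2,3) sz by simp
qed

section \<open>Vertices of degree two\<close>

definition nbrs :: "'a set set \<Rightarrow> 'a \<Rightarrow> 'a set" where
  "nbrs E y = {u. {u, y} \<in> E}"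

lemma nbrs_Un: "nbrs (E \<union> F) y = nbrs E y \<union> nbrs F y"
  by (auto simp: nbrs_def)

lemma nbrs_insert: "nbrs (insert {a, b} E) y = (if y = a then {b} else {}) \<union> (if y = b then {a} else {}) \<union> nbrs E y"
  by (auto simp: nbrs_def doubleton_eq_iff)

lemma nbrs_outside: "y \<notin> insert a (insert b (set_tree t)) \<Longrightarrow> nbrs (tedges a t b) y = {}"
  using tedges_subset[of _ a t b] by (fastforce simp: nbrs_def)

lemma cherries_subset: "cherries t \<subseteq> set_tree t"
  by (induction t) auto

lemma card_cherries: "distinct (inorder t) \<Longrightarrow> card (cherries t) = num_cherries t"
proof (induction t)
  case (Node l c r)
  have "cherries l \<inter> cherries r = {}"
    using Node.prems cherries_subset[of l] cherries_subset[of r] by auto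
  moreover have "finite (cherries l)" "finite (cherries r)"
    by (meson cherries_subset finite_set_tree finite_subset)+
  ultimately show ?case using Node by (auto simp: card_Un_disjoint)
qed simp

lemma nbrs_Node_left:
  assumes "distinct (a # inorder (Node l c r) @ [b])" "y \<in> set_tree l"
  shows "nbrs (tedges a (Node l c r) b) y = nbrs (tedges a l c) y"
proof -
  have "nbrs (tedges c r b) y = {}" using assms by (intro nbrs_outside) auto
  then show ?thesis using assms by (auto simp: nbrs_insert nbrs_Un)
qed

lemma nbrs_Node_right:
  assumes "distinct (a # inorder (Node l c r) @ [b])" "y \<in> set_tree r"
  shows "nbrs (tedges a (Node l c r) b) y = nbrs (tedges c r b) y"
proof -
  have "nbrs (tedges a l c) y = {}" using assms by (intro nbrs_outside) auto
  then show ?thesis using assms by (auto simp: nbrs_insert nbrs_Un)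
qed

lemma finite_nbrs: "finite (nbrs (tedges a t b) y)"
proof (rule finite_subset)
  show "nbrs (tedges a t b) y \<subseteq> insert a (insert b (set_tree t))"
    using tedges_subset[of _ a t b] by (fastforce simp: nbrs_def)
qed auto

lemma nbrs_cherry:
  assumes "distinct (a # inorder t @ [b])" "y \<in> cherries t"
  shows "card (nbrs (tedges a t b) y) = 2 \<and> nbrs (tedges a t b) y \<inter> cherries t = {}"
  using assms
proof (induction t arbitrary: a b)
  case (Node l c r)
  have d: "distinct (a # inorder l @ [c])" "distinct (c # inorder r @ [b])" using Node.prems(1) by auto
  have sub: "nbrs (tedges p t q) y \<subseteq> insert p (insert q (set_tree t))" for p q t
    using tedges_subset[of _ p t q] by (fastforce simp: nbrs_def)
  consider "l = Leaf" "r = Leaf" "y = c" | "y \<in> cherries l" | "y \<in> cherries r"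
    using Node.prems(2) by (auto split: if_splits)
  then show ?case
  proof cases
    case 1
    then have "nbrs (tedges a (Node l c r) b) y = {a, b}"
      using Node.prems(1) by (auto simp: nbrs_def doubleton_eq_iff)
    then show ?thesis using Node.prems(1) 1 by auto
  next
    case 2
    then have "nbrs (tedges a (Node l c r) b) y = nbrs (tedges a l c) y" "l \<noteq> Leaf"
      using nbrs_Node_left[OF Node.prems(1), of y] cherries_subset[of l] by auto
    moreover have "insert a (insert c (set_tree l)) \<inter> cherries r = {}"
      using Node.prems(1) cherries_subset[of r] by auto
    ultimately show ?thesis using Node.IH(1)[OF d(1) 2] sub[of a l c] by auto
  next
    case 3
    then have "nbrs (tedges a (Node l c r) b) y = nbrs (tedges c r b) y" "r \<noteq> Leaf"
      using nbrs_Node_right[OF Node.prems(1), of y] cherries_subset[of r] by auto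
    moreover have "insert c (insert b (set_tree r)) \<inter> cherries l = {}"
      using Node.prems(1) cherries_subset[of l] by auto
    ultimately show ?thesis using Node.IH(2)[OF d(2) 3] sub[of c r b] by auto
  qed
qed simp

lemma three_le_card: "finite A \<Longrightarrow> {p, q, r} \<subseteq> A \<Longrightarrow> p \<noteq> q \<Longrightarrow> p \<noteq> r \<Longrightarrow> q \<noteq> r \<Longrightarrow> 3 \<le> card A"
  using card_mono[of A "{p, q, r}"] by simp

lemma degree_not_cherry:
  assumes "distinct (a # inorder t @ [b])" "y \<in> set_tree t" "y \<notin> cherries t"
  shows "card (nbrs (tedges a t b) y) \<ge> 3"
  using assms
proof (induction t arbitrary: a b)
  case (Node l c r)
  have d: "distinct (a # inorder l @ [c])" "distinct (c # inorder r @ [b])" using Node.prems(1) by auto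
  consider "y = c" "l \<noteq> Leaf" | "y = c" "r \<noteq> Leaf" | "y \<in> set_tree l" "y \<notin> cherries l" | "y \<in> set_tree r" "y \<notin> cherries r"
    using Node.prems(2,3) by (auto split: if_splits)
  then show ?case
  proof cases
    case 1
    have "{a, b, value l} \<subseteq> nbrs (tedges a (Node l c r) b) y"
      using tedges_base[of a c l] tedges_base[of c b r] tedges_apex(2)[OF 1(2), of c a] 1
      by (auto simp: nbrs_def insert_commute)
    moreover have "value l \<noteq> a" "value l \<noteq> b" "a \<noteq> b"
      using value_in_set[OF 1(2)] Node.prems(1) by auto
    ultimately show ?thesis by (intro three_le_card[OF finite_nbrs, of a b "value l"]) blast+
  next
    case 2
    have "{a, b, value r} \<subseteq> nbrs (tedges a (Node l c r) b) y"
      using tedges_base[of a c l] tedges_base[of c b r] tedges_apex(1)[OF 2(2), of c b] 2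
      by (auto simp: nbrs_def insert_commute)
    moreover have "value r \<noteq> a" "value r \<noteq> b" "a \<noteq> b"
      using value_in_set[OF 2(2)] Node.prems(1) by auto
    ultimately show ?thesis by (intro three_le_card[OF finite_nbrs, of a b "value r"]) blast+
  next
    case 3
    then show ?thesis using Node.IH(1)[OF d(1)] nbrs_Node_left[OF Node.prems(1), of y] by auto
  next
    case 4
    then show ?thesis using Node.IH(2)[OF d(2)] nbrs_Node_right[OF Node.prems(1), of y] by auto
  qed
qed simp

lemma nbrs_pend:
  "nbrs (pend_edges x v t w) y = (if y = x then {v, w} else {}) \<union> (if y = v \<or> y = w then {x} else {})
    \<union> nbrs (tedges v t w) y"
  by (auto simp: pend_edges_def nbrs_def doubleton_eq_iff)

lemma nbrs_pend_cherry:
  assumes "distinct (x # v # inorder t @ [w])" "y \<in> insert x (cherries t)"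
  shows "card (nbrs (pend_edges x v t w) y) = 2 \<and> nbrs (pend_edges x v t w) y \<inter> insert x (cherries t) = {}"
proof (cases "y = x")
  case True
  have "nbrs (tedges v t w) x = {}" using assms(1) by (intro nbrs_outside) auto
  then have "nbrs (pend_edges x v t w) y = {v, w}" using assms(1) True by (auto simp: nbrs_pend)
  then show ?thesis using assms(1) cherries_subset[of t] by auto
next
  case False
  then have y: "y \<in> cherries t" using assms(2) by simp
  then have "nbrs (pend_edges x v t w) y = nbrs (tedges v t w) y"
    using False assms(1) cherries_subset[of t] by (auto simp: nbrs_pend)
  moreover have "x \<notin> nbrs (tedges v t w) y"
    using tedges_subset[of "{x, y}" v t w] assms(1) by (auto simp: nbrs_def)
  moreover have "distinct (v # inorder t @ [w])" using assms(1) by simp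
  ultimately show ?thesis using nbrs_cherry[OF _ y, of v w] by simp
qed

lemma pend_degree2:
  assumes dist: "distinct (x # v # inorder t @ [w])" and t: "t \<noteq> Leaf"
  shows "{y \<in> pend_verts x v t w. card (nbrs (pend_edges x v t w) y) = 2} = insert x (cherries t)"
proof -
  let ?E = "pend_edges x v t w"
  have fin: "finite (nbrs ?E y)" for y
    unfolding nbrs_pend using finite_nbrs[of v t w y] by simp
  have "{value t, v} \<in> tedges v t w" "{w, v} \<in> tedges v t w"
    by (subst insert_commute, rule tedges_apex(1)[OF t], subst insert_commute, rule tedges_base)
  then have "{x, w, value t} \<subseteq> nbrs ?E v" "{x, v, value t} \<subseteq> nbrs ?E w"
    using tedges_apex(2)[OF t, of w v] tedges_base[of v w t] by (simp_all add: nbrs_def pend_edges_def)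
  then have vw: "card (nbrs ?E v) \<ge> 3" "card (nbrs ?E w) \<ge> 3"
    using value_in_set[OF t] dist by (intro three_le_card[OF fin, of x w "value t"]
        three_le_card[OF fin, of x v "value t"]; auto)+
  have c: "y \<in> insert x (cherries t) \<Longrightarrow> card (nbrs ?E y) = 2" for y
    using nbrs_pend_cherry[OF dist] by blast
  have nc: "card (nbrs ?E y) \<ge> 3" if "y \<in> set_tree t" "y \<notin> cherries t" for y
  proof -
    have "nbrs ?E y = nbrs (tedges v t w) y" using that(1) dist by (auto simp: nbrs_pend)
    moreover have "distinct (v # inorder t @ [w])" using dist by simp
    ultimately show ?thesis using degree_not_cherry[OF _ that] by simp
  qed
  show ?thesis
    using vw c nc cherries_subset[of t] by (force simp: pend_verts_def)
qed

section \<open>Deleting the vertices of degree two\<close>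

fun prune :: "'a tree \<Rightarrow> 'a tree" where
  "prune Leaf = Leaf"
| "prune (Node l c r) = (if l = Leaf \<and> r = Leaf then Leaf else Node (prune l) c (prune r))"

lemma size_prune: "size (prune t) + num_cherries t = size t"
  by (induction t) auto

lemma num_cherries_le_prune: "num_cherries t \<le> size (prune t) + 1"
proof (induction t)
  case (Node l c r)
  then show ?case by (cases "l = Leaf"; cases "r = Leaf") auto
qed simp

lemma set_prune: "distinct (inorder t) \<Longrightarrow> set_tree (prune t) = set_tree t - cherries t"
proof (induction t)
  case (Node l c r)
  then show ?case using cherries_subset[of l] cherries_subset[of r] by auto
qed simp

lemma distinct_prune: "distinct (inorder t) \<Longrightarrow> distinct (inorder (prune t))"
  by (induction t) (auto simp: set_prune)

lemma tedges_prune: "tedges a (prune t) b \<subseteq> tedges a t b"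
  by (induction t arbitrary: a b) (auto; blast)+

lemma tedges_pruneI:
  "e \<in> tedges a t b \<Longrightarrow> e \<inter> cherries t = {} \<Longrightarrow> e \<in> tedges a (prune t) b"
proof (induction t arbitrary: a b)
  case (Node l c r)
  show ?case
  proof (cases "l = Leaf \<and> r = Leaf")
    case True
    then show ?thesis using Node.prems by auto
  next
    case False
    then have "e \<inter> cherries l = {}" "e \<inter> cherries r = {}" using Node.prems(2) by auto
    then show ?thesis using Node.IH(1)[of a c] Node.IH(2)[of c b] Node.prems(1) False by auto
  qed
qed simp

text \<open>
  Cherries sit on sides of the pruned polygon, at most one on each side, and a vertex has two such
  sides. One of the sides at an end of the base edge is the base edge itself.
\<close>

lemma cherry_neighbours:
  assumes "distinct (a # inorder t @ [b])"
  shows "card (cherries t \<inter> nbrs (tedges a t b) y) \<le> (if y = a \<or> y = b then 1 else 2)"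
  using assms
proof (induction t arbitrary: a b)
  case (Node l c r)
  have d: "distinct (a # inorder l @ [c])" "distinct (c # inorder r @ [b])" using Node.prems by auto
  show ?case
  proof (cases "l = Leaf \<and> r = Leaf")
    case True
    then have "cherries (Node l c r) \<inter> nbrs (tedges a (Node l c r) b) y \<subseteq> {c}" by auto
    then have "card (cherries (Node l c r) \<inter> nbrs (tedges a (Node l c r) b) y) \<le> card {c}"
      by (intro card_mono) auto
    then show ?thesis by auto
  next
    case False
    let ?L = "cherries l \<inter> nbrs (tedges a l c) y" and ?R = "cherries r \<inter> nbrs (tedges c r b) y"
    have sub: "cherries (Node l c r) \<inter> nbrs (tedges a (Node l c r) b) y \<subseteq> ?L \<union> ?R"
    proof
      fix z assume z: "z \<in> cherries (Node l c r) \<inter> nbrs (tedges a (Node l c r) b) y"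
      then have e: "{y, z} \<in> tedges a (Node l c r) b" by (auto simp: nbrs_def insert_commute)
      have "z \<in> cherries l \<or> z \<in> cherries r" using z False by auto
      then show "z \<in> ?L \<union> ?R"
      proof
        assume "z \<in> cherries l"
        then have "{y, z} \<in> tedges a l c"
          using e nbrs_Node_left[OF Node.prems, of z] cherries_subset[of l] by (auto simp: nbrs_def)
        then show ?thesis using \<open>z \<in> cherries l\<close> by (auto simp: nbrs_def insert_commute)
      next
        assume "z \<in> cherries r"
        then have "{y, z} \<in> tedges c r b"
          using e nbrs_Node_right[OF Node.prems, of z] cherries_subset[of r] by (auto simp: nbrs_def)
        then show ?thesis using \<open>z \<in> cherries r\<close> by (auto simp: nbrs_def insert_commute)
      qed
    qed
    have fin: "finite ?L" "finite ?R" by (simp_all add: finite_nbrs)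
    have le: "card (cherries (Node l c r) \<inter> nbrs (tedges a (Node l c r) b) y) \<le> card ?L + card ?R"
      using card_mono[OF _ sub] fin card_Un_le[of ?L ?R] by simp
    have "y \<notin> insert a (insert c (set_tree l)) \<Longrightarrow> ?L = {}" "y \<notin> insert c (insert b (set_tree r)) \<Longrightarrow> ?R = {}"
      using nbrs_outside by fast+
    moreover have "a \<notin> insert c (insert b (set_tree r))" "b \<notin> insert a (insert c (set_tree l))"
      "y \<in> set_tree l \<Longrightarrow> y \<notin> insert c (insert b (set_tree r))"
      "y \<in> set_tree r \<Longrightarrow> y \<notin> insert a (insert c (set_tree l))"
      using Node.prems by auto
    ultimately have "y = a \<Longrightarrow> card ?R = 0" "y = b \<Longrightarrow> card ?L = 0"
      "y \<noteq> a \<Longrightarrow> y \<noteq> b \<Longrightarrow> y \<noteq> c \<Longrightarrow> card ?L = 0 \<or> card ?R = 0"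
      by (metis card.empty insert_iff)+
    then show ?thesis
      using le Node.IH(1)[OF d(1)] Node.IH(2)[OF d(2)] by (auto split: if_splits)
  qed
qed simp

text \<open>
  Let \<open>H\<close> be the pruned triangulation, and let \<open>S\<close> be isolating for \<open>m'\<close> in \<open>H\<close>. A vertex of \<open>H\<close>
  has at most two neighbours outside \<open>H\<close>. The vertices outside \<open>H\<close> have degree two and are
  pairwise nonadjacent; none of them has an undominated neighbour if \<open>S\<close> dominates \<open>H\<close>, which is
  the case \<open>m' = 0\<close>.
\<close>

lemma pend_prune_bound:
  assumes dist: "distinct (x # v # inorder t @ [w])" and t: "t \<noteq> Leaf"
    and m: "m \<ge> m' + 2 \<or> m \<ge> 1 \<and> m' = 0"
  shows "\<exists>S. isolating m (pend_verts x v t w) (pend_edges x v t w) S \<and>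
    card S \<le> max 1 ((size (prune t) + 2) div (m' + 3))"
proof -
  let ?E = "pend_edges x v t w" and ?V = "pend_verts x v t w"
  let ?E' = "tedges v (prune t) w" and ?V' = "insert v (insert w (set_tree (prune t)))"
  let ?C = "insert x (cherries t)"
  have "distinct (v # inorder (prune t) @ [w])"
    using dist distinct_prune[of t] set_prune[of t] by auto
  then obtain S where S: "isolating m' ?V' ?E' S" "card S \<le> max 1 ((size (prune t) + 2) div (m' + 3))"
    using tree_bound[of v "prune t" w m'] by blast
  have d: "distinct (v # inorder t @ [w])" using dist by simp
  have E': "?E' \<subseteq> ?E" using tedges_prune[of v t w] by (auto simp: pend_edges_def)
  have V: "?V = ?V' \<union> ?C" "?V' \<inter> ?C = {}"
    using dist set_prune[of t] cherries_subset[of t] by (auto simp: pend_verts_def)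
  have EI: "{y, z} \<in> ?E'" if "{y, z} \<in> ?E" "y \<in> ?V'" "z \<in> ?V'" for y z
  proof -
    have "{y, z} \<in> tedges v t w" using that V(2) by (auto simp: pend_edges_def doubleton_eq_iff)
    then show ?thesis using that V(2) by (intro tedges_pruneI) auto
  qed
  let ?D = "dominated ?E S" and ?D' = "dominated ?E' S"
  have D: "?D' \<subseteq> ?D" using E' by (auto simp: dominated_def)
  have SV: "S \<subseteq> ?V'" using S(1) by (simp add: isolating_def)
  have zero: "?V' \<subseteq> ?D" if "m' = 0" using S(1) D that by (auto simp: isolating_def)
  have "isolating m ?V ?E S"
    unfolding isolating_def
  proof (intro conjI ballI)
    show "S \<subseteq> ?V" using SV V by auto
    fix y assume y: "y \<in> ?V - ?D"
    let ?N = "{z \<in> ?V - ?D. {y, z} \<in> ?E}"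
    have N: "?N \<subseteq> nbrs ?E y" by (auto simp: nbrs_def insert_commute)
    show "card ?N < m"
    proof (cases "y \<in> ?C")
      case True
      note C = nbrs_pend_cherry[OF dist True]
      show ?thesis
      proof (cases "m' = 0")
        case True
        have "?N = {}" using N C V(1) zero[OF True] by blast
        then have "card ?N = 0" by (simp only: card.empty)
        then show ?thesis using m by linarith
      next
        case False
        have "finite (nbrs ?E y)" using C card.infinite by fastforce
        then have "card ?N \<le> 2" using C card_mono[OF _ N] by simp
        then show ?thesis using False m by linarith
      qed
    next
      case False
      then have yV: "y \<in> ?V' - ?D'" using y V D by auto
      then have "m' \<noteq> 0" using zero y by blast
      have "?N \<subseteq> {z \<in> ?V' - ?D'. {y, z} \<in> ?E'} \<union> (?C \<inter> nbrs ?E y)"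
        using EI yV V D by (auto simp: nbrs_def insert_commute)
      moreover have "finite (cherries t)" using finite_subset[OF cherries_subset[of t]] by simp
      ultimately have "card ?N \<le> card ({z \<in> ?V' - ?D'. {y, z} \<in> ?E'} \<union> (?C \<inter> nbrs ?E y))"
        by (intro card_mono) auto
      then have "card ?N \<le> card {z \<in> ?V' - ?D'. {y, z} \<in> ?E'} + card (?C \<inter> nbrs ?E y)"
        using card_Un_le order_trans by blast
      moreover have "card {z \<in> ?V' - ?D'. {y, z} \<in> ?E'} < m'"
        using S(1) yV unfolding isolating_def by blast
      moreover have "card (?C \<inter> nbrs ?E y) \<le> 2"
      proof -
        let ?cn = "cherries t \<inter> nbrs (tedges v t w) y" and ?X = "if y = v \<or> y = w then {x} else {}"
        have "x \<notin> nbrs (tedges v t w) y"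
          using tedges_subset[of "{x, y}" v t w] dist by (auto simp: nbrs_def)
        then have "?C \<inter> nbrs ?E y \<subseteq> ?cn \<union> ?X"
          using False dist cherries_subset[of t] by (auto simp: nbrs_pend)
        then have "card (?C \<inter> nbrs ?E y) \<le> card (?cn \<union> ?X)"
          by (rule card_mono[rotated]) (simp add: finite_nbrs)
        also have "\<dots> \<le> card ?cn + card ?X" by (rule card_Un_le)
        also have "\<dots> \<le> 2" using cherry_neighbours[OF d, of y] by (auto split: if_splits)
        finally show ?thesis .
      qed
      ultimately show ?thesis using m \<open>m' \<noteq> 0\<close> by linarith
    qed
  qed
  then show ?thesis using S(2) by blast
qed

section \<open>Domination along the boundary cycle\<close>

text \<open>
  The list is read as a path; the pair of its last and its first element is not included.
\<close>

definition consec :: "'a list \<Rightarrow> ('a \<times> 'a) set" where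
  "consec xs = set (zip xs (tl xs))"

lemma consec_simps [simp]: "consec [] = {}" "consec [x] = {}"
  "consec (x # y # xs) = insert (x, y) (consec (y # xs))"
  by (auto simp: consec_def)

lemma consec_append: "consec (xs @ c # ys) = consec (xs @ [c]) \<union> consec (c # ys)"
proof (induction xs)
  case (Cons x xs)
  then show ?case by (cases xs) auto
qed auto

lemma consec_iff_nth: "(p, q) \<in> consec xs \<longleftrightarrow> (\<exists>i. Suc i < length xs \<and> p = xs ! i \<and> q = xs ! Suc i)"
  unfolding consec_def in_set_zip by (auto simp: nth_tl less_diff_conv)

text \<open>
  The sides of the polygon other than the base edge.
\<close>

fun leaf_pairs :: "'a \<Rightarrow> 'a tree \<Rightarrow> 'a \<Rightarrow> ('a \<times> 'a) set" where
  "leaf_pairs a Leaf b = {(a, b)}"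
| "leaf_pairs a (Node l c r) b = leaf_pairs a l c \<union> leaf_pairs c r b"

lemma consec_inorder: "consec (a # inorder t @ [b]) = leaf_pairs a t b"
proof (induction t arbitrary: a b)
  case (Node l c r)
  have "a # inorder (Node l c r) @ [b] = (a # inorder l) @ c # (inorder r @ [b])" by simp
  then have "consec (a # inorder (Node l c r) @ [b])
      = consec ((a # inorder l) @ [c]) \<union> consec (c # (inorder r @ [b]))"
    using consec_append by metis
  then show ?case using Node by simp
qed simp

lemma leaf_pairs_edges: "(p, q) \<in> leaf_pairs a t b \<Longrightarrow> {p, q} \<in> tedges a t b"
  by (induction t arbitrary: a b) auto

lemma cherry_on_leaf_pair:
  "y \<in> cherries t \<Longrightarrow> \<exists>(p, q)\<in>leaf_pairs a (prune t) b. {p, y} \<in> tedges a t b \<and> {q, y} \<in> tedges a t b"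
proof (induction t arbitrary: a b)
  case (Node l c r)
  show ?case
  proof (cases "l = Leaf \<and> r = Leaf")
    case True
    then show ?thesis using Node.prems by (auto simp: insert_commute)
  next
    case False
    then consider "y \<in> cherries l" | "y \<in> cherries r" using Node.prems by auto
    then show ?thesis
    proof cases
      case 1
      then show ?thesis using Node.IH(1)[of a c] False by fastforce
    next
      case 2
      then show ?thesis using Node.IH(2)[of c b] False by fastforce
    qed
  qed
qed simp

text \<open>
  Every second vertex of a cycle, beginning after the edge with index \<open>j\<close>. Only this edge may stay
  uncovered, and only if the cycle is odd.
\<close>

lemma alternate_cover:
  assumes "j < length L"
  shows "\<exists>S\<subseteq>set L. card S \<le> length L div 2 \<and>
    (\<forall>i<length L. i \<noteq> j \<or> even (length L) \<longrightarrow> L ! i \<in> S \<or> L ! (Suc i mod length L) \<in> S)"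
proof -
  define h where "h = length L"
  have h: "j < h" "0 < h" using assms by (auto simp: h_def)
  define S where "S = (\<lambda>t. L ! ((j + 2 + 2 * t) mod h)) ` {..<h div 2}"
  have "S \<subseteq> set L" using h by (auto simp: S_def h_def)
  moreover have "card S \<le> h div 2" unfolding S_def using card_image_le[of "{..<h div 2}"] by simp
  moreover have "L ! i \<in> S \<or> L ! (Suc i mod h) \<in> S" if i: "i < h" "i \<noteq> j \<or> even h" for i
  proof -
    \<comment> \<open>The distance from \<open>j + 1\<close> to \<open>i\<close> along the cycle; \<open>S\<close> consists of the odd distances.\<close>
    define s where "s = (i + h - j - 1) mod h"
    have s: "s < h" using h by (simp add: s_def)
    have i_eq: "(j + 1 + s) mod h = i"
    proof -
      have "(j + 1 + s) mod h = (j + 1 + (i + h - j - 1)) mod h" unfolding s_def by (rule mod_add_right_eq)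
      also have "j + 1 + (i + h - j - 1) = i + h" using h by simp
      finally show ?thesis using i by simp
    qed
    show ?thesis
    proof (cases "odd s")
      case True
      then obtain t where t: "s = 2 * t + 1" by (auto elim: oddE)
      then have "t < h div 2" "i = (j + 2 + 2 * t) mod h" using s i_eq by (auto simp: algebra_simps)
      then show ?thesis by (auto simp: S_def)
    next
      case False
      then obtain t where t: "s = 2 * t" by (auto elim: evenE)
      have "s \<noteq> h - 1"
      proof
        assume "s = h - 1"
        then have "i = j" using i_eq h by simp
        moreover have "odd h" using \<open>s = h - 1\<close> False h by (metis even_Suc Suc_diff_1)
        ultimately show False using i by simp
      qed
      then have "t < h div 2" using t s by linarith
      moreover have "Suc i mod h = (j + 2 + 2 * t) mod h"
        using i_eq t by (metis Suc_eq_plus1 add.assoc add.commute mod_Suc_eq one_add_one plus_1_eq_Suc)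
      ultimately show ?thesis by (auto simp: S_def)
    qed
  qed
  ultimately show ?thesis unfolding h_def by blast
qed

lemma dominatedI: "s \<in> S \<Longrightarrow> {x, s} \<in> E \<Longrightarrow> x \<in> dominated E S"
  by (auto simp: dominated_def insert_commute)

lemma dominated_mem: "s \<in> S \<Longrightarrow> s \<in> dominated E S"
  by (simp add: dominated_def)

text \<open>
  An ear is a vertex adjacent to two consecutive vertices of the cycle; a vertex cover of the
  cycle dominates all ears. On an odd cycle the uncovered edge is chosen to be one without an ear;
  if all edges carry ears, an additional vertex is taken.
\<close>

lemma dominate_cycle_with_ears:
  fixes L :: "'a list"
  defines "h \<equiv> length L"
  assumes h: "h \<ge> 2"
    and adj: "\<And>i. i < h \<Longrightarrow> {L ! i, L ! (Suc i mod h)} \<in> E"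
    and C: "finite C" "card C \<le> h" "idx ` C \<subseteq> {..<h}"
    and ear: "\<And>y. y \<in> C \<Longrightarrow> {L ! idx y, y} \<in> E \<and> {L ! (Suc (idx y) mod h), y} \<in> E"
  shows "\<exists>S. isolating 0 (set L \<union> C) E S \<and> 2 * card S \<le> h + (if odd h \<and> card C = h then 1 else 0)"
proof -
  let ?cov = "\<lambda>S i. L ! i \<in> S \<or> L ! (Suc i mod h) \<in> S"
  have "\<exists>S\<subseteq>set L. 2 * card S \<le> h + (if odd h \<and> card C = h then 1 else 0) \<and>
      (\<exists>j. (\<forall>i<h. i \<noteq> j \<longrightarrow> ?cov S i) \<and> (\<forall>y\<in>C. ?cov S (idx y)))"
  proof (cases "odd h \<and> card C = h")
    case True
    obtain S where S: "S \<subseteq> set L" "card S \<le> h div 2" "\<forall>i<h. i \<noteq> 0 \<or> even h \<longrightarrow> ?cov S i"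
      using alternate_cover[of 0 L, folded h_def] h by fastforce
    let ?S = "insert (L ! 0) S"
    have cov: "?cov ?S i" if "i < h" for i using S(3) that by auto
    have "card ?S \<le> h div 2 + 1" using card_insert_le_Suc[of "L ! 0" S] S(2) by simp
    then have "2 * card ?S \<le> h + 1" using True by presburger
    moreover have "?S \<subseteq> set L"
    proof -
      have "0 < length L" using h unfolding h_def by linarith
      then show ?thesis using S(1) nth_mem by blast
    qed
    moreover have "\<forall>y\<in>C. ?cov ?S (idx y)" using cov C(3) by blast
    ultimately show ?thesis using True cov by (intro exI[of _ ?S]) auto
  next
    case False
    obtain j where j: "j < h" "even h \<or> j \<notin> idx ` C"
    proof (cases "even h")
      case True then show ?thesis using that[of 0] h by auto
    next
      case o: False
      then have "card C < h" using False C(2) by auto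
      then have "card (idx ` C) < card {..<h}" using card_image_le[OF C(1), of idx] by simp
      then have "\<not> {..<h} \<subseteq> idx ` C" using card_mono[of "idx ` C" "{..<h}"] C(1) by auto
      then obtain j where "j \<in> {..<h}" "j \<notin> idx ` C" by blast
      then show ?thesis using that by auto
    qed
    obtain S where S: "S \<subseteq> set L" "card S \<le> h div 2" "\<forall>i<h. i \<noteq> j \<or> even h \<longrightarrow> ?cov S i"
      using alternate_cover[of j L, folded h_def] j(1) by blast
    have "?cov S (idx y)" if "y \<in> C" for y
    proof -
      have "idx y < h" "idx y \<noteq> j \<or> even h" using that C(3) j(2) by auto
      then show ?thesis using S(3) by blast
    qed
    moreover have "2 * card S \<le> h" using S(2) by linarith
    ultimately show ?thesis using S by (intro exI[of _ S]) auto
  qed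
  then obtain S j where S: "S \<subseteq> set L" "2 * card S \<le> h + (if odd h \<and> card C = h then 1 else 0)"
    "\<And>i. i < h \<Longrightarrow> i \<noteq> j \<Longrightarrow> ?cov S i" "\<And>y. y \<in> C \<Longrightarrow> ?cov S (idx y)" by blast
  have "L ! i \<in> dominated E S" if i: "i < h" for i
  proof (cases "i = j")
    case False
    then show ?thesis using S(3)[OF i] adj[OF i] dominatedI dominated_mem by metis
  next
    case True
    \<comment> \<open>The other edge at this vertex is covered.\<close>
    define i' where "i' = (i + h - 1) mod h"
    have "i' < h" using h by (simp add: i'_def)
    have eq: "Suc i' mod h = i"
    proof -
      have "Suc i' mod h = Suc (i + h - 1) mod h" by (simp add: i'_def mod_Suc_eq)
      also have "Suc (i + h - 1) = i + h" using h by simp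
      finally show ?thesis using i by simp
    qed
    have "i' \<noteq> j"
    proof
      assume "i' = j"
      then have "Suc i mod h = i" using eq True by simp
      then show False using i h by (cases "Suc i = h") auto
    qed
    then show ?thesis using S(3)[OF \<open>i' < h\<close>] adj[OF \<open>i' < h\<close>] eq dominatedI dominated_mem
      by (metis insert_commute)
  qed
  then have "set L \<subseteq> dominated E S" by (auto simp: in_set_conv_nth h_def)
  moreover have "C \<subseteq> dominated E S" using S(4) ear by (fastforce simp: dominated_def)
  ultimately have "isolating 0 (set L \<union> C) E S" using S(1) by (auto simp: isolating_def)
  then show ?thesis using S(2) by blast
qed

text \<open>
  The cherries and \<open>x\<close> are ears on the boundary cycle of the pruned triangulation.
\<close>

lemma pend_dominate:
  assumes dist: "distinct (x # v # inorder t @ [w])" and t: "t \<noteq> Leaf"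
  defines "h \<equiv> size (prune t) + 2"
  shows "\<exists>S. isolating 0 (pend_verts x v t w) (pend_edges x v t w) S \<and>
    2 * card S \<le> h + (if odd h \<and> num_cherries t + 1 = h then 1 else 0)"
proof -
  let ?E = "pend_edges x v t w"
  define L where "L = v # inorder (prune t) @ [w]"
  have h: "length L = h" "h \<ge> 2" by (simp_all add: L_def h_def)
  let ?C = "insert x (cherries t)"
  have Lh: "L ! (h - 1) = w" "L ! 0 = v" using h by (simp_all add: L_def h_def nth_append)
  have fin: "finite (cherries t)" using finite_subset[OF cherries_subset] by auto
  have cC: "card ?C = num_cherries t + 1"
    using dist card_cherries[of t] cherries_subset[of t] fin by (auto simp: card_insert_if)
  have V: "pend_verts x v t w = set L \<union> ?C"
    using dist set_prune[of t] cherries_subset[of t] by (auto simp: pend_verts_def L_def)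
  have pr: "tedges v (prune t) w \<subseteq> ?E" using tedges_prune[of v t w] by (auto simp: pend_edges_def)
  have adj: "{L ! i, L ! (Suc i mod length L)} \<in> ?E" if "i < length L" for i
  proof (cases "Suc i < length L")
    case True
    then have "(L ! i, L ! Suc i) \<in> consec L" by (auto simp: consec_iff_nth)
    then have "{L ! i, L ! Suc i} \<in> tedges v (prune t) w"
      unfolding L_def consec_inorder by (rule leaf_pairs_edges)
    then show ?thesis using True pr by auto
  next
    case False
    then have "Suc i = length L" using that by simp
    then have "i = h - 1" "Suc i mod length L = 0" using h by auto
    then show ?thesis using Lh pr tedges_base[of v w "prune t"] by (auto simp: insert_commute)
  qed
  have "\<exists>i<length L. {L ! i, y} \<in> ?E \<and> {L ! (Suc i mod length L), y} \<in> ?E" if yC: "y \<in> ?C" for y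
  proof (cases "y = x")
    case True
    then show ?thesis using h Lh by (intro exI[of _ "h - 1"]) (auto simp: pend_edges_def insert_commute)
  next
    case False
    then obtain p q where "(p, q) \<in> leaf_pairs v (prune t) w" "{p, y} \<in> tedges v t w" "{q, y} \<in> tedges v t w"
      using yC cherry_on_leaf_pair[of y t v w] by auto
    then obtain i where "Suc i < length L" "p = L ! i" "q = L ! Suc i" "{p, y} \<in> ?E" "{q, y} \<in> ?E"
      unfolding consec_inorder[symmetric] consec_iff_nth L_def by (auto simp: pend_edges_def)
    then show ?thesis by (intro exI[of _ i]) auto
  qed
  then obtain idx where idx: "\<And>y. y \<in> ?C \<Longrightarrow> idx y < length L \<and> {L ! idx y, y} \<in> ?E \<and> {L ! (Suc (idx y) mod length L), y} \<in> ?E"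
    by metis
  have "\<exists>S. isolating 0 (set L \<union> ?C) ?E S \<and>
     2 * card S \<le> length L + (if odd (length L) \<and> card ?C = length L then 1 else 0)"
  proof (rule dominate_cycle_with_ears[OF _ adj _ _ _ conjunct2[OF idx]])
    show "card ?C \<le> length L" using cC num_cherries_le_prune[of t] h by (simp add: h_def)
  qed (use h fin idx in auto)
  then show ?thesis using cC h V by simp
qed

section \<open>The upper bounds for trees\<close>

lemma iota_le_isolating:
  assumes "isolating (nat (k + 1)) (verts G) (edges G) S" "finite (verts G)"
  shows "iota k G \<le> card S"
proof -
  let ?m = "nat (k + 1)" and ?D = "dominated (edges G) S"
  have SV: "S \<subseteq> verts G" using assms(1) by (simp add: isolating_def)
  have D: "verts G - closed_nbhd G S = verts G - ?D"
    by (auto simp: closed_nbhd_def dominated_def neighbours_def insert_commute)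
  have "\<not> contains_copy (induced_subgraph G (verts G - closed_nbhd G S)) (star ?m)"
  proof
    assume "contains_copy (induced_subgraph G (verts G - closed_nbhd G S)) (star ?m)"
    then obtain f where f: "inj_on f {0..?m}" "f ` {0..?m} \<subseteq> verts G - ?D"
      "\<And>i. i \<in> {1..?m} \<Longrightarrow> f ` {0, i} \<in> edges G"
      unfolding contains_copy_def D by (auto simp: star_def induced_subgraph_def)
    have "card (f ` {1..?m}) = ?m" using inj_on_subset[OF f(1), of "{1..?m}"] by (simp add: card_image)
    moreover have "f ` {1..?m} \<subseteq> {y \<in> verts G - ?D. {f 0, y} \<in> edges G}"
    proof (rule image_subsetI)
      fix i assume i: "i \<in> {1..?m}"
      then have "f i \<in> verts G - ?D" using f(2) by (meson atLeastAtMost_iff image_subset_iff zero_le)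
      then show "f i \<in> {y \<in> verts G - ?D. {f 0, y} \<in> edges G}" using f(3)[OF i] by simp
    qed
    ultimately have "?m \<le> card {y \<in> verts G - ?D. {f 0, y} \<in> edges G}"
      using card_mono[of "{y \<in> verts G - ?D. {f 0, y} \<in> edges G}" "f ` {1..?m}"] assms(2) by simp
    moreover have "f 0 \<in> verts G - ?D" using f(2) by (meson atLeastAtMost_iff image_subset_iff zero_le order_refl)
    then have "card {y \<in> verts G - ?D. {f 0, y} \<in> edges G} < ?m"
      using assms(1) unfolding isolating_def by blast
    ultimately show False by linarith
  qed
  then have "star_isolating k G S" using SV by (simp add: star_isolating_def)
  then show ?thesis unfolding iota_def by (intro Least_le) auto
qed

lemma isolating_star_isolating:
  assumes "star_isolating k G S" "simple_graph G"
  shows "isolating (nat (k + 1)) (verts G) (edges G) S"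
proof -
  let ?m = "nat (k + 1)" and ?D = "dominated (edges G) S"
  have fin: "finite (verts G)" using assms(2) by (simp add: simple_graph_def)
  have D: "verts G - closed_nbhd G S = verts G - ?D"
    by (auto simp: closed_nbhd_def dominated_def neighbours_def insert_commute)
  have "card {y \<in> verts G - ?D. {x, y} \<in> edges G} < ?m" if x: "x \<in> verts G - ?D" for x
  proof (rule ccontr)
    let ?N = "{y \<in> verts G - ?D. {x, y} \<in> edges G}"
    assume "\<not> card ?N < ?m"
    then obtain N where N: "N \<subseteq> ?N" "card N = ?m" "finite N"
      by (meson not_less obtain_subset_with_card_n)
    then obtain f where f: "bij_betw f {1..?m} N"
      using finite_same_card_bij[of "{1..?m}" N] by auto
    have xN: "x \<notin> N"
    proof
      assume "x \<in> N"
      then have "{x} \<in> edges G" using N by auto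
      then show False using assms(2) unfolding simple_graph_def by fastforce
    qed
    let ?f = "f(0 := x)"
    have "inj_on ?f {0..?m}"
    proof (rule inj_onI)
      fix i j assume ij: "i \<in> {0..?m}" "j \<in> {0..?m}" "?f i = ?f j"
      have fN: "f i \<in> N" if "i \<in> {1..?m}" for i using f that by (auto simp: bij_betw_def)
      show "i = j"
      proof (cases "i = 0 \<or> j = 0")
        case True
        then show ?thesis using ij fN[of i] fN[of j] xN by (auto split: if_splits)
      next
        case False
        then show ?thesis using ij bij_betw_imp_inj_on[OF f] by (auto simp: inj_on_def)
      qed
    qed
    moreover have fN: "f i \<in> ?N" if "i \<in> {1..?m}" for i
      using bij_betwE[OF f] N(1) that by blast
    have "?f ` {0..?m} \<subseteq> verts G - ?D"
    proof (rule image_subsetI)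
      fix i assume "i \<in> {0..?m}"
      then show "?f i \<in> verts G - ?D" using x fN[of i] by (cases "i = 0") auto
    qed
    moreover have "?f ` {0, i} \<in> edges G \<and> ?f ` {0, i} \<subseteq> verts G - ?D" if "i \<in> {1..?m}" for i
      using fN[OF that] that x by (auto simp: insert_commute)
    ultimately have "contains_copy (induced_subgraph G (verts G - closed_nbhd G S)) (star ?m)"
      unfolding contains_copy_def D
      by (intro exI[of _ ?f]) (auto simp: star_def induced_subgraph_def)
    then show False using assms(1) by (simp add: star_isolating_def)
  qed
  then show ?thesis using assms(1) by (auto simp: isolating_def star_isolating_def)
qed

definition tree_graph :: "'a \<Rightarrow> 'a tree \<Rightarrow> 'a \<Rightarrow> 'a graph" where
  "tree_graph a t b = \<lparr>verts = insert a (insert b (set_tree t)), edges = tedges a t b\<rparr>"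

lemma le_max_div:
  assumes "x \<le> max 1 (N div M)" "M \<le> N" "0 < M"
  shows "real x \<le> real N / real M"
proof -
  have "1 \<le> N div M" using assms(2,3) by (simp add: div_greater_zero_iff Suc_le_eq)
  then have "real x \<le> real (N div M)" using assms(1) by simp
  also have "\<dots> \<le> real N / real M" by (rule of_nat_div_le_of_nat)
  finally show ?thesis .
qed

text \<open>
  After rerooting at a vertex of degree two, the counts are \<open>n = size s + 3\<close> and
  \<open>n\<^sub>2 = num_cherries s + 1\<close>, and the pruned triangulation has \<open>n - n\<^sub>2\<close> vertices.
\<close>

lemma tree_graph_iota_bounds:
  fixes t :: "'a tree" and k :: int
  assumes dist: "distinct (a # inorder t @ [b])" and n4: "n \<ge> 4"
    and n: "n = card (verts (tree_graph a t b))" and n2: "n2 = num_deg2 (tree_graph a t b)"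
    and k: "k \<ge> -1"
  defines "i \<equiv> iota k (tree_graph a t b)" and "m \<equiv> nat (k + 1)"
  shows "i \<le> max 1 (n div (m + 3))" "i \<le> max 1 ((n + n2) div (m + 4))"
    "k \<ge> 1 \<Longrightarrow> i \<le> max 1 ((n - n2) div (m + 1))"
    "k = 0 \<Longrightarrow> i \<le> max 1 ((n - n2) div 3)"
    "k = -1 \<Longrightarrow> 2 * i \<le> (n - n2) + (if odd n2 \<and> n = 2 * n2 then 1 else 0)"
    "2 * n2 \<le> n" "2 \<le> n2"
proof -
  let ?G = "tree_graph a t b"
  have "t \<noteq> Leaf"
  proof
    assume "t = Leaf"
    then have "n \<le> 2" using n by (simp add: tree_graph_def card_insert_if)
    then show False using n4 by simp
  qed
  then obtain x v s w where r: "distinct (x # v # inorder s @ [w])"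
    "tedges a t b = pend_edges x v s w" "insert a (insert b (set_tree t)) = pend_verts x v s w"
    using reroot_pend[OF dist] by blast
  have V: "verts ?G = pend_verts x v s w" and E: "edges ?G = pend_edges x v s w"
    using r by (auto simp: tree_graph_def)
  have ns: "n = size s + 3" using n V card_pend_verts[OF r(1)] by simp
  then have s: "s \<noteq> Leaf" using n4 by auto
  have "vdegree ?G y = card (nbrs (pend_edges x v s w) y)" for y
  proof -
    have "neighbours ?G y = nbrs (edges ?G) y"
      unfolding neighbours_def nbrs_def
      using pend_edges_subset[of _ x v s w] unfolding E V by fastforce
    then show ?thesis by (simp add: vdegree_def E)
  qed
  then have "num_deg2 ?G = card (insert x (cherries s))"
    unfolding num_deg2_def V using pend_degree2[OF r(1) s] by simp
  also have "\<dots> = num_cherries s + 1"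
    using r(1) card_cherries[of s] cherries_subset[of s] finite_subset[OF cherries_subset[of s]]
    by (auto simp: card_insert_if)
  finally have n2s: "n2 = num_cherries s + 1" using n2 by simp
  have nn2: "n - n2 = size (prune s) + 2" "n = size (prune s) + 2 + n2"
    using size_prune[of s] ns n2s by auto
  show "2 * n2 \<le> n" using nn2 n2s num_cherries_le_prune[of s] by simp
  show "2 \<le> n2" using n2s num_cherries_pos[OF s] by simp
  have fin: "finite (verts ?G)" by (simp add: tree_graph_def)
  have iso: "i \<le> card S" if "isolating m (pend_verts x v s w) (pend_edges x v s w) S" for S
    unfolding i_def by (rule iota_le_isolating[OF _ fin]) (use that V E in \<open>simp add: m_def\<close>)
  show "i \<le> max 1 (n div (m + 3))"
    using pend_bound[OF r(1), of 0 m] iso ns by fastforce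
  show "i \<le> max 1 ((n + n2) div (m + 4))"
  proof -
    obtain S where "isolating m (pend_verts x v s w) (pend_edges x v s w) S"
      "card S \<le> max 1 ((size s + 3 + 1 * (num_cherries s + 1)) div (m + 3 + 1))"
      using pend_bound[OF r(1), of 1 m] by auto
    moreover have "size s + 3 + 1 * (num_cherries s + 1) = n + n2" "m + 3 + 1 = m + 4"
      using ns n2s by simp_all
    ultimately show ?thesis using iso[of S] by (simp add: add.commute)
  qed
  show "i \<le> max 1 ((n - n2) div (m + 1))" if "k \<ge> 1"
  proof -
    have m: "m \<ge> 2" using that by (simp add: m_def)
    then have "m - 2 + 2 \<le> m" by linarith
    then obtain S where "isolating m (pend_verts x v s w) (pend_edges x v s w) S"
      "card S \<le> max 1 ((size (prune s) + 2) div (m - 2 + 3))"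
      using pend_prune_bound[OF r(1) s, of "m - 2" m] by blast
    moreover have "m - 2 + 3 = m + 1" using m by simp
    ultimately show ?thesis using iso nn2 by fastforce
  qed
  show "i \<le> max 1 ((n - n2) div 3)" if "k = 0"
  proof -
    have "m = 1" using that by (simp add: m_def)
    then obtain S where "isolating m (pend_verts x v s w) (pend_edges x v s w) S"
      "card S \<le> max 1 ((size (prune s) + 2) div 3)"
      using pend_prune_bound[OF r(1) s, of 0 m] by auto
    then show ?thesis using iso nn2 by fastforce
  qed
  show "2 * i \<le> (n - n2) + (if odd n2 \<and> n = 2 * n2 then 1 else 0)" if "k = -1"
  proof -
    have "m = 0" using that by (simp add: m_def)
    then obtain S where S: "isolating m (pend_verts x v s w) (pend_edges x v s w) S"
      "2 * card S \<le> size (prune s) + 2 + (if odd (size (prune s) + 2) \<and> num_cherries s + 1 = size (prune s) + 2 then 1 else 0)"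
      using pend_dominate[OF r(1) s] by auto
    have "odd (size (prune s) + 2) \<and> num_cherries s + 1 = size (prune s) + 2 \<longleftrightarrow> odd n2 \<and> n = 2 * n2"
    proof -
      have "num_cherries s + 1 = size (prune s) + 2 \<longleftrightarrow> n = 2 * n2"
        "n = 2 * n2 \<Longrightarrow> size (prune s) + 2 = n2" using nn2 n2s by auto
      then show ?thesis by metis
    qed
    then show ?thesis using iso[OF S(1)] S(2) nn2 by (auto split: if_splits)
  qed
qed

lemma tree_graph_iota_bound:
  fixes k :: int
  assumes dist: "distinct (a # inorder t @ [b])" and k: "k \<ge> -1"
    and n: "int (card (verts (tree_graph a t b))) \<ge> (if k \<ge> 1 then 2 * k + 3 else k + 5)"
  shows "real (iota k (tree_graph a t b))
    \<le> iota_bound k (card (verts (tree_graph a t b))) (num_deg2 (tree_graph a t b))"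
proof -
  define N n2 i m where "N = card (verts (tree_graph a t b))" and "n2 = num_deg2 (tree_graph a t b)"
    and "i = iota k (tree_graph a t b)" and "m = nat (k + 1)"
  have m: "real_of_int k = real m - 1" using k by (simp add: m_def)
  have Nm: "N \<ge> 4" "N \<ge> m + 3" using n k by (auto simp: m_def N_def split: if_splits)
  note b = tree_graph_iota_bounds[OF dist Nm(1) N_def n2_def k, folded i_def m_def]
  have n2: "2 \<le> n2" "2 * n2 \<le> N" using b(6,7) by simp_all
  have A: "real i \<le> real N / real (m + 3)"
    by (rule le_max_div[OF b(1)]) (use Nm in auto)
  have B: "real i \<le> real (N + n2) / real (m + 4)"
    by (rule le_max_div[OF b(2)]) (use Nm n2 in auto)
  have C: "real i \<le> real (N - n2) / real (m + 1)" if k1: "k \<ge> 1"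
    by (rule le_max_div[OF b(3)[OF k1]]) (use n n2 k1 in \<open>auto simp: N_def[symmetric] m_def\<close>)
  have D: "real i \<le> (real N - real n2 - real_of_int k * indic N n2) / (real_of_int k + 3)" if k0: "k \<le> 0"
  proof (cases "k = 0")
    case True
    have "real i \<le> real (N - n2) / real 3"
      by (rule le_max_div[OF b(4)[OF True]]) (use n n2 True in \<open>auto simp: N_def[symmetric]\<close>)
    then show ?thesis using True n2 by (simp add: of_nat_diff)
  next
    case False
    then have k1: "k = -1" using k k0 by simp
    have "real (2 * i) \<le> real (N - n2) + indic N n2"
      using b(5)[OF k1] unfolding indic_def
      by (auto simp flip: of_nat_add of_nat_Suc simp: of_nat_le_iff simp del: of_nat_add)
    then show ?thesis using k1 n2 by (simp add: of_nat_diff)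
  qed
  have le: "n2 \<le> N" using n2 by simp
  show ?thesis unfolding N_def[symmetric] n2_def[symmetric] i_def[symmetric]
  proof (cases "k \<ge> 1")
    case True
    then show "real i \<le> iota_bound k N n2" unfolding iota_bound_def
      using A B C le by (simp add: m of_nat_diff add.commute)
  next
    case False
    then show "real i \<le> iota_bound k N n2" unfolding iota_bound_def
      using B D by (simp add: m add.commute)
  qed
qed

section \<open>Arcs and Jordan curves\<close>

definition joins :: "complex set \<Rightarrow> complex \<Rightarrow> complex \<Rightarrow> bool" where
  "joins a p q \<longleftrightarrow> (\<exists>g. arc g \<and> path_image g = a \<and> pathstart g = p \<and> pathfinish g = q)"

lemma joins_sym: "joins a p q \<Longrightarrow> joins a q p"
  unfolding joins_def by (metis arc_reversepath path_image_reversepath pathfinish_reversepath pathstart_reversepath)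

lemma joins_ends: "joins a p q \<Longrightarrow> p \<in> a \<and> q \<in> a \<and> p \<noteq> q"
  unfolding joins_def using arc_distinct_ends pathfinish_in_path_image pathstart_in_path_image by blast

lemma joins_append:
  assumes "joins a p q" "joins b q r" "a \<inter> b \<subseteq> {q}"
  shows "joins (a \<union> b) p r"
proof -
  obtain g h where g: "arc g" "path_image g = a" "pathstart g = p" "pathfinish g = q"
    and h: "arc h" "path_image h = b" "pathstart h = q" "pathfinish h = r"
    using assms(1,2) unfolding joins_def by blast
  have "arc (g +++ h)" using g h assms(3) by (intro arc_join) auto
  then show ?thesis unfolding joins_def using g h
    by (intro exI[of _ "g +++ h"]) (auto simp: path_image_join)
qed

text \<open>
  An arc without its ends. It is dense in the arc, so that an arc is contained in the closure of
  any region that contains this part.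
\<close>

lemma joins_connected_interior:
  assumes "joins a p q"
  shows "connected (a - {p, q})" "a - {p, q} \<noteq> {}" "a \<subseteq> closure (a - {p, q})"
proof -
  obtain g where g: "arc g" "path_image g = a" "pathstart g = p" "pathfinish g = q"
    using assms unfolding joins_def by blast
  show "connected (a - {p, q})"
    using connected_simple_path_endless[of g] g arc_imp_simple_path by blast
  have inj: "inj_on g {0..1}" using g(1) by (simp add: arc_def)
  have sub: "g ` {0<..<1} \<subseteq> a - {p, q}"
  proof
    fix z assume "z \<in> g ` {0<..<1}"
    then obtain x where x: "z = g x" "0 < x" "x < 1" by auto
    have "g x \<noteq> g 0" "g x \<noteq> g 1" using inj_onD[OF inj, of x 0] inj_onD[OF inj, of x 1] x by auto
    then show "z \<in> a - {p, q}" using x g by (auto simp: path_image_def pathstart_def pathfinish_def)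
  qed
  moreover have "g (1/2) \<in> g ` {0<..<1}" by auto
  ultimately show "a - {p, q} \<noteq> {}" by blast
  have "g ` closure {0<..<1} \<subseteq> closure (a - {p, q})"
  proof (rule image_closure_subset)
    show "continuous_on (closure {0<..<1}) g" using g(1) by (simp add: arc_def path_def)
    show "g ` {0<..<1} \<subseteq> closure (a - {p, q})" using sub closure_subset by blast
  qed simp
  then show "a \<subseteq> closure (a - {p, q})" using g(2) by (simp add: path_image_def)
qed

lemma joins_Jordan:
  assumes "joins a p q" "joins b p q" "a \<inter> b = {p, q}"
  shows "inside (a \<union> b) \<noteq> {}" "open (inside (a \<union> b))" "connected (inside (a \<union> b))"
    "bounded (inside (a \<union> b))" "frontier (inside (a \<union> b)) = a \<union> b"
    "connected (outside (a \<union> b))" "open (outside (a \<union> b))" "inside (a \<union> b) \<union> outside (a \<union> b) = - (a \<union> b)"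
    "frontier (outside (a \<union> b)) = a \<union> b" "\<not> bounded (outside (a \<union> b))"
proof -
  obtain g where g: "arc g" "path_image g = a" "pathstart g = p" "pathfinish g = q"
    using assms(1) unfolding joins_def by blast
  obtain h where h: "arc h" "path_image h = b" "pathstart h = q" "pathfinish h = p"
    using joins_sym[OF assms(2)] unfolding joins_def by blast
  have s: "simple_path (g +++ h)" using g h assms(3) by (intro simple_path_join_loop) auto
  have e: "pathfinish (g +++ h) = pathstart (g +++ h)" using g h by simp
  have i: "path_image (g +++ h) = a \<union> b" using g h by (simp add: path_image_join)
  note J = Jordan_inside_outside[OF s e, unfolded i]
  show "inside (a \<union> b) \<noteq> {}" "open (inside (a \<union> b))" "connected (inside (a \<union> b))"
    "bounded (inside (a \<union> b))" "frontier (inside (a \<union> b)) = a \<union> b"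
    "connected (outside (a \<union> b))" "open (outside (a \<union> b))" "inside (a \<union> b) \<union> outside (a \<union> b) = - (a \<union> b)"
    "frontier (outside (a \<union> b)) = a \<union> b" "\<not> bounded (outside (a \<union> b))"
    using J by blast+
qed

lemma joins_theta:
  assumes "joins c1 u w" "joins c2 u w" "joins a u w"
    "c1 \<inter> c2 = {u, w}" "c1 \<inter> a = {u, w}" "c2 \<inter> a = {u, w}" "a \<inter> inside (c1 \<union> c2) \<noteq> {}"
  shows "inside (c1 \<union> a) \<inter> inside (c2 \<union> a) = {}"
    "inside (c1 \<union> a) \<union> inside (c2 \<union> a) \<union> (a - {u, w}) = inside (c1 \<union> c2)"
proof -
  obtain g1 where g1: "arc g1" "path_image g1 = c1" "pathstart g1 = u" "pathfinish g1 = w"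
    using assms(1) unfolding joins_def by blast
  obtain g2 where g2: "arc g2" "path_image g2 = c2" "pathstart g2 = u" "pathfinish g2 = w"
    using assms(2) unfolding joins_def by blast
  obtain g where g: "arc g" "path_image g = a" "pathstart g = u" "pathfinish g = w"
    using assms(3) unfolding joins_def by blast
  have "u \<noteq> w" using joins_ends[OF assms(1)] by simp
  show "inside (c1 \<union> a) \<inter> inside (c2 \<union> a) = {}"
    "inside (c1 \<union> a) \<union> inside (c2 \<union> a) \<union> (a - {u, w}) = inside (c1 \<union> c2)"
    using split_inside_simple_closed_curve[OF arc_imp_simple_path[OF g1(1)] g1(3,4)
      arc_imp_simple_path[OF g2(1)] g2(3,4) arc_imp_simple_path[OF g(1)] g(3,4) \<open>u \<noteq> w\<close>]
    unfolding g1(2) g2(2) g(2) using assms(4-7) by blast+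
qed

text \<open>
  The part of the definition of a plane graph that the decomposition below uses.
\<close>

definition plane_arcs :: "complex set \<Rightarrow> complex set set \<Rightarrow> bool" where
  "plane_arcs V A \<longleftrightarrow> (\<forall>a\<in>A. \<exists>p q. joins a p q \<and> a \<inter> V = {p, q}) \<and>
     (\<forall>a\<in>A. \<forall>b\<in>A. a \<noteq> b \<longrightarrow> a \<inter> b \<subseteq> V \<and> a \<inter> V \<noteq> b \<inter> V)"

lemma plane_arcsE:
  assumes "plane_arcs V A" "a \<in> A"
  obtains p q where "joins a p q" "a \<inter> V = {p, q}"
proof -
  have "\<exists>p q. joins a p q \<and> a \<inter> V = {p, q}"
    using bspec[OF conjunct1[OF assms(1)[unfolded plane_arcs_def]] assms(2)] .
  then show thesis using that by (elim exE conjE)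
qed

lemma plane_arcs_joins:
  assumes "plane_arcs V A" "a \<in> A" "a \<inter> V = {p, q}"
  shows "joins a p q"
proof -
  obtain p' q' where "joins a p' q'" "a \<inter> V = {p', q'}"
    by (rule plane_arcsE[OF assms(1,2)])
  moreover have "p' = p \<and> q' = q \<or> p' = q \<and> q' = p"
    using assms(3) \<open>a \<inter> V = {p', q'}\<close> by (simp add: doubleton_eq_iff)
  ultimately show ?thesis using joins_sym by blast
qed

lemma plane_arcs_eq: "plane_arcs V A \<Longrightarrow> a \<in> A \<Longrightarrow> b \<in> A \<Longrightarrow> a \<inter> V = b \<inter> V \<Longrightarrow> a = b"
  unfolding plane_arcs_def by blast

lemma plane_arcs_Int: "plane_arcs V A \<Longrightarrow> a \<in> A \<Longrightarrow> b \<in> A \<Longrightarrow> a \<noteq> b \<Longrightarrow> a \<inter> b \<subseteq> V"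
  unfolding plane_arcs_def by blast

lemma plane_arcs_interior:
  assumes "plane_arcs V A" "a \<in> A"
  shows "connected (a - V)" "a - V \<noteq> {}" "a \<subseteq> closure (a - V)"
proof -
  obtain p q where j: "joins a p q" and pq: "a \<inter> V = {p, q}"
    by (rule plane_arcsE[OF assms])
  from pq have eq: "a - V = a - {p, q}" by blast
  show "connected (a - V)" "a - V \<noteq> {}" "a \<subseteq> closure (a - V)"
    unfolding eq by (rule joins_connected_interior[OF j])+
qed

definition path_arcs :: "complex set \<Rightarrow> complex set set \<Rightarrow> complex list \<Rightarrow> complex set set" where
  "path_arcs V A L = {a \<in> A. \<exists>(p, q)\<in>consec L. a \<inter> V = {p, q}}"

definition has_arcs :: "complex set \<Rightarrow> complex set set \<Rightarrow> complex list \<Rightarrow> bool" where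
  "has_arcs V A L \<longleftrightarrow> (\<forall>(p, q)\<in>consec L. \<exists>a\<in>A. a \<inter> V = {p, q})"

lemma consec_subset: "(p, q) \<in> consec L \<Longrightarrow> p \<in> set L \<and> q \<in> set L"
  by (auto simp: consec_iff_nth)

lemma path_arcs_V: "a \<in> path_arcs V A L \<Longrightarrow> a \<inter> V \<subseteq> set L"
proof -
  assume "a \<in> path_arcs V A L"
  then obtain p q where "(p, q) \<in> consec L" "a \<inter> V = {p, q}" unfolding path_arcs_def by auto
  then show ?thesis using consec_subset[of p q L] by simp
qed

lemma path_arcs_simps:
  "path_arcs V A [] = {}" "path_arcs V A [p] = {}"
  "path_arcs V A (p # q # L) = {b \<in> A. b \<inter> V = {p, q}} \<union> path_arcs V A (q # L)"
  by (auto simp: path_arcs_def)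

lemma joins_path:
  assumes pl: "plane_arcs V A"
  shows "length L \<ge> 2 \<Longrightarrow> distinct L \<Longrightarrow> has_arcs V A L \<Longrightarrow> joins (\<Union>(path_arcs V A L)) (hd L) (last L)"
proof (induction L rule: induct_list012)
  case (3 p q L)
  obtain a where a: "a \<in> A" "a \<inter> V = {p, q}" using "3.prems"(3) by (auto simp: has_arcs_def)
  have ja: "joins a p q" by (rule plane_arcs_joins[OF pl a])
  have uniq: "b = a" if "b \<in> A" "b \<inter> V = {p, q}" for b
    using plane_arcs_eq[OF pl that(1) a(1)] that(2) a(2) by simp
  have single: "{b \<in> A. b \<inter> V = {p, q}} = {a}"
  proof
    show "{b \<in> A. b \<inter> V = {p, q}} \<subseteq> {a}" using uniq by auto
    show "{a} \<subseteq> {b \<in> A. b \<inter> V = {p, q}}" using a by simp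
  qed
  show ?case
  proof (cases L)
    case Nil
    then have "path_arcs V A [p, q] = {a}"
      by (simp add: path_arcs_simps single)
    then show ?thesis using ja Nil by simp
  next
    case (Cons r M)
    then have IH: "joins (\<Union>(path_arcs V A (q # L))) q (last (q # L))"
      using 3 by (auto simp: has_arcs_def)
    have eq: "path_arcs V A (p # q # L) = insert a (path_arcs V A (q # L))"
      by (simp add: path_arcs_simps single)
    have "a \<inter> b \<subseteq> {q}" if b: "b \<in> path_arcs V A (q # L)" for b
    proof -
      have bV: "b \<inter> V \<subseteq> set (q # L)" by (rule path_arcs_V[OF b])
      then have "b \<noteq> a" using a "3.prems"(2) by auto
      moreover have "b \<in> A" using b by (simp add: path_arcs_def)
      ultimately have "a \<inter> b \<subseteq> V" using plane_arcs_Int[OF pl a(1)] by blast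
      then have "a \<inter> b \<subseteq> {p, q} \<inter> set (q # L)" using a bV by blast
      then show ?thesis using "3.prems"(2) by auto
    qed
    then have "a \<inter> \<Union>(path_arcs V A (q # L)) \<subseteq> {q}" by blast
    from joins_append[OF ja IH this] show ?thesis unfolding eq by simp
  qed
qed auto

text \<open>
  Through this lemma the condition on the faces passes from the plane to the inside of the
  exterior cycle, and from a polygon to the two parts into which a chord cuts it.
\<close>

lemma components_open_part:
  assumes "open X" "open Y" "X \<inter> Y = {}" "F \<in> components (X - S)"
  shows "F \<in> components ((X \<union> Y) - S)"
  unfolding in_components_maximal
proof (intro conjI allI impI)
  note m = assms(4)[unfolded in_components_maximal]
  note F = m[THEN conjunct1] m[THEN conjunct2, THEN conjunct1]
    m[THEN conjunct2, THEN conjunct2, THEN conjunct1] m[THEN conjunct2, THEN conjunct2, THEN conjunct2]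
  show "F \<noteq> {}" "F \<subseteq> X \<union> Y - S" "connected F" using F by auto
  fix D assume D: "D \<noteq> {} \<and> F \<subseteq> D \<and> D \<subseteq> X \<union> Y - S \<and> connected D"
  have "X \<inter> D = {} \<or> Y \<inter> D = {}"
    by (rule connectedD) (use D assms(1-3) in auto)
  then have "D \<subseteq> X - S" using D F(1,2) by auto
  then show "D = F" using F(4) D by simp
qed

lemma consec_append_nonempty:
  assumes "xs \<noteq> []" "ys \<noteq> []"
  shows "consec (xs @ ys) = consec xs \<union> consec ys \<union> {(last xs, hd ys)}"
  using assms
proof (induction xs)
  case (Cons x xs)
  show ?case
  proof (cases "xs = []")
    case True
    then show ?thesis using Cons.prems by (cases ys) auto
  next
    case False
    then obtain x' xs' where "xs = x' # xs'" by (cases xs) auto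
    then show ?thesis using Cons by auto
  qed
qed simp

text \<open>
  Glueing of two triangulated polygons along the common side \<open>uw\<close>: the leaf for \<open>uw\<close> in one tree
  gives way to the other tree.
\<close>

lemma graft:
  assumes "a # inorder t @ [b] = xs @ u # w # zs"
  shows "\<exists>t'. a # inorder t' @ [b] = xs @ u # inorder s @ w # zs \<and>
    tedges a t' b = tedges a t b \<union> tedges u s w"
  using assms
proof (induction t arbitrary: a b xs zs)
  case Leaf
  then have "xs = []" "zs = []" "u = a" "w = b" by (auto simp: Cons_eq_append_conv append_eq_Cons_conv)
  then show ?case using tedges_base[of a b s] by (intro exI[of _ s]) auto
next
  case (Node l c r)
  have eq: "(a # inorder l) @ c # (inorder r @ [b]) = xs @ u # w # zs" using Node.prems by simp
  show ?case
  proof (cases "length xs < length (a # inorder l)")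
    case True
    define n where "n = length (a # inorder l)"
    have l: "a # inorder l @ [c] = xs @ u # w # take (n - length xs - 1) zs"
    proof -
      have "take (n + 1) (xs @ u # w # zs) = xs @ u # w # take (n - length xs - 1) zs"
        using True by (simp add: n_def take_Cons' )
      then show ?thesis using arg_cong[OF eq, of "take (n + 1)"] by (simp add: n_def)
    qed
    have r: "inorder r @ [b] = drop (n - length xs - 1) zs"
    proof -
      have "drop (n + 1) (xs @ u # w # zs) = drop (n - length xs - 1) zs"
        using True by (simp add: n_def drop_Cons')
      then show ?thesis using arg_cong[OF eq, of "drop (n + 1)"] by (simp add: n_def)
    qed
    obtain t' where t': "a # inorder t' @ [c] = xs @ u # inorder s @ w # take (n - length xs - 1) zs"
      "tedges a t' c = tedges a l c \<union> tedges u s w"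
      using Node.IH(1)[OF l] by blast
    have "a # inorder (Node t' c r) @ [b] = (a # inorder t' @ [c]) @ inorder r @ [b]" by simp
    also have "\<dots> = xs @ u # inorder s @ w # zs" unfolding t'(1) r by simp
    finally show ?thesis using t'(2) by (intro exI[of _ "Node t' c r"]) auto
  next
    case False
    define n where "n = length (a # inorder l)"
    have l: "a # inorder l = take n xs"
      using arg_cong[OF eq, of "take n"] False by (simp add: n_def)
    have r: "c # inorder r @ [b] = drop n xs @ u # w # zs"
      using arg_cong[OF eq, of "drop n"] False by (simp add: n_def)
    obtain t' where t': "c # inorder t' @ [b] = drop n xs @ u # inorder s @ w # zs"
      "tedges c t' b = tedges c r b \<union> tedges u s w"
      using Node.IH(2)[OF r] by blast
    have "a # inorder (Node l c t') @ [b] = (a # inorder l) @ (c # inorder t' @ [b])" by simp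
    also have "\<dots> = xs @ u # inorder s @ w # zs" unfolding t'(1) l by (simp flip: append_assoc)
    finally show ?thesis using t'(2) by (intro exI[of _ "Node l c t'"]) auto
  qed
qed

lemma list_split_two:
  assumes "u \<in> set L" "w \<in> set L" "u \<noteq> w"
  obtains xs u' ys w' zs where "L = xs @ u' # ys @ w' # zs" "{u', w'} = {u, w}"
proof -
  obtain xs ys where L: "L = xs @ u # ys" using assms(1) by (meson split_list)
  show thesis
  proof (cases "w \<in> set ys")
    case True
    then obtain ys' zs where "ys = ys' @ w # zs" by (meson split_list)
    then show thesis using that[of xs u ys' w zs] L by simp
  next
    case False
    then have "w \<in> set xs" using assms L by auto
    then obtain xs' zs where "xs = xs' @ w # zs" by (meson split_list)
    then show thesis using that[of xs' w zs u ys] L by (simp add: insert_commute)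
  qed
qed

section \<open>Polygons with arcs as sides\<close>

definition cycle_set :: "complex set \<Rightarrow> complex set set \<Rightarrow> complex list \<Rightarrow> complex set \<Rightarrow> complex set" where
  "cycle_set V A L b = \<Union>(path_arcs V A L) \<union> b"

text \<open>
  A closed polygon with arcs as sides. The closing side \<open>b\<close> is kept apart from the path along the
  list because it becomes the base edge.
\<close>

definition polygon :: "complex set \<Rightarrow> complex set set \<Rightarrow> complex list \<Rightarrow> complex set \<Rightarrow> bool" where
  "polygon V A L b \<longleftrightarrow> length L \<ge> 3 \<and> distinct L \<and> set L \<subseteq> V \<and> has_arcs V A L \<and>
     b \<in> A \<and> b \<inter> V = {hd L, last L}"

lemma has_arcs_in_path_arcs:
  "has_arcs V A L \<Longrightarrow> (p, q) \<in> consec L \<Longrightarrow> \<exists>a\<in>path_arcs V A L. a \<inter> V = {p, q}"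
  unfolding has_arcs_def path_arcs_def by fastforce

lemma path_arcs_cover:
  assumes "has_arcs V A L" "length L \<ge> 2" "x \<in> set L"
  shows "x \<in> \<Union>(path_arcs V A L)"
proof -
  obtain i where i: "i < length L" "x = L ! i" using assms(3) by (auto simp: in_set_conv_nth)
  obtain p q where pq: "(p, q) \<in> consec L" "x = p \<or> x = q"
  proof (cases "Suc i < length L")
    case True
    then show ?thesis using that[of "L ! i" "L ! Suc i"] i by (auto simp: consec_iff_nth)
  next
    case False
    then have "i > 0" using i assms(2) by linarith
    then have "(L ! (i - 1), L ! i) \<in> consec L"
      using i by (auto simp: consec_iff_nth intro!: exI[of _ "i - 1"])
    then show ?thesis using that i by blast
  qed
  obtain a where "a \<in> path_arcs V A L" "a \<inter> V = {p, q}" using has_arcs_in_path_arcs[OF assms(1) pq(1)] by blast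
  then show ?thesis using pq(2) by blast
qed

lemma polygon_facts:
  assumes pl: "plane_arcs V A" and P: "polygon V A L b"
  shows "b \<notin> path_arcs V A L" "joins (\<Union>(path_arcs V A L)) (hd L) (last L)" "joins b (hd L) (last L)"
    "\<Union>(path_arcs V A L) \<inter> b = {hd L, last L}" "cycle_set V A L b \<inter> V = set L"
proof -
  note P' = P[unfolded polygon_def]
  have L: "length L \<ge> 3" "distinct L" "has_arcs V A L" "set L \<subseteq> V" and b: "b \<in> A" "b \<inter> V = {hd L, last L}"
    using P' by simp_all
  have L0: "L \<noteq> []" using L(1) by auto
  show bn: "b \<notin> path_arcs V A L"
  proof
    assume "b \<in> path_arcs V A L"
    then obtain i where i: "Suc i < length L" "b \<inter> V = {L ! i, L ! Suc i}"
      unfolding path_arcs_def by (auto simp: consec_iff_nth)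
    then have "{L ! 0, L ! (length L - 1)} = {L ! i, L ! Suc i}"
      using b(2) L0 by (simp add: hd_conv_nth last_conv_nth)
    then have "{0, length L - 1} = {i, Suc i}"
      using L(1,2) i(1) unfolding doubleton_eq_iff
      by (metis One_nat_def Suc_lessD diff_less length_greater_0_conv L0 lessI nth_eq_iff_index_eq zero_less_Suc)
    then show False using L(1) by (auto simp: doubleton_eq_iff)
  qed
  show jp: "joins (\<Union>(path_arcs V A L)) (hd L) (last L)"
    by (rule joins_path[OF pl]) (use L in auto)
  show jb: "joins b (hd L) (last L)" by (rule plane_arcs_joins[OF pl b])
  have cov: "set L \<subseteq> \<Union>(path_arcs V A L)" using path_arcs_cover[OF L(3)] L(1) by auto
  have sub: "\<Union>(path_arcs V A L) \<inter> V \<subseteq> set L" using path_arcs_V by blast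
  have ends: "{hd L, last L} \<subseteq> set L" using L0 by simp
  show "\<Union>(path_arcs V A L) \<inter> b = {hd L, last L}"
  proof
    show "\<Union>(path_arcs V A L) \<inter> b \<subseteq> {hd L, last L}"
    proof
      fix z assume "z \<in> \<Union>(path_arcs V A L) \<inter> b"
      then obtain a where a: "a \<in> path_arcs V A L" "z \<in> a" "z \<in> b" by blast
      then have "a \<inter> b \<subseteq> V" using bn plane_arcs_Int[OF pl, of a b] b(1) by (auto simp: path_arcs_def)
      then show "z \<in> {hd L, last L}" using a b(2) by blast
    qed
    show "{hd L, last L} \<subseteq> \<Union>(path_arcs V A L) \<inter> b" using cov ends b(2) by blast
  qed
  show "cycle_set V A L b \<inter> V = set L"
    unfolding cycle_set_def using cov sub ends b(2) L(4) by blast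
qed

lemma polygon_Jordan:
  assumes pl: "plane_arcs V A" and P: "polygon V A L b"
  defines "C \<equiv> cycle_set V A L b"
  shows "inside C \<noteq> {}" "open (inside C)" "connected (inside C)" "bounded (inside C)"
    "frontier (inside C) = C" "connected (outside C)" "open (outside C)" "inside C \<union> outside C = - C"
    "frontier (outside C) = C" "\<not> bounded (outside C)"
  unfolding C_def cycle_set_def
  using joins_Jordan[OF polygon_facts(2,3,4)[OF pl P]] by blast+

text \<open>
  An arc that is not a side meets the polygon at most in vertices, and as a connected set it
  cannot change between inside and outside.
\<close>

lemma arc_off_cycle:
  assumes pl: "plane_arcs V A" and P: "polygon V A L b" and a: "a \<in> A" "a \<notin> insert b (path_arcs V A L)"
  shows "(a - V) \<inter> cycle_set V A L b = {}"
    "a - V \<subseteq> inside (cycle_set V A L b) \<or> (a - V) \<inter> inside (cycle_set V A L b) = {}"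
proof -
  have "b \<in> A" using P by (simp add: polygon_def)
  then have "a \<inter> c \<subseteq> V" if "c \<in> insert b (path_arcs V A L)" for c
    using that a by (intro plane_arcs_Int[OF pl a(1)]) (auto simp: path_arcs_def)
  then show off: "(a - V) \<inter> cycle_set V A L b = {}" unfolding cycle_set_def by blast
  show "a - V \<subseteq> inside (cycle_set V A L b) \<or> (a - V) \<inter> inside (cycle_set V A L b) = {}"
  proof (rule ccontr)
    assume "\<not> ?thesis"
    then have "(a - V) \<inter> frontier (inside (cycle_set V A L b)) \<noteq> {}"
      by (intro connected_Int_frontier plane_arcs_interior(1)[OF pl a(1)]) auto
    then show False using off polygon_Jordan(5)[OF pl P] by simp
  qed
qed

definition edges_within :: "complex set \<Rightarrow> complex set set \<Rightarrow> complex set \<Rightarrow> complex set set" where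
  "edges_within V A X = {a \<inter> V | a. a \<in> A \<and> a \<subseteq> X}"

lemma edges_withinI: "a \<in> A \<Longrightarrow> a \<inter> V = e \<Longrightarrow> a \<subseteq> X \<Longrightarrow> e \<in> edges_within V A X"
  unfolding edges_within_def by blast

text \<open>
  Instead of the boundary cycle of a face only its corners are counted; in this form the condition
  passes to the pieces of a polygon that is cut along a chord.
\<close>

definition triangular_faces :: "complex set \<Rightarrow> complex set set \<Rightarrow> complex set \<Rightarrow> bool" where
  "triangular_faces V A I \<longleftrightarrow> (\<forall>F\<in>components (I - \<Union>A). card (frontier F \<inter> V) = 3)"

text \<open>
  Without a chord the inside of the polygon is a single face, which has three corners.
\<close>

lemma polygon_no_chord:
  assumes pl: "plane_arcs V A" and P: "polygon V A L b"
    and IV: "inside (cycle_set V A L b) \<inter> V = {}"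
    and tri: "triangular_faces V A (inside (cycle_set V A L b))"
    and none: "\<And>a. a \<in> A \<Longrightarrow> (a - V) \<inter> inside (cycle_set V A L b) = {}"
  shows "\<exists>t. hd L # inorder t @ [last L] = L \<and>
    edges_within V A (inside (cycle_set V A L b) \<union> cycle_set V A L b) = tedges (hd L) t (last L)"
proof -
  let ?C = "cycle_set V A L b"
  let ?I = "inside ?C"
  note J = polygon_Jordan[OF pl P]
  have P': "length L \<ge> 3" "distinct L" "has_arcs V A L" "b \<in> A" "b \<inter> V = {hd L, last L}"
    using P by (simp_all add: polygon_def)
  have disj: "?I \<inter> a = {}" if "a \<in> A" for a using none[OF that] IV by blast
  then have "?I - \<Union>A = ?I" by blast
  moreover have "components ?I = {?I}" using J(1,3) by (simp add: components_eq_sing_iff)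
  ultimately have "card (frontier ?I \<inter> V) = 3" using tri unfolding triangular_faces_def by simp
  then have "card (set L) = 3" using J(5) polygon_facts(5)[OF pl P] by simp
  then have "length L = 3" using P'(2) distinct_card by metis
  then obtain p c q where L: "L = [p, c, q]" by (auto simp: numeral_3_eq_3 length_Suc_conv)
  have "edges_within V A (?I \<union> ?C) = {{p, c}, {c, q}, {p, q}}"
  proof
    show "edges_within V A (?I \<union> ?C) \<subseteq> {{p, c}, {c, q}, {p, q}}"
    proof
      fix e assume "e \<in> edges_within V A (?I \<union> ?C)"
      then obtain a where a: "a \<in> A" "a \<subseteq> ?I \<union> ?C" "e = a \<inter> V" by (auto simp: edges_within_def)
      have "a \<in> insert b (path_arcs V A L)"
      proof (rule ccontr)
        assume "a \<notin> insert b (path_arcs V A L)"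
        then have "(a - V) \<inter> ?C = {}" by (rule arc_off_cycle(1)[OF pl P a(1)])
        then have "a - V = {}" using a(2) none[OF a(1)] by blast
        then show False using plane_arcs_interior(2)[OF pl a(1)] by simp
      qed
      then consider "a = b" | "a \<in> path_arcs V A L" by blast
      then show "e \<in> {{p, c}, {c, q}, {p, q}}"
      proof cases
        case 1
        then show ?thesis using a(3) P'(5) L by simp
      next
        case 2
        then obtain p' q' where pq: "(p', q') \<in> consec L" "a \<inter> V = {p', q'}" unfolding path_arcs_def by auto
        have e: "e = {p', q'}" using a(3) pq(2) by simp
        have "p' = p \<and> q' = c \<or> p' = c \<and> q' = q" using pq(1) L by simp
        then show ?thesis unfolding e by auto
      qed
    qed
    have on: "{p', q'} \<in> edges_within V A (?I \<union> ?C)" if pq: "(p', q') \<in> consec L" for p' q'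
    proof -
      obtain a where a: "a \<in> path_arcs V A L" "a \<inter> V = {p', q'}"
        using has_arcs_in_path_arcs[OF P'(3) pq] by blast
      from a(1) have "a \<in> A" "a \<subseteq> ?I \<union> ?C" by (auto simp: cycle_set_def path_arcs_def)
      then show ?thesis using a(2) by (intro edges_withinI)
    qed
    have "{p, c} \<in> edges_within V A (?I \<union> ?C)" "{c, q} \<in> edges_within V A (?I \<union> ?C)"
      using on L by simp_all
    moreover have "b \<subseteq> ?I \<union> ?C" by (auto simp: cycle_set_def)
    then have "{p, q} \<in> edges_within V A (?I \<union> ?C)"
      using P'(4,5) L by (intro edges_withinI) auto
    ultimately have "e \<in> edges_within V A (?I \<union> ?C)" if "e \<in> {{p, c}, {c, q}, {p, q}}" for e
      using that by blast
    then show "{{p, c}, {c, q}, {p, q}} \<subseteq> edges_within V A (?I \<union> ?C)" by blast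
  qed
  then show ?thesis using L by (intro exI[of _ "Node Leaf c Leaf"]) auto
qed

lemma path_arcs_Un:
  "consec L = consec M \<union> consec N \<Longrightarrow> path_arcs V A L = path_arcs V A M \<union> path_arcs V A N"
  unfolding path_arcs_def by blast

lemma path_arcs_pair:
  assumes "plane_arcs V A" "a \<in> A" "a \<inter> V = {p, q}"
  shows "path_arcs V A [p, q] = {a}"
proof -
  have "b = a" if "b \<in> A" "b \<inter> V = {p, q}" for b
    using plane_arcs_eq[OF assms(1) that(1) assms(2)] that(2) assms(3) by simp
  then have "{b \<in> A. b \<inter> V = {p, q}} \<subseteq> {a}" by blast
  moreover have "{a} \<subseteq> {b \<in> A. b \<inter> V = {p, q}}" using assms by simp
  ultimately show ?thesis by (simp add: path_arcs_simps)
qed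

lemma has_arcs_Un:
  "consec L = consec M \<union> consec N \<Longrightarrow> has_arcs V A L \<longleftrightarrow> has_arcs V A M \<and> has_arcs V A N"
  unfolding has_arcs_def by (simp add: ball_Un)

lemma has_arcs_pair: "a \<in> A \<Longrightarrow> a \<inter> V = {p, q} \<Longrightarrow> has_arcs V A [p, q]"
  unfolding has_arcs_def by (simp, rule bexI[of _ a], assumption+)

section \<open>Cutting a polygon along a chord\<close>

text \<open>
  A chord and the two paths between its ends form a theta curve.
\<close>

lemma polygon_split:
  assumes pl: "plane_arcs V A" and P: "polygon V A (xs @ u # ys @ w # zs) b"
    and a: "a \<in> A" "a \<inter> V = {u, w}" "a \<notin> insert b (path_arcs V A (xs @ u # ys @ w # zs))"
    and ins: "a - V \<subseteq> inside (cycle_set V A (xs @ u # ys @ w # zs) b)"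
    and ne: "ys \<noteq> []" "xs @ zs \<noteq> []"
  defines "C \<equiv> cycle_set V A (xs @ u # ys @ w # zs) b"
    and "C1 \<equiv> cycle_set V A (u # ys @ [w]) a" and "C2 \<equiv> cycle_set V A (xs @ u # w # zs) b"
  shows "polygon V A (u # ys @ [w]) a" "polygon V A (xs @ u # w # zs) b"
    "inside C1 \<inter> inside C2 = {}" "inside C1 \<union> inside C2 \<union> (a - {u, w}) = inside C" "C1 \<union> C2 = C \<union> a"
proof -
  define L where "L = xs @ u # ys @ w # zs"
  define Px Py Pz where "Px = path_arcs V A (xs @ [u])" and "Py = path_arcs V A (u # ys @ [w])"
    and "Pz = path_arcs V A (w # zs)"
  note P' = P[unfolded polygon_def, folded L_def]
  have L: "distinct L" "has_arcs V A L" "set L \<subseteq> V" and b: "b \<in> A" "b \<inter> V = {hd L, last L}"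
    using P' by simp_all
  have hl: "hd L = hd (xs @ [u])" "last L = last (w # zs)"
    by (simp_all add: L_def hd_append)
  have c0: "consec (u # ys @ w # zs) = consec (u # ys @ [w]) \<union> consec (w # zs)"
    using consec_append[of "u # ys" w zs] by simp
  have cL: "consec L = consec (xs @ [u]) \<union> consec (u # ys @ w # zs)"
    unfolding L_def by (rule consec_append)
  have hx: "has_arcs V A (xs @ [u])" and hy: "has_arcs V A (u # ys @ [w])" and hz: "has_arcs V A (w # zs)"
    using L(2) has_arcs_Un[OF cL] has_arcs_Un[OF c0] by blast+
  have PL: "path_arcs V A L = Px \<union> Py \<union> Pz"
    unfolding path_arcs_Un[OF cL] path_arcs_Un[OF c0] Px_def Py_def Pz_def by blast
  have pa: "path_arcs V A [u, w] = {a}" by (rule path_arcs_pair[OF pl a(1,2)])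
  have c2: "consec (u # w # zs) = consec [u, w] \<union> consec (w # zs)" by simp
  have cL2: "consec (xs @ u # w # zs) = consec (xs @ [u]) \<union> consec (u # w # zs)" by (rule consec_append)
  have PL2: "path_arcs V A (xs @ u # w # zs) = Px \<union> {a} \<union> Pz"
    unfolding path_arcs_Un[OF cL2] path_arcs_Un[OF c2] pa Px_def Pz_def by blast
  \<comment> \<open>The path from \<open>w\<close> to \<open>u\<close> on the far side of the chord; it runs through \<open>b\<close>.\<close>
  define L3 where "L3 = (w # zs) @ xs @ [u]"
  have cL3: "consec L3 = (consec (w # zs) \<union> consec (xs @ [u])) \<union> consec [last L, hd L]"
    unfolding L3_def hl by (subst consec_append_nonempty) auto
  have b': "b \<inter> V = {last L, hd L}" using b(2) by (simp add: insert_commute)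
  have pb: "path_arcs V A [last L, hd L] = {b}" by (rule path_arcs_pair[OF pl b(1) b'])
  have PL3: "path_arcs V A L3 = Px \<union> Pz \<union> {b}"
  proof -
    have "path_arcs V A L3 = (Pz \<union> Px) \<union> path_arcs V A [last L, hd L]"
      unfolding path_arcs_def cL3 Px_def Pz_def by blast
    then show ?thesis unfolding pb by blast
  qed
  have h3: "has_arcs V A L3"
  proof -
    have "has_arcs V A [last L, hd L]" using b(1) b' by (rule has_arcs_pair)
    then show ?thesis using hx hz unfolding has_arcs_def cL3 by (simp only: ball_Un)
  qed
  define c1 c2 where "c1 = \<Union>Py" and "c2 = \<Union>(Px \<union> Pz) \<union> b"
  have c2_eq: "c2 = \<Union>(path_arcs V A L3)" unfolding c2_def PL3 by blast
  have C: "C = c1 \<union> c2" unfolding C_def cycle_set_def L_def[symmetric] PL c1_def c2_def by blast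
  have C1: "C1 = c1 \<union> a" unfolding C1_def cycle_set_def c1_def Py_def by blast
  have C2: "C2 = c2 \<union> a" unfolding C2_def cycle_set_def PL2 c2_def by blast
  show "C1 \<union> C2 = C \<union> a" unfolding C C1 C2 by blast
  have d1: "distinct (u # ys @ [w])" and d2: "distinct (xs @ u # w # zs)" and d3: "distinct L3"
    using L(1) by (auto simp: L_def L3_def)
  have j1: "joins c1 u w"
    using joins_path[OF pl _ d1 hy] unfolding c1_def Py_def by simp
  have "joins c2 w u"
    using joins_path[OF pl _ d3 h3] unfolding c2_eq by (simp add: L3_def)
  then have j2: "joins c2 u w" by (rule joins_sym)
  have ja: "joins a u w" by (rule plane_arcs_joins[OF pl a(1,2)])
  have uw: "u \<noteq> w" using L(1) by (auto simp: L_def)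
  have "set (u # ys @ [w]) \<subseteq> c1" using path_arcs_cover[OF hy] unfolding c1_def Py_def by auto
  then have uwc1: "u \<in> c1" "w \<in> c1" by auto
  have "set L3 \<subseteq> c2" using path_arcs_cover[OF h3] unfolding c2_eq by (auto simp: L3_def)
  then have uwc2: "u \<in> c2" "w \<in> c2" by (auto simp: L3_def)
  have uwa: "u \<in> a" "w \<in> a" using a(2) by blast+
  have PA: "Px \<union> Py \<union> Pz \<subseteq> A" by (auto simp: Px_def Py_def Pz_def path_arcs_def)
  have anot: "a \<notin> insert b (Px \<union> Py \<union> Pz)" using a(3) PL by (simp add: L_def)
  have setint: "set (u # ys @ [w]) \<inter> set L3 = {u, w}" using L(1) by (auto simp: L_def L3_def)
  \<comment> \<open>A common arc of the two paths would have the ends \<open>u\<close> and \<open>w\<close> and hence be the chord; distinct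
    arcs meet only in vertices.\<close>
  have i12: "c1 \<inter> c2 \<subseteq> {u, w}"
  proof
    fix z assume z: "z \<in> c1 \<inter> c2"
    obtain a1 where a1: "a1 \<in> Py" "z \<in> a1" using z unfolding c1_def by blast
    obtain a2 where a2: "a2 \<in> path_arcs V A L3" "z \<in> a2" using z unfolding c2_eq by blast
    have s: "a1 \<inter> V \<subseteq> set (u # ys @ [w])" "a2 \<inter> V \<subseteq> set L3"
      using path_arcs_V a1(1) a2(1) unfolding Py_def by blast+
    have A1: "a1 \<in> A" "a2 \<in> A" using a1(1) a2(1) PA unfolding path_arcs_def by blast+
    have "a1 \<noteq> a2"
    proof
      assume "a1 = a2"
      then have sub: "a1 \<inter> V \<subseteq> {u, w}" using s setint by blast
      obtain p q where pq: "joins a1 p q" "a1 \<inter> V = {p, q}" by (rule plane_arcsE[OF pl A1(1)])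
      have "p \<noteq> q" using joins_ends[OF pq(1)] by simp
      moreover have "{p, q} \<subseteq> {u, w}" using sub unfolding pq(2) .
      ultimately have "{p, q} = {u, w}" by auto
      then have "a1 \<inter> V = a \<inter> V" unfolding pq(2) a(2) .
      then have "a1 = a" by (rule plane_arcs_eq[OF pl A1(1) a(1)])
      then show False using a1(1) anot by blast
    qed
    then have "a1 \<inter> a2 \<subseteq> V" by (rule plane_arcs_Int[OF pl A1])
    then show "z \<in> {u, w}" using a1(2) a2(2) s setint by blast
  qed
  have offa: "c \<inter> a \<subseteq> {u, w}" if "c \<in> insert b (Px \<union> Py \<union> Pz)" for c
  proof -
    have "c \<in> A" "c \<noteq> a" using that PA b(1) anot by blast+
    then have "c \<inter> a \<subseteq> V" using plane_arcs_Int[OF pl _ a(1)] by blast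
    then show ?thesis using a(2) by blast
  qed
  have i1a: "c1 \<inter> a \<subseteq> {u, w}" unfolding c1_def using offa by blast
  have i2a: "c2 \<inter> a \<subseteq> {u, w}" unfolding c2_def using offa by blast
  have meets: "a \<inter> inside (c1 \<union> c2) \<noteq> {}"
    using plane_arcs_interior(2)[OF pl a(1)] ins unfolding L_def[symmetric] C_def[symmetric]
    unfolding C[symmetric] C_def L_def by blast
  have eqs: "c1 \<inter> c2 = {u, w}" "c1 \<inter> a = {u, w}" "c2 \<inter> a = {u, w}"
    using i12 i1a i2a uwc1 uwc2 uwa by blast+
  note theta = joins_theta[OF j1 j2 ja eqs meets]
  show "inside C1 \<inter> inside C2 = {}" "inside C1 \<union> inside C2 \<union> (a - {u, w}) = inside C"
    unfolding C C1 C2 by (fact theta)+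
  show "polygon V A (u # ys @ [w]) a"
    unfolding polygon_def using d1 hy a ne(1) L(3) by (auto simp: L_def Suc_le_eq)
  have "has_arcs V A [u, w]" using a(1,2) by (rule has_arcs_pair)
  then have h2: "has_arcs V A (xs @ u # w # zs)"
    using hx hz unfolding has_arcs_def cL2 c2 by (simp only: ball_Un)
  have "length (xs @ u # w # zs) \<ge> 3" using ne(2) by (cases xs; cases zs) auto
  moreover have "hd (xs @ u # w # zs) = hd L" "last (xs @ u # w # zs) = last L"
    by (simp_all add: L_def hd_append)
  ultimately show "polygon V A (xs @ u # w # zs) b"
    unfolding polygon_def using d2 h2 b L(3) by (auto simp: L_def)
qed

text \<open>
  The inside is cut along a chord into two shorter polygons. By induction both are triangulated,
  and the tree of the part at the chord is grafted onto the tree of the part at the base edge.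
\<close>

lemma polygon_triangulation:
  assumes pl: "plane_arcs V A" and P: "polygon V A L b"
    and IV: "inside (cycle_set V A L b) \<inter> V = {}"
    and tri: "triangular_faces V A (inside (cycle_set V A L b))"
  shows "\<exists>t. hd L # inorder t @ [last L] = L \<and>
    edges_within V A (inside (cycle_set V A L b) \<union> cycle_set V A L b) = tedges (hd L) t (last L)"
  using P IV tri
proof (induction "length L" arbitrary: L b rule: less_induct)
  case less
  let ?C = "cycle_set V A L b"
  note P = less.prems(1) and IV = less.prems(2) and tri = less.prems(3)
  note J = polygon_Jordan[OF pl P]
  have P': "length L \<ge> 3" "distinct L" "set L \<subseteq> V" "has_arcs V A L" "b \<in> A" "b \<inter> V = {hd L, last L}"
    using P by (simp_all add: polygon_def)
  show ?case
  proof (cases "\<exists>a\<in>A. (a - V) \<inter> inside ?C \<noteq> {}")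
    case False
    then show ?thesis using polygon_no_chord[OF pl P IV tri] by blast
  next
    case True
    then obtain a where a: "a \<in> A" "(a - V) \<inter> inside ?C \<noteq> {}" by blast
    have IC: "inside ?C \<inter> ?C = {}" by (rule inside_no_overlap)
    have "c \<subseteq> ?C" if "c \<in> insert b (path_arcs V A L)" for c using that by (auto simp: cycle_set_def)
    then have an: "a \<notin> insert b (path_arcs V A L)" using a(2) IC by blast
    then have ins: "a - V \<subseteq> inside ?C" using arc_off_cycle(2)[OF pl P a(1)] a(2) by blast
    have clI: "closure (inside ?C) = inside ?C \<union> ?C"
      using J(5) closure_Un_frontier[of "inside ?C"] by simp
    \<comment> \<open>The ends of the chord are limits of points of the inside, and so they are on the cycle.\<close>
    have acl: "a \<subseteq> inside ?C \<union> ?C"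
      using plane_arcs_interior(3)[OF pl a(1)] closure_mono[OF ins] clI by blast
    obtain p q where pq: "joins a p q" "a \<inter> V = {p, q}" by (rule plane_arcsE[OF pl a(1)])
    have "a \<inter> V \<subseteq> set L" using acl IV polygon_facts(5)[OF pl P] by blast
    then have "p \<in> set L" "q \<in> set L" "p \<noteq> q" using pq joins_ends by auto
    then obtain xs u ys w zs where L: "L = xs @ u # ys @ w # zs" and "{u, w} = {p, q}"
      by (rule list_split_two)
    then have aV: "a \<inter> V = {u, w}" using pq(2) by simp
    have ne1: "ys \<noteq> []"
    proof
      assume "ys = []"
      then have "(u, w) \<in> consec L" unfolding L using consec_append[of xs u "w # zs"] by simp
      then have "a \<in> path_arcs V A L" using a(1) aV by (auto simp: path_arcs_def)
      then show False using an by simp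
    qed
    have ne2: "xs @ zs \<noteq> []"
    proof
      assume "xs @ zs = []"
      then have "b \<inter> V = {u, w}" using P'(6) by (simp add: L)
      then show False using plane_arcs_eq[OF pl a(1) P'(5)] aV an by simp
    qed
    let ?L1 = "u # ys @ [w]" and ?L2 = "xs @ u # w # zs"
    let ?C1 = "cycle_set V A ?L1 a" and ?C2 = "cycle_set V A ?L2 b"
    note S = polygon_split[OF pl P[unfolded L] a(1) aV an[unfolded L] ins[unfolded L] ne1 ne2, folded L]
    note J1 = polygon_Jordan[OF pl S(1)] and J2 = polygon_Jordan[OF pl S(2)]
    have I1: "inside ?C1 \<subseteq> inside ?C" and I2: "inside ?C2 \<subseteq> inside ?C" using S(4) by blast+
    have "a \<subseteq> \<Union>A" using a(1) by blast
    moreover have uwa: "{u, w} \<subseteq> a" using aV by blast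
    ultimately have split: "inside ?C - \<Union>A = (inside ?C1 \<union> inside ?C2) - \<Union>A"
      using S(4) by blast
    have "components (inside ?C1 - \<Union>A) \<subseteq> components (inside ?C - \<Union>A)"
      unfolding split using components_open_part[OF J1(2) J2(2) S(3)] by blast
    then have tri1: "triangular_faces V A (inside ?C1)" using tri unfolding triangular_faces_def by blast
    have "components (inside ?C2 - \<Union>A) \<subseteq> components (inside ?C - \<Union>A)"
      unfolding split using components_open_part[OF J2(2) J1(2)] S(3) by (metis Int_commute Un_commute subsetI)
    then have tri2: "triangular_faces V A (inside ?C2)" using tri unfolding triangular_faces_def by blast
    have IV1: "inside ?C1 \<inter> V = {}" and IV2: "inside ?C2 \<inter> V = {}" using IV I1 I2 by blast+
    have len: "length ?L1 < length L" "length ?L2 < length L"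
      using ne1 ne2 unfolding L by (cases xs; cases zs; auto)+
    obtain t1 where t1: "u # inorder t1 @ [w] = ?L1"
      "edges_within V A (inside ?C1 \<union> ?C1) = tedges u t1 w"
      using less.hyps[OF len(1) S(1) IV1 tri1] by auto
    have hl: "hd ?L2 = hd L" "last ?L2 = last L" by (simp_all add: L hd_append)
    obtain t2 where t2: "hd L # inorder t2 @ [last L] = ?L2"
      "edges_within V A (inside ?C2 \<union> ?C2) = tedges (hd L) t2 (last L)"
      using less.hyps[OF len(2) S(2) IV2 tri2] unfolding hl by blast
    obtain t where t: "hd L # inorder t @ [last L] = xs @ u # inorder t1 @ w # zs"
      "tedges (hd L) t (last L) = tedges (hd L) t2 (last L) \<union> tedges u t1 w"
      using graft[OF t2(1)] by blast
    have "inorder t1 = ys" using t1(1) by simp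
    then have "hd L # inorder t @ [last L] = L" using t(1) L by simp
    \<comment> \<open>Every arc in the closed polygon lies in one of the closed parts, because it does not cross the chord.\<close>
    moreover have "c \<subseteq> inside ?C \<union> ?C \<longleftrightarrow> c \<subseteq> inside ?C1 \<union> ?C1 \<or> c \<subseteq> inside ?C2 \<union> ?C2" if c: "c \<in> A" for c
    proof
      have "?C1 \<union> ?C2 \<subseteq> inside ?C \<union> ?C" using S(5) acl by blast
      then show "c \<subseteq> inside ?C \<union> ?C" if "c \<subseteq> inside ?C1 \<union> ?C1 \<or> c \<subseteq> inside ?C2 \<union> ?C2"
        using that I1 I2 by blast
      assume cs: "c \<subseteq> inside ?C \<union> ?C"
      have aC1: "a \<subseteq> ?C1" by (simp add: cycle_set_def)
      show "c \<subseteq> inside ?C1 \<union> ?C1 \<or> c \<subseteq> inside ?C2 \<union> ?C2"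
      proof (cases "c = a \<or> c \<in> insert a (insert b (path_arcs V A ?L1 \<union> path_arcs V A ?L2))")
        case True
        then show ?thesis using aC1 by (auto simp: cycle_set_def)
      next
        case False
        have off1: "(c - V) \<inter> ?C1 = {}" by (rule arc_off_cycle(1)[OF pl S(1) c]) (use False in blast)
        have off2: "(c - V) \<inter> ?C2 = {}" by (rule arc_off_cycle(1)[OF pl S(2) c]) (use False in blast)
        have "c - V \<subseteq> inside ?C1 \<union> inside ?C2" using cs off1 off2 S(4,5) aC1 by blast
        then have "inside ?C1 \<inter> (c - V) = {} \<or> inside ?C2 \<inter> (c - V) = {}"
          using connectedD[OF plane_arcs_interior(1)[OF pl c] J1(2) J2(2)] S(3) by blast
        then have "c - V \<subseteq> inside ?C1 \<or> c - V \<subseteq> inside ?C2"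
          using \<open>c - V \<subseteq> inside ?C1 \<union> inside ?C2\<close> by blast
        moreover have "closure (inside ?C1) = inside ?C1 \<union> ?C1" "closure (inside ?C2) = inside ?C2 \<union> ?C2"
          using J1(5) J2(5) closure_Un_frontier[of "inside ?C1"] closure_Un_frontier[of "inside ?C2"] by simp_all
        ultimately show ?thesis
          using plane_arcs_interior(3)[OF pl c] closure_mono[of "c - V"] by blast
      qed
    qed
    then have "edges_within V A (inside ?C \<union> ?C)
        = edges_within V A (inside ?C1 \<union> ?C1) \<union> edges_within V A (inside ?C2 \<union> ?C2)"
      unfolding edges_within_def by blast
    then have "edges_within V A (inside ?C \<union> ?C) = tedges (hd L) t (last L)"
      unfolding t(2) t1(2) t2(2) by blast
    ultimately show ?thesis by blast
  qed
qed

section \<open>Mops are trees\<close>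

lemma cycle_edges_consec:
  assumes "vs \<noteq> []"
  shows "cycle_edges vs = {{p, q} | p q. (p, q) \<in> consec vs} \<union> {{last vs, hd vs}}"
proof
  let ?n = "length vs"
  have ends: "last vs = vs ! (?n - 1)" "hd vs = vs ! 0"
    using assms by (simp_all add: last_conv_nth hd_conv_nth)
  show "cycle_edges vs \<subseteq> {{p, q} | p q. (p, q) \<in> consec vs} \<union> {{last vs, hd vs}}"
  proof
    fix e assume "e \<in> cycle_edges vs"
    then obtain i where i: "i < ?n" "e = {vs ! i, vs ! (Suc i mod ?n)}" by (auto simp: cycle_edges_def)
    show "e \<in> {{p, q} | p q. (p, q) \<in> consec vs} \<union> {{last vs, hd vs}}"
    proof (cases "Suc i < ?n")
      case True
      then have "(vs ! i, vs ! Suc i) \<in> consec vs" by (auto simp: consec_iff_nth)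
      then show ?thesis using i True by auto
    next
      case False
      then have "Suc i = ?n" using i by simp
      then have "i = ?n - 1" "Suc i mod ?n = 0" by simp_all
      then show ?thesis using i ends by simp
    qed
  qed
  show "{{p, q} | p q. (p, q) \<in> consec vs} \<union> {{last vs, hd vs}} \<subseteq> cycle_edges vs"
  proof
    fix e assume "e \<in> {{p, q} | p q. (p, q) \<in> consec vs} \<union> {{last vs, hd vs}}"
    then consider i where "Suc i < ?n" "e = {vs ! i, vs ! Suc i}" | "e = {last vs, hd vs}"
      by (auto simp: consec_iff_nth)
    then show "e \<in> cycle_edges vs"
    proof cases
      case 1
      then show ?thesis by (auto simp: cycle_edges_def intro!: image_eqI[of _ _ i])
    next
      case 2
      then show ?thesis using assms ends
        by (auto simp: cycle_edges_def intro!: image_eqI[of _ _ "?n - 1"])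
    qed
  qed
qed

lemma plane_graph_plane_arcs: "is_plane_graph P \<Longrightarrow> plane_arcs (pverts P) (parcs P)"
  unfolding is_plane_graph_def plane_arcs_def joins_def by (elim conjE) (intro conjI; fast)

lemma bounded_by_cycle_polygon:
  assumes pl: "plane_arcs (pverts P) (parcs P)" and F: "bounded_by_cycle P F vs"
  obtains b where "polygon (pverts P) (parcs P) vs b" "frontier F = cycle_set (pverts P) (parcs P) vs b"
proof -
  let ?V = "pverts P" and ?A = "parcs P"
  have vs: "length vs \<ge> 3" "distinct vs" "set vs \<subseteq> ?V"
    and E: "\<forall>i<length vs. {vs ! i, vs ! (Suc i mod length vs)} \<in> (\<lambda>a. a \<inter> ?V) ` ?A"
    and fr: "frontier F = \<Union>{a \<in> ?A. a \<inter> ?V \<in> cycle_edges vs}"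
    using F by (auto simp: bounded_by_cycle_def is_cycle_def abstract_graph_def)
  have "vs \<noteq> []" using vs(1) by auto
  note ce = cycle_edges_consec[OF this]
  have all: "e \<in> (\<lambda>a. a \<inter> ?V) ` ?A" if "e \<in> cycle_edges vs" for e
    using that E by (auto simp: cycle_edges_def)
  have "{last vs, hd vs} \<in> (\<lambda>a. a \<inter> ?V) ` ?A" by (rule all) (simp add: ce)
  then obtain b where b: "b \<in> ?A" "b \<inter> ?V = {last vs, hd vs}" by blast
  have "has_arcs ?V ?A vs"
    unfolding has_arcs_def
  proof (intro ballI, clarify)
    fix p q assume "(p, q) \<in> consec vs"
    then have "{p, q} \<in> (\<lambda>a. a \<inter> ?V) ` ?A" by (intro all) (auto simp: ce)
    then show "\<exists>a\<in>?A. a \<inter> ?V = {p, q}" by blast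
  qed
  then have P: "polygon ?V ?A vs b"
    unfolding polygon_def using vs b by (simp add: insert_commute)
  have "{a \<in> ?A. a \<inter> ?V \<in> cycle_edges vs} = path_arcs ?V ?A vs \<union> path_arcs ?V ?A [last vs, hd vs]"
    unfolding ce path_arcs_def by auto
  also have "path_arcs ?V ?A [last vs, hd vs] = {b}" by (rule path_arcs_pair[OF pl b])
  finally have "frontier F = cycle_set ?V ?A vs b" unfolding fr cycle_set_def by (simp add: Un_commute)
  then show thesis using that P by blast
qed

text \<open>
  The exterior face is the outside of its boundary cycle, so that this cycle is a polygon through
  all vertices with all arcs inside or on it.
\<close>

theorem mop_tree_graph:
  assumes "mop P"
  obtains a t b where "distinct (a # inorder t @ [b])" "abstract_graph P = tree_graph a t b"
proof -
  let ?V = "pverts P" and ?A = "parcs P"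
  have pg: "is_plane_graph P" using assms by (simp add: mop_def triangulated_disc_def)
  note pl = plane_graph_plane_arcs[OF pg]
  obtain F where F: "F \<in> faces P" "\<not> bounded F" using exterior_face_unique[OF pg] by blast
  obtain vs where "bounded_by_cycle P F vs"
    using assms F by (auto simp: mop_def triangulated_disc_def)
  then obtain b where Pol: "polygon ?V ?A vs b" and fr: "frontier F = cycle_set ?V ?A vs b"
    by (rule bounded_by_cycle_polygon[OF pl])
  let ?C = "cycle_set ?V ?A vs b"
  note J = polygon_Jordan[OF pl Pol]
  have VC: "?V \<subseteq> ?C" using assms F fr by (auto simp: mop_def)
  then have Vset: "?V = set vs" using polygon_facts(5)[OF pl Pol] by blast
  have vs: "length vs \<ge> 3" "distinct vs" "b \<in> ?A" using Pol by (simp_all add: polygon_def)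
  have CA: "?C \<subseteq> \<Union>?A" using vs(3) by (auto simp: cycle_set_def path_arcs_def)
  then have dr: "drawing P = \<Union>?A" using VC by (auto simp: drawing_def)
  have Fc: "F \<noteq> {}" "connected F" "F \<subseteq> - drawing P"
    using F(1) in_components_nonempty in_components_connected in_components_subset
    unfolding faces_def by blast+
  have FC: "F \<subseteq> inside ?C \<union> outside ?C" using Fc(3) CA J(8) dr by blast
  \<comment> \<open>The face is unbounded and so avoids the inside. It fills the outside, because its frontier is the
    cycle.\<close>
  have "F \<inter> inside ?C = {}"
  proof (rule ccontr)
    assume "F \<inter> inside ?C \<noteq> {}"
    moreover have "inside ?C \<inter> outside ?C = {}" by (rule inside_Int_outside)
    ultimately have "F \<subseteq> inside ?C"
      using connectedD[OF Fc(2) J(2) J(7)] FC by blast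
    then show False using F(2) J(4) bounded_subset by blast
  qed
  then have F_out: "F \<subseteq> outside ?C" using FC by blast
  have "outside ?C \<subseteq> F"
  proof (rule ccontr)
    assume "\<not> outside ?C \<subseteq> F"
    then have "outside ?C \<inter> frontier F \<noteq> {}"
      using Fc(1) F_out by (intro connected_Int_frontier J(6)) auto
    then show False using fr J(8) by blast
  qed
  then have F_eq: "F = outside ?C" using F_out by blast
  have IV: "inside ?C \<inter> ?V = {}" using VC J(8) by blast
  have "triangular_faces ?V ?A (inside ?C)"
    unfolding triangular_faces_def
  proof
    fix F' assume F': "F' \<in> components (inside ?C - \<Union>?A)"
    have "inside ?C \<inter> outside ?C = {}" by (rule inside_Int_outside)
    then have "F' \<in> components ((inside ?C \<union> outside ?C) - \<Union>?A)"
      using components_open_part[OF J(2) J(7) _ F'] by blast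
    moreover have "(inside ?C \<union> outside ?C) - \<Union>?A = - drawing P" using J(8) CA dr by blast
    ultimately have "F' \<in> faces P" by (simp add: faces_def)
    moreover have "bounded F'"
      using in_components_subset[OF F'] J(4) bounded_subset by blast
    ultimately obtain vs' where vs': "length vs' = 3" "bounded_by_cycle P F' vs'"
      using assms by (auto simp: mop_def triangulated_disc_def)
    obtain b' where "polygon ?V ?A vs' b'" "frontier F' = cycle_set ?V ?A vs' b'"
      by (rule bounded_by_cycle_polygon[OF pl vs'(2)])
    then have "frontier F' \<inter> ?V = set vs'" "distinct vs'"
      using polygon_facts(5)[OF pl] by (simp_all add: polygon_def)
    then show "card (frontier F' \<inter> ?V) = 3" using vs'(1) distinct_card by metis
  qed
  from polygon_triangulation[OF pl Pol IV this]
  obtain t where t: "hd vs # inorder t @ [last vs] = vs"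
    "edges_within ?V ?A (inside ?C \<union> ?C) = tedges (hd vs) t (last vs)" by blast
  have "a \<subseteq> inside ?C \<union> ?C" if "a \<in> ?A" for a
  proof -
    have "a \<inter> F = {}" using that Fc(3) dr by blast
    then show ?thesis using F_eq J(8) by blast
  qed
  then have "edges_within ?V ?A (inside ?C \<union> ?C) = (\<lambda>a. a \<inter> ?V) ` ?A"
    unfolding edges_within_def by blast
  moreover have "set vs = insert (hd vs) (insert (last vs) (set_tree t))"
    using arg_cong[OF t(1), of set] by auto
  ultimately have "abstract_graph P = tree_graph (hd vs) t (last vs)"
    using t(2) Vset by (simp add: abstract_graph_def tree_graph_def)
  moreover have "distinct (hd vs # inorder t @ [last vs])" using t(1) vs(2) by simp
  ultimately show thesis using that by blast
qed

section \<open>Polygons inscribed in a parabola\<close>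

text \<open>
  With vertices \<open>(x, x\<^sup>2)\<close> on a parabola it is convenient to measure heights from the parabola.
  The line through the points at \<open>u\<close> and \<open>v\<close> is \<open>y = (u + v) x - u v\<close>, and its height
  above the parabola is the product \<open>(x - u) (v - x)\<close>. Nested chords thus compare factor by
  factor.
\<close>

definition chord :: "real \<Rightarrow> real \<Rightarrow> real \<Rightarrow> real" where
  "chord u v x = (x - u) * (v - x)"

definition pt :: "real \<Rightarrow> complex" where
  "pt x = Complex x (x\<^sup>2)"

definition ht :: "complex \<Rightarrow> real" where
  "ht z = Im z - (Re z)\<^sup>2"

text \<open>
  Written as a convex hull, the segment is a function of the edge, which is an unordered pair.
\<close>

definition seg :: "real set \<Rightarrow> complex set" where
  "seg e = convex hull (pt ` e)"

lemma pt_simps [simp]: "Re (pt x) = x" "ht (pt x) = 0" "pt x = pt y \<longleftrightarrow> x = y"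
  by (auto simp: pt_def ht_def)

lemma inj_pt: "inj_on pt A"
  by (auto simp: inj_on_def)

lemma complex_eq_ht: "z = w \<longleftrightarrow> Re z = Re w \<and> ht z = ht w"
  by (auto simp: complex_eq_iff ht_def)

lemma chord_nonneg: "u \<le> x \<Longrightarrow> x \<le> v \<Longrightarrow> 0 \<le> chord u v x"
  by (simp add: chord_def)

lemma chord_nonpos: "x \<le> u \<or> v \<le> x \<Longrightarrow> u \<le> v \<Longrightarrow> chord u v x \<le> 0"
  by (auto simp: chord_def mult_le_0_iff)

lemma chord_eq_0 [simp]: "chord u v u = 0" "chord u v v = 0"
  by (simp_all add: chord_def)

lemma chord_mono_right: "a \<le> x \<Longrightarrow> c \<le> b \<Longrightarrow> chord a c x \<le> chord a b x"
  by (auto simp: chord_def intro: mult_left_mono)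

lemma chord_mono_left: "x \<le> b \<Longrightarrow> a \<le> c \<Longrightarrow> chord c b x \<le> chord a b x"
  by (auto simp: chord_def intro: mult_right_mono)

lemma chord_mono_right_strict: "a < x \<Longrightarrow> c < b \<Longrightarrow> chord a c x < chord a b x"
  by (simp add: chord_def)

lemma chord_mono_left_strict: "x < b \<Longrightarrow> a < c \<Longrightarrow> chord c b x < chord a b x"
  by (simp add: chord_def)

lemma ht_chord_iff:
  "chord u v (Re z) \<le> ht z \<longleftrightarrow> (u + v) * Re z - u * v \<le> Im z"
  "chord u v (Re z) < ht z \<longleftrightarrow> (u + v) * Re z - u * v < Im z"
  "ht z \<le> chord u v (Re z) \<longleftrightarrow> Im z \<le> (u + v) * Re z - u * v"
  "ht z < chord u v (Re z) \<longleftrightarrow> Im z < (u + v) * Re z - u * v"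
  "ht z = chord u v (Re z) \<longleftrightarrow> Im z = (u + v) * Re z - u * v"
  by (simp_all add: chord_def ht_def power2_eq_square algebra_simps)

lemma seg_eq_closed_segment: "seg {u, v} = closed_segment (pt u) (pt v)"
  by (simp add: seg_def segment_convex_hull)

lemma seg_iff:
  assumes "u < v"
  shows "z \<in> seg {u, v} \<longleftrightarrow> u \<le> Re z \<and> Re z \<le> v \<and> ht z = chord u v (Re z)"
proof
  assume "z \<in> seg {u, v}"
  then obtain s where s: "0 \<le> s" "s \<le> 1" "z = (1 - s) *\<^sub>R pt u + s *\<^sub>R pt v"
    unfolding seg_eq_closed_segment in_segment by blast
  have "Re z = (1 - s) * u + s * v" using s(3) by (simp add: pt_def)
  then have Re: "Re z = u + s * (v - u)" by (simp add: algebra_simps)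
  have Im: "Im z = (1 - s) * u\<^sup>2 + s * v\<^sup>2" using s(3) by (simp add: pt_def)
  have "0 \<le> s * (v - u)" "s * (v - u) \<le> 1 * (v - u)"
    using s assms by (auto intro: mult_right_mono simp del: mult_1)
  then have "u \<le> Re z" "Re z \<le> v" using Re by simp_all
  moreover have "Im z = (u + v) * Re z - u * v"
    unfolding Re Im by (simp add: power2_eq_square algebra_simps)
  then have "ht z = chord u v (Re z)" by (simp add: ht_chord_iff)
  ultimately show "u \<le> Re z \<and> Re z \<le> v \<and> ht z = chord u v (Re z)" by simp
next
  assume z: "u \<le> Re z \<and> Re z \<le> v \<and> ht z = chord u v (Re z)"
  define s where "s = (Re z - u) / (v - u)"
  have s: "0 \<le> s" "s \<le> 1" using z assms by (auto simp: s_def divide_simps)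
  have Re: "Re z = u + s * (v - u)" using assms by (simp add: s_def)
  have "Im z = (u + v) * Re z - u * v" using z by (simp add: ht_chord_iff)
  then have Im: "Im z = (1 - s) * u\<^sup>2 + s * v\<^sup>2"
    unfolding Re by (simp add: power2_eq_square algebra_simps)
  have "z = (1 - s) *\<^sub>R pt u + s *\<^sub>R pt v"
    by (rule complex_eqI) (simp_all add: pt_def Im, simp add: Re algebra_simps)
  then show "z \<in> seg {u, v}" unfolding seg_eq_closed_segment in_segment using s by blast
qed

abbreviation increasing :: "real \<Rightarrow> real tree \<Rightarrow> real \<Rightarrow> bool" where
  "increasing a t b \<equiv> sorted_wrt (<) (a # inorder t @ [b])"

lemma increasing_Node:
  assumes "increasing a (Node l c r) b"
  shows "increasing a l c" "increasing c r b" "a < c" "c < b"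
  using assms by (auto simp: sorted_wrt_append)

lemma increasing_less: "increasing a t b \<Longrightarrow> a < b"
  by (auto simp: sorted_wrt_append)

text \<open>
  The height of the lower boundary, which consists of the sides of the polygon other than the base
  edge.
\<close>

fun low :: "real \<Rightarrow> real tree \<Rightarrow> real \<Rightarrow> real \<Rightarrow> real" where
  "low a Leaf b x = chord a b x"
| "low a (Node l c r) b x = (if x \<le> c then low a l c x else low c r b x)"

definition region :: "real \<Rightarrow> real tree \<Rightarrow> real \<Rightarrow> complex set" where
  "region a t b = {z. a \<le> Re z \<and> Re z \<le> b \<and> low a t b (Re z) \<le> ht z \<and> ht z \<le> chord a b (Re z)}"

definition inner_region :: "real \<Rightarrow> real tree \<Rightarrow> real \<Rightarrow> complex set" where
  "inner_region a t b = {z. a < Re z \<and> Re z < b \<and> low a t b (Re z) < ht z \<and> ht z < chord a b (Re z)}"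

lemma low_bounds:
  assumes "increasing a t b" "a \<le> x" "x \<le> b"
  shows "0 \<le> low a t b x \<and> low a t b x \<le> chord a b x"
  using assms
proof (induction t arbitrary: a b)
  case Leaf
  then show ?case by (simp add: chord_nonneg)
next
  case (Node l c r)
  note i = increasing_Node[OF Node.prems(1)]
  show ?case
  proof (cases "x \<le> c")
    case True
    then show ?thesis using Node.IH(1)[OF i(1)] Node.prems chord_mono_right[of a x c b] i by simp
  next
    case False
    then show ?thesis using Node.IH(2)[OF i(2)] Node.prems chord_mono_left[of x b a c] i by simp
  qed
qed

lemma leaf_pairs_ordered:
  assumes "increasing a t b" "(u, v) \<in> leaf_pairs a t b"
  shows "a \<le> u \<and> u < v \<and> v \<le> b"
  using assms
proof (induction t arbitrary: a b)
  case (Node l c r)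
  note i = increasing_Node[OF Node.prems(1)]
  show ?case using Node.IH(1)[OF i(1)] Node.IH(2)[OF i(2)] Node.prems(2) i by auto
qed auto

lemma low_leaf_pair:
  assumes "increasing a t b" "(u, v) \<in> leaf_pairs a t b" "a \<le> x" "x \<le> b"
  shows "chord u v x \<le> low a t b x \<and> (u \<le> x \<longrightarrow> x \<le> v \<longrightarrow> low a t b x = chord u v x)"
  using assms
proof (induction t arbitrary: a b)
  case (Node l c r)
  note i = increasing_Node[OF Node.prems(1)]
  consider "(u, v) \<in> leaf_pairs a l c" | "(u, v) \<in> leaf_pairs c r b" using Node.prems(2) by auto
  then show ?case
  proof cases
    case 1
    note o = leaf_pairs_ordered[OF i(1) 1]
    show ?thesis
    proof (cases "x \<le> c")
      case True
      then show ?thesis using Node.IH(1)[OF i(1) 1] Node.prems by simp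
    next
      case False
      then have "chord u v x \<le> 0" using o by (intro chord_nonpos) auto
      then show ?thesis using low_bounds[OF i(2), of x] False Node.prems o by auto
    qed
  next
    case 2
    note o = leaf_pairs_ordered[OF i(2) 2]
    show ?thesis
    proof (cases "x \<le> c")
      case True
      have "chord u v x \<le> 0" using o True by (intro chord_nonpos) auto
      moreover have "0 \<le> low a l c x" using low_bounds[OF i(1), of x] True Node.prems by simp
      moreover have "low a l c x = chord u v x" if "u \<le> x"
      proof -
        have "x = c" "x = u" using that o True by auto
        moreover have "low a l c c = 0" using low_bounds[OF i(1), of c] i by simp
        ultimately show ?thesis by simp
      qed
      ultimately show ?thesis using True by auto
    next
      case False
      then show ?thesis using Node.IH(2)[OF i(2) 2] Node.prems by simp
    qed
  qed
qed simp

lemma leaf_pair_over: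
  assumes "increasing a t b" "a \<le> x" "x \<le> b"
  shows "\<exists>(u, v)\<in>leaf_pairs a t b. u \<le> x \<and> x \<le> v"
  using assms
proof (induction t arbitrary: a b)
  case (Node l c r)
  note i = increasing_Node[OF Node.prems(1)]
  show ?case
  proof (cases "x \<le> c")
    case True
    then show ?thesis using Node.IH(1)[OF i(1)] Node.prems by auto
  next
    case False
    then show ?thesis using Node.IH(2)[OF i(2)] Node.prems by auto
  qed
qed simp

text \<open>
  The lower boundary is the maximum of the lines through its sides, since a side is below the
  parabola outside its own interval. This is what makes the region convex.
\<close>

lemma low_le_iff:
  assumes "increasing a t b" "a \<le> x" "x \<le> b"
  shows "low a t b x \<le> y \<longleftrightarrow> (\<forall>(u, v)\<in>leaf_pairs a t b. chord u v x \<le> y)"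
    "low a t b x < y \<longleftrightarrow> (\<forall>(u, v)\<in>leaf_pairs a t b. chord u v x < y)"
proof -
  obtain u v where uv: "(u, v) \<in> leaf_pairs a t b" "u \<le> x" "x \<le> v"
    using leaf_pair_over[OF assms] by auto
  then have eq: "low a t b x = chord u v x" using low_leaf_pair[OF assms(1) uv(1) assms(2,3)] by simp
  have le: "chord p q x \<le> low a t b x" if "(p, q) \<in> leaf_pairs a t b" for p q
    using low_leaf_pair[OF assms(1) that assms(2,3)] by simp
  show "low a t b x \<le> y \<longleftrightarrow> (\<forall>(u, v)\<in>leaf_pairs a t b. chord u v x \<le> y)"
    using uv(1) eq le by (auto intro: order_trans)
  show "low a t b x < y \<longleftrightarrow> (\<forall>(u, v)\<in>leaf_pairs a t b. chord u v x < y)"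
    using uv(1) eq le by (auto intro: le_less_trans)
qed

lemma finite_leaf_pairs: "finite (leaf_pairs a t b)"
  by (induction t arbitrary: a b) auto

lemma region_halfplanes:
  assumes "increasing a t b"
  shows "region a t b = {z. a \<le> Re z} \<inter> {z. Re z \<le> b} \<inter> {z. Im z \<le> (a + b) * Re z - a * b} \<inter>
    (\<Inter>(u, v)\<in>leaf_pairs a t b. {z. (u + v) * Re z - u * v \<le> Im z})"
  unfolding region_def using low_le_iff(1)[OF assms] by (auto simp: ht_chord_iff)

lemma inner_region_halfplanes:
  assumes "increasing a t b"
  shows "inner_region a t b = {z. a < Re z} \<inter> {z. Re z < b} \<inter> {z. Im z < (a + b) * Re z - a * b} \<inter>
    (\<Inter>(u, v)\<in>leaf_pairs a t b. {z. (u + v) * Re z - u * v < Im z})"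
  unfolding inner_region_def using low_le_iff(2)[OF assms] by (auto simp: ht_chord_iff)

lemma closed_region: "increasing a t b \<Longrightarrow> closed (region a t b)"
  unfolding region_halfplanes
  by (intro closed_Int closed_INT ballI) (auto intro!: closed_Collect_le continuous_intros split: prod.split)

lemma open_inner_region: "increasing a t b \<Longrightarrow> open (inner_region a t b)"
  unfolding inner_region_halfplanes
  by (intro open_Int open_INT finite_leaf_pairs ballI) (auto intro!: open_Collect_less continuous_intros split: prod.split)

lemma convex_halfplane:
  "convex {z. s * Re z - d \<le> Im z}" "convex {z. Im z \<le> s * Re z - d}"
  "convex {z. a \<le> Re z}" "convex {z. Re z \<le> b}"
proof -
  have "{z. s * Re z - d \<le> Im z} = {z. inner (Complex s (-1)) z \<le> d}" for s d
    by (auto simp: inner_complex_def)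
  then show "convex {z. s * Re z - d \<le> Im z}" by (metis convex_halfspace_le)
  have "{z. Im z \<le> s * Re z - d} = {z. inner (Complex s (-1)) z \<ge> d}" for s d
    by (auto simp: inner_complex_def)
  then show "convex {z. Im z \<le> s * Re z - d}" by (metis convex_halfspace_ge)
  have "{z. a \<le> Re z} = {z. inner 1 z \<ge> a}" for a by (auto simp: inner_complex_def)
  then show "convex {z. a \<le> Re z}" by (metis convex_halfspace_ge)
  have "{z. Re z \<le> b} = {z. inner 1 z \<le> b}" for b by (auto simp: inner_complex_def)
  then show "convex {z. Re z \<le> b}" by (metis convex_halfspace_le)
qed

lemma convex_region: "increasing a t b \<Longrightarrow> convex (region a t b)"
  unfolding region_halfplanes
  by (intro convex_Int convex_INT convex_halfplane ballI) (auto split: prod.split intro: convex_halfplane)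

lemma bounded_region:
  assumes "increasing a t b"
  shows "bounded (region a t b)"
proof (rule bounded_subset[OF bounded_cbox])
  show "region a t b \<subseteq> cbox (Complex a 0) (Complex b ((b - a) * (b - a) + (\<bar>a\<bar> + \<bar>b\<bar>)\<^sup>2))"
  proof
    fix z assume "z \<in> region a t b"
    then have z: "a \<le> Re z" "Re z \<le> b" "low a t b (Re z) \<le> ht z" "ht z \<le> chord a b (Re z)"
      by (simp_all add: region_def)
    have "0 \<le> ht z" using low_bounds[OF assms z(1,2)] z(3) by simp
    then have "0 \<le> Im z" unfolding ht_def using zero_le_power2[of "Re z"] by linarith
    have "chord a b (Re z) \<le> (b - a) * (b - a)" unfolding chord_def using z(1,2) by (intro mult_mono) auto
    moreover have "(Re z)\<^sup>2 \<le> (\<bar>a\<bar> + \<bar>b\<bar>)\<^sup>2"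
      using z(1,2) by (intro abs_le_square_iff[THEN iffD1]) auto
    ultimately have "Im z \<le> (b - a) * (b - a) + (\<bar>a\<bar> + \<bar>b\<bar>)\<^sup>2" using z(4) unfolding ht_def by linarith
    then show "z \<in> cbox (Complex a 0) (Complex b ((b - a) * (b - a) + (\<bar>a\<bar> + \<bar>b\<bar>)\<^sup>2))"
      using z \<open>0 \<le> Im z\<close> by (simp add: in_cbox_complex_iff)
  qed
qed

lemma inner_region_subset: "inner_region a t b \<subseteq> region a t b"
  by (auto simp: region_def inner_region_def)

lemma region_boundary_ht:
  assumes "increasing a t b" "z \<in> region a t b" "z \<notin> inner_region a t b"
  shows "ht z = chord a b (Re z) \<or> ht z = low a t b (Re z)"
proof -
  have z: "a \<le> Re z" "Re z \<le> b" "low a t b (Re z) \<le> ht z" "ht z \<le> chord a b (Re z)"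
    using assms(2) by (simp_all add: region_def)
  have "ht z = chord a b (Re z)" if "Re z = a \<or> Re z = b"
  proof -
    have "chord a b (Re z) = 0" using that by auto
    then show ?thesis using z low_bounds[OF assms(1) z(1,2)] by linarith
  qed
  then show ?thesis using z assms(3) by (fastforce simp: inner_region_def)
qed

text \<open>
  A point on the upper or the lower boundary leaves the region when it is moved vertically.
\<close>

lemma interior_region:
  assumes "increasing a t b"
  shows "interior (region a t b) = inner_region a t b"
proof
  show "inner_region a t b \<subseteq> interior (region a t b)"
    by (rule interior_maximal[OF inner_region_subset open_inner_region[OF assms]])
  show "interior (region a t b) \<subseteq> inner_region a t b"
  proof
    fix z assume z: "z \<in> interior (region a t b)"
    then obtain e where e: "e > 0" "cball z e \<subseteq> region a t b" by (auto simp: mem_interior_cball)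
    have "z + Complex 0 e \<in> cball z e" "z + Complex 0 (-e) \<in> cball z e"
      using e(1) by (auto simp: dist_norm norm_complex_def)
    then have "z + Complex 0 e \<in> region a t b" "z + Complex 0 (-e) \<in> region a t b"
      using e(2) by blast+
    then have "ht z + e \<le> chord a b (Re z)" "low a t b (Re z) \<le> ht z - e"
      by (simp_all add: region_def ht_def algebra_simps)
    then show "z \<in> inner_region a t b"
      using region_boundary_ht[OF assms, of z] z e(1) interior_subset by fastforce
  qed
qed

lemma inner_region_nonempty:
  assumes "increasing a t b" "t \<noteq> Leaf"
  shows "inner_region a t b \<noteq> {}"
proof -
  obtain l c r where t: "t = Node l c r" using assms(2) by (cases t) auto
  note i = increasing_Node[OF assms(1)[unfolded t]]
  let ?z = "Complex c (c\<^sup>2 + chord a b c / 2)"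
  have "low a l c c = 0" using low_bounds[OF i(1), of c] i by simp
  moreover have "chord a b c > 0" using i by (simp add: chord_def)
  ultimately have "?z \<in> inner_region a t b" using i by (simp add: inner_region_def t ht_def)
  then show ?thesis by blast
qed

lemma frontier_region: "increasing a t b \<Longrightarrow> frontier (region a t b) = region a t b - inner_region a t b"
  by (simp add: frontier_def interior_region closed_region)

lemma frontier_inner_region:
  assumes "increasing a t b" "t \<noteq> Leaf"
  shows "frontier (inner_region a t b) = region a t b - inner_region a t b"
proof -
  have "closure (interior (region a t b)) = closure (region a t b)"
    by (rule convex_closure_interior[OF convex_region[OF assms(1)]])
      (use inner_region_nonempty[OF assms] interior_region[OF assms(1)] in simp)
  then have "closure (inner_region a t b) = region a t b"
    using interior_region[OF assms(1)] closed_region[OF assms(1)] by simp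
  then show ?thesis
    using open_inner_region[OF assms(1)] by (simp add: frontier_def interior_open)
qed

lemma region_boundary:
  assumes "increasing a t b"
  shows "region a t b - inner_region a t b = seg {a, b} \<union> (\<Union>(u, v)\<in>leaf_pairs a t b. seg {u, v})"
proof
  show "region a t b - inner_region a t b \<subseteq> seg {a, b} \<union> (\<Union>(u, v)\<in>leaf_pairs a t b. seg {u, v})"
  proof
    fix z assume z: "z \<in> region a t b - inner_region a t b"
    then have x: "a \<le> Re z" "Re z \<le> b" by (simp_all add: region_def)
    have "ht z = chord a b (Re z) \<or> ht z = low a t b (Re z)"
      using region_boundary_ht[OF assms] z by blast
    then show "z \<in> seg {a, b} \<union> (\<Union>(u, v)\<in>leaf_pairs a t b. seg {u, v})"
    proof
      assume "ht z = chord a b (Re z)"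
      then show ?thesis using x increasing_less[OF assms] by (simp add: seg_iff)
    next
      assume h: "ht z = low a t b (Re z)"
      obtain u v where uv: "(u, v) \<in> leaf_pairs a t b" "u \<le> Re z" "Re z \<le> v"
        using leaf_pair_over[OF assms x] by auto
      then have "z \<in> seg {u, v}"
        using h low_leaf_pair[OF assms uv(1) x] leaf_pairs_ordered[OF assms uv(1)] by (simp add: seg_iff)
      then show ?thesis using uv(1) by auto
    qed
  qed
  show "seg {a, b} \<union> (\<Union>(u, v)\<in>leaf_pairs a t b. seg {u, v}) \<subseteq> region a t b - inner_region a t b"
  proof
    fix z assume "z \<in> seg {a, b} \<union> (\<Union>(u, v)\<in>leaf_pairs a t b. seg {u, v})"
    then consider "z \<in> seg {a, b}" | u v where "(u, v) \<in> leaf_pairs a t b" "z \<in> seg {u, v}" by auto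
    then show "z \<in> region a t b - inner_region a t b"
    proof cases
      case 1
      then show ?thesis using increasing_less[OF assms] low_bounds[OF assms, of "Re z"]
        by (simp add: seg_iff region_def inner_region_def)
    next
      case 2
      note o = leaf_pairs_ordered[OF assms 2(1)]
      then have z: "u \<le> Re z" "Re z \<le> v" "ht z = chord u v (Re z)" using 2(2) by (simp_all add: seg_iff)
      then have x: "a \<le> Re z" "Re z \<le> b" using o by simp_all
      then have "ht z = low a t b (Re z)" using low_leaf_pair[OF assms 2(1) x] z by simp
      then show ?thesis using low_bounds[OF assms x] x by (simp add: region_def inner_region_def)
    qed
  qed
qed

section \<open>Triangles and edges of an inscribed polygon\<close>

fun triangles :: "'a \<Rightarrow> 'a tree \<Rightarrow> 'a \<Rightarrow> ('a \<times> 'a \<times> 'a) set" where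
  "triangles a Leaf b = {}"
| "triangles a (Node l c r) b = insert (a, c, b) (triangles a l c \<union> triangles c r b)"

definition tri_region :: "real \<times> real \<times> real \<Rightarrow> complex set" where
  "tri_region T = (case T of (u, c, v) \<Rightarrow> inner_region u (Node Leaf c Leaf) v)"

lemma tri_region_iff:
  "z \<in> tri_region (u, c, v) \<longleftrightarrow> u < Re z \<and> Re z < v \<and> ht z < chord u v (Re z) \<and>
    (if Re z \<le> c then chord u c (Re z) < ht z else chord c v (Re z) < ht z)"
  by (auto simp: tri_region_def inner_region_def)

lemma seg_subset_region:
  assumes "increasing a t b" "e \<in> tedges a t b"
  shows "seg e \<subseteq> region a t b"
  using assms
proof (induction t arbitrary: a b)
  case Leaf
  then show ?case using seg_iff[of a b] by (auto simp: region_def)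
next
  case (Node l c r)
  note i = increasing_Node[OF Node.prems(1)]
  consider "e = {a, b}" | "e \<in> tedges a l c" | "e \<in> tedges c r b" using Node.prems(2) by auto
  then show ?case
  proof cases
    case 1
    then show ?thesis using region_boundary[OF Node.prems(1)] by blast
  next
    case 2
    show ?thesis
    proof
      fix z assume "z \<in> seg e"
      then have "z \<in> region a l c" using Node.IH(1)[OF i(1) 2] by blast
      then show "z \<in> region a (Node l c r) b"
        using chord_mono_right[of a "Re z" c b] i by (auto simp: region_def)
    qed
  next
    case 3
    show ?thesis
    proof
      fix z assume "z \<in> seg e"
      then have z: "z \<in> region c r b" using Node.IH(2)[OF i(2) 3] by blast
      have "low a l c c = 0" "low c r b c = 0"
        using low_bounds[OF i(1), of c] low_bounds[OF i(2), of c] i by simp_all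
      then show "z \<in> region a (Node l c r) b"
        using z chord_mono_left[of "Re z" b a c] i by (auto simp: region_def)
    qed
  qed
qed

lemma tri_region_root_disjoint:
  assumes "a < c" "c < b"
  shows "tri_region (a, c, b) \<inter> region a l c = {}" "tri_region (a, c, b) \<inter> region c r b = {}"
    "tri_region (a, c, b) \<inter> seg {a, b} = {}"
proof -
  show "tri_region (a, c, b) \<inter> region a l c = {}"
    using assms by (auto simp: tri_region_iff region_def)
  show "tri_region (a, c, b) \<inter> region c r b = {}"
  proof (rule ccontr)
    assume "\<not> ?thesis"
    then obtain z where z: "z \<in> tri_region (a, c, b)" "z \<in> region c r b" by blast
    then have "Re z \<ge> c" "ht z \<le> chord c b (Re z)" by (simp_all add: region_def)
    then show False using z(1) by (cases "Re z = c") (auto simp: tri_region_iff)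
  qed
  show "tri_region (a, c, b) \<inter> seg {a, b} = {}"
    using assms seg_iff[of a b] by (auto simp: tri_region_iff)
qed

lemma inner_region_left:
  assumes "increasing a (Node l c r) b"
  shows "inner_region a l c \<subseteq> inner_region a (Node l c r) b"
proof
  note i = increasing_Node[OF assms]
  fix z assume "z \<in> inner_region a l c"
  then show "z \<in> inner_region a (Node l c r) b"
    using chord_mono_right[of a "Re z" c b] i by (auto simp: inner_region_def)
qed

lemma inner_region_right:
  assumes "increasing a (Node l c r) b"
  shows "inner_region c r b \<subseteq> inner_region a (Node l c r) b"
proof
  note i = increasing_Node[OF assms]
  fix z assume "z \<in> inner_region c r b"
  then show "z \<in> inner_region a (Node l c r) b"
    using chord_mono_left[of "Re z" b a c] i by (auto simp: inner_region_def)
qed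

lemma tri_region_inner:
  assumes "increasing a (Node l c r) b"
  shows "tri_region (a, c, b) \<subseteq> inner_region a (Node l c r) b"
proof
  note i = increasing_Node[OF assms]
  fix z assume z: "z \<in> tri_region (a, c, b)"
  then show "z \<in> inner_region a (Node l c r) b"
    using low_bounds[OF i(1), of "Re z"] low_bounds[OF i(2), of "Re z"]
    by (cases "Re z \<le> c") (auto simp: tri_region_iff inner_region_def)
qed

lemma triangle_subset:
  "increasing a t b \<Longrightarrow> T \<in> triangles a t b \<Longrightarrow> tri_region T \<subseteq> inner_region a t b"
proof (induction t arbitrary: a b)
  case (Node l c r)
  note i = increasing_Node[OF Node.prems(1)]
  show ?case
    using Node.IH(1)[OF i(1)] Node.IH(2)[OF i(2)] Node.prems(2) tri_region_inner[OF Node.prems(1)]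
      inner_region_left[OF Node.prems(1)] inner_region_right[OF Node.prems(1)]
    unfolding triangles.simps by blast
qed simp

lemma inner_regions_disjoint:
  assumes "a < c" "c < b"
  shows "inner_region a l c \<inter> region c r b = {}" "region a l c \<inter> inner_region c r b = {}"
    "inner_region a l c \<inter> seg {a, b} = {}" "inner_region c r b \<inter> seg {a, b} = {}"
proof -
  show "inner_region a l c \<inter> region c r b = {}" "region a l c \<inter> inner_region c r b = {}"
    by (auto simp: inner_region_def region_def)
  show "inner_region a l c \<inter> seg {a, b} = {}"
  proof (rule equals0I)
    fix z assume "z \<in> inner_region a l c \<inter> seg {a, b}"
    then show False using chord_mono_right[of a "Re z" c b] assms seg_iff[of a b z]
      by (simp add: inner_region_def)
  qed
  show "inner_region c r b \<inter> seg {a, b} = {}"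
  proof (rule equals0I)
    fix z assume "z \<in> inner_region c r b \<inter> seg {a, b}"
    then show False using chord_mono_left[of "Re z" b a c] assms seg_iff[of a b z]
      by (simp add: inner_region_def)
  qed
qed

lemma triangle_seg_disjoint:
  "increasing a t b \<Longrightarrow> T \<in> triangles a t b \<Longrightarrow> e \<in> tedges a t b \<Longrightarrow> tri_region T \<inter> seg e = {}"
proof (induction t arbitrary: a b)
  case (Node l c r)
  note i = increasing_Node[OF Node.prems(1)]
  note d = tri_region_root_disjoint[OF i(3,4)] inner_regions_disjoint[OF i(3,4)]
  consider "T = (a, c, b)" | "T \<in> triangles a l c" | "T \<in> triangles c r b" using Node.prems(2) by auto
  then show ?case
  proof cases
    case 1
    then show ?thesis
      using d(1)[of l] d(2)[of r] d(3) Node.prems(3) seg_subset_region[OF i(1), of e] seg_subset_region[OF i(2), of e]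
      unfolding tedges.simps by blast
  next
    case 2
    then show ?thesis
      using d(4)[of l r] d(6)[of l] triangle_subset[OF i(1) 2] Node.prems(3) seg_subset_region[OF i(2), of e]
        Node.IH(1)[OF i(1) 2]
      unfolding tedges.simps by blast
  next
    case 3
    then show ?thesis
      using d(5)[of l r] d(7)[of r] triangle_subset[OF i(2) 3] Node.prems(3) seg_subset_region[OF i(1), of e]
        Node.IH(2)[OF i(2) 3]
      unfolding tedges.simps by blast
  qed
qed simp

lemma triangles_disjoint:
  "increasing a t b \<Longrightarrow> T \<in> triangles a t b \<Longrightarrow> T' \<in> triangles a t b \<Longrightarrow> T \<noteq> T' \<Longrightarrow>
    tri_region T \<inter> tri_region T' = {}"
proof (induction t arbitrary: a b)
  case (Node l c r)
  note i = increasing_Node[OF Node.prems(1)]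
  note d = tri_region_root_disjoint[OF i(3,4)] inner_regions_disjoint[OF i(3,4)]
  have L: "tri_region S \<subseteq> inner_region a l c" if "S \<in> triangles a l c" for S
    by (rule triangle_subset[OF i(1) that])
  have R: "tri_region S \<subseteq> inner_region c r b" if "S \<in> triangles c r b" for S
    by (rule triangle_subset[OF i(2) that])
  have sub: "inner_region a l c \<subseteq> region a l c" "inner_region c r b \<subseteq> region c r b"
    by (rule inner_region_subset)+
  have "T = (a, c, b) \<or> T \<in> triangles a l c \<or> T \<in> triangles c r b"
    "T' = (a, c, b) \<or> T' \<in> triangles a l c \<or> T' \<in> triangles c r b"
    using Node.prems(2,3) by auto
  then show ?case
    using d(1)[of l] d(2)[of r] d(4)[of l r] L[of T] L[of T'] R[of T] R[of T'] sub
      Node.IH(1)[OF i(1), of] Node.IH(2)[OF i(2), of] Node.prems(4)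
    by (elim disjE) blast+
qed simp

text \<open>
  Below the base edge, a point is either above the two lower sides of the root triangle, hence
  inside this triangle, or on one of the sides, or strictly below one of them and then in the
  inner region of a subtree.
\<close>

lemma inner_region_covered:
  "increasing a t b \<Longrightarrow> z \<in> inner_region a t b \<Longrightarrow>
    (\<exists>T\<in>triangles a t b. z \<in> tri_region T) \<or> (\<exists>e\<in>tedges a t b. z \<in> seg e)"
proof (induction t arbitrary: a b)
  case Leaf
  then show ?case by (auto simp: inner_region_def)
next
  case (Node l c r)
  note i = increasing_Node[OF Node.prems(1)]
  have z: "a < Re z" "Re z < b" "low a (Node l c r) b (Re z) < ht z" "ht z < chord a b (Re z)"
    using Node.prems(2) by (simp_all add: inner_region_def)
  show ?case
  proof (cases "Re z \<le> c")
    case True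
    consider "ht z > chord a c (Re z)" | "ht z = chord a c (Re z)" | "ht z < chord a c (Re z)" by linarith
    then show ?thesis
    proof cases
      case 1
      then have "z \<in> tri_region (a, c, b)" using z True by (simp add: tri_region_iff)
      then show ?thesis by auto
    next
      case 2
      then have "z \<in> seg {a, c}" using z True i by (simp add: seg_iff)
      then show ?thesis using tedges_base[of a c l] by auto
    next
      case 3
      have "Re z \<noteq> c"
      proof
        assume "Re z = c"
        then show False using 3 z low_bounds[OF i(1), of c] i by simp
      qed
      then have "z \<in> inner_region a l c" using z True 3 by (simp add: inner_region_def)
      then show ?thesis using Node.IH(1)[OF i(1)] by auto
    qed
  next
    case False
    consider "ht z > chord c b (Re z)" | "ht z = chord c b (Re z)" | "ht z < chord c b (Re z)" by linarith
    then show ?thesis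
    proof cases
      case 1
      then have "z \<in> tri_region (a, c, b)" using z False by (simp add: tri_region_iff)
      then show ?thesis by auto
    next
      case 2
      then have "z \<in> seg {c, b}" using z False i by (simp add: seg_iff)
      then show ?thesis using tedges_base[of c b r] by auto
    next
      case 3
      then have "z \<in> inner_region c r b" using z False by (simp add: inner_region_def)
      then show ?thesis using Node.IH(2)[OF i(2)] by auto
    qed
  qed
qed

text \<open>
  Two edges span intervals that are nested or have at most an end in common. On nested intervals
  the inner chord is strictly lower except at a common end.
\<close>

lemma segs_cross_at_vertices:
  assumes "increasing a t b" "e \<in> tedges a t b" "e' \<in> tedges a t b" "e \<noteq> e'"
  shows "seg e \<inter> seg e' \<subseteq> pt ` insert a (insert b (set_tree t))"
  using assms
proof (induction t arbitrary: a b e e')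
  case (Node l c r)
  note i = increasing_Node[OF Node.prems(1)]
  have left: "z = pt a" if "z \<in> region a l c" "z \<in> seg {a, b}" for z
  proof -
    have z: "a \<le> Re z" "Re z \<le> c" "ht z \<le> chord a c (Re z)" "ht z = chord a b (Re z)"
      using that i seg_iff[of a b z] by (simp_all add: region_def)
    then have "Re z = a" using chord_mono_right_strict[of a "Re z" c b] i by force
    then show ?thesis using z by (simp add: complex_eq_ht)
  qed
  have right: "z = pt b" if "z \<in> region c r b" "z \<in> seg {a, b}" for z
  proof -
    have z: "c \<le> Re z" "Re z \<le> b" "ht z \<le> chord c b (Re z)" "ht z = chord a b (Re z)"
      using that i seg_iff[of a b z] by (simp_all add: region_def)
    then have "Re z = b" using chord_mono_left_strict[of "Re z" b a c] i by force
    then show ?thesis using z by (simp add: complex_eq_ht)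
  qed
  have mid: "z = pt c" if "z \<in> region a l c" "z \<in> region c r b" for z
  proof -
    have "Re z = c" using that by (simp add: region_def)
    moreover then have "ht z = 0"
      using that low_bounds[OF i(1), of c] i by (simp add: region_def)
    ultimately show ?thesis by (simp add: complex_eq_ht)
  qed
  have L: "seg f \<subseteq> region a l c" if "f \<in> tedges a l c" for f by (rule seg_subset_region[OF i(1) that])
  have R: "seg f \<subseteq> region c r b" if "f \<in> tedges c r b" for f by (rule seg_subset_region[OF i(2) that])
  have "e = {a, b} \<or> e \<in> tedges a l c \<or> e \<in> tedges c r b" "e' = {a, b} \<or> e' \<in> tedges a l c \<or> e' \<in> tedges c r b"
    using Node.prems(2,3) by auto
  then consider "e = {a, b}" "e' \<in> tedges a l c" | "e = {a, b}" "e' \<in> tedges c r b"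
    | "e' = {a, b}" "e \<in> tedges a l c" | "e' = {a, b}" "e \<in> tedges c r b"
    | "e \<in> tedges a l c" "e' \<in> tedges a l c" | "e \<in> tedges c r b" "e' \<in> tedges c r b"
    | "e \<in> tedges a l c" "e' \<in> tedges c r b" | "e' \<in> tedges a l c" "e \<in> tedges c r b"
    using Node.prems(4) by metis
  then show ?case
  proof cases
    case 1
    then have "seg e \<inter> seg e' \<subseteq> {pt a}" using left L by blast
    then show ?thesis by auto
  next
    case 2
    then have "seg e \<inter> seg e' \<subseteq> {pt b}" using right R by blast
    then show ?thesis by auto
  next
    case 3
    then have "seg e \<inter> seg e' \<subseteq> {pt a}" using left L by blast
    then show ?thesis by auto
  next
    case 4
    then have "seg e \<inter> seg e' \<subseteq> {pt b}" using right R by blast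
    then show ?thesis by auto
  next
    case 5 then show ?thesis using Node.IH(1)[OF i(1) 5 Node.prems(4)] by auto
  next
    case 6 then show ?thesis using Node.IH(2)[OF i(2) 6 Node.prems(4)] by auto
  next
    case 7
    then have "seg e \<inter> seg e' \<subseteq> {pt c}" using mid L R by blast
    then show ?thesis by auto
  next
    case 8
    then have "seg e \<inter> seg e' \<subseteq> {pt c}" using mid L R by blast
    then show ?thesis by auto
  qed
qed simp

lemma tedges_pair:
  "increasing a t b \<Longrightarrow> e \<in> tedges a t b \<Longrightarrow> \<exists>u v. e = {u, v} \<and> u < v"
proof (induction t arbitrary: a b)
  case (Node l c r)
  note i = increasing_Node[OF Node.prems(1)]
  consider "e = {a, b}" | "e \<in> tedges a l c" | "e \<in> tedges c r b" using Node.prems(2) by auto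
  then show ?case
  proof cases
    case 1
    then show ?thesis using i(3,4) by (intro exI[of _ a] exI[of _ b]) simp
  qed (use Node.IH(1)[OF i(1)] Node.IH(2)[OF i(2)] in blast)+
qed auto

lemma triangles_edges:
  "increasing a t b \<Longrightarrow> (u, c, v) \<in> triangles a t b \<Longrightarrow>
    u < c \<and> c < v \<and> {u, c} \<in> tedges a t b \<and> {c, v} \<in> tedges a t b \<and> {u, v} \<in> tedges a t b"
proof (induction t arbitrary: a b)
  case (Node l d r)
  note i = increasing_Node[OF Node.prems(1)]
  show ?case using Node.IH(1)[OF i(1)] Node.IH(2)[OF i(2)] Node.prems(2) i(3,4)
    tedges_base[of a d l] tedges_base[of d b r] by auto
qed auto

section \<open>Trees are mops\<close>

definition straight_drawing :: "real \<Rightarrow> real tree \<Rightarrow> real \<Rightarrow> plane_graph" where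
  "straight_drawing a t b =
     \<lparr>pverts = pt ` insert a (insert b (set_tree t)), parcs = seg ` tedges a t b\<rparr>"

lemma finite_tedges: "finite (tedges a t b)"
  by (induction t arbitrary: a b) auto

lemma seg_Int_verts:
  assumes "u < v" "{u, v} \<subseteq> X"
  shows "seg {u, v} \<inter> pt ` X = pt ` {u, v}"
proof
  show "seg {u, v} \<inter> pt ` X \<subseteq> pt ` {u, v}"
    using seg_iff[OF assms(1)] by (auto simp: chord_def)
  show "pt ` {u, v} \<subseteq> seg {u, v} \<inter> pt ` X"
    using seg_iff[OF assms(1)] assms by auto
qed

context
  fixes a b :: real and t :: "real tree"
  assumes inc: "increasing a t b"
begin

lemma seg_edge_Int_verts:
  assumes "e \<in> tedges a t b"
  shows "seg e \<inter> pt ` insert a (insert b (set_tree t)) = pt ` e"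
proof -
  obtain u v where e: "e = {u, v}" "u < v" using tedges_pair[OF inc assms] by blast
  show ?thesis unfolding e(1)
    by (rule seg_Int_verts[OF e(2)]) (use tedges_subset[OF assms] e(1) in simp)
qed

lemma straight_drawing_plane: "is_plane_graph (straight_drawing a t b)"
proof -
  let ?V = "pt ` insert a (insert b (set_tree t))"
  have "\<exists>g. arc g \<and> path_image g = seg e \<and> seg e \<inter> ?V = {pathstart g, pathfinish g}"
    if e: "e \<in> tedges a t b" for e
  proof -
    obtain u v where uv: "e = {u, v}" "u < v" using tedges_pair[OF inc e] by blast
    have "seg e \<inter> ?V = {pt u, pt v}" using seg_edge_Int_verts[OF e] uv(1) by simp
    then show ?thesis using uv
      by (intro exI[of _ "linepath (pt u) (pt v)"]) (simp add: seg_eq_closed_segment)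
  qed
  moreover have "seg e \<inter> seg e' \<subseteq> ?V \<and> seg e \<inter> ?V \<noteq> seg e' \<inter> ?V"
    if e: "e \<in> tedges a t b" "e' \<in> tedges a t b" "seg e \<noteq> seg e'" for e e'
  proof -
    have ne: "e \<noteq> e'" using e(3) by blast
    have "pt ` e \<noteq> pt ` e'" using ne inj_image_eq_iff[OF inj_pt] by blast
    then show ?thesis
      using segs_cross_at_vertices[OF inc e(1,2) ne] seg_edge_Int_verts[OF e(1)] seg_edge_Int_verts[OF e(2)]
      by simp
  qed
  ultimately show ?thesis
    by (simp add: is_plane_graph_def straight_drawing_def finite_tedges)
qed

lemma abstract_straight_drawing:
  "abstract_graph (straight_drawing a t b) = tree_graph (pt a) (map_tree pt t) (pt b)"
proof -
  have "(\<lambda>x. x \<inter> pt ` insert a (insert b (set_tree t))) ` seg ` tedges a t b = (\<lambda>e. pt ` e) ` tedges a t b"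
    unfolding image_image using seg_edge_Int_verts by (rule image_cong[OF refl])
  then show ?thesis
    by (simp add: abstract_graph_def straight_drawing_def tree_graph_def tedges_map tree.set_map)
qed

lemma drawing_straight_drawing: "drawing (straight_drawing a t b) = \<Union>(seg ` tedges a t b)"
proof -
  have "pt x \<in> \<Union>(seg ` tedges a t b)" if x: "x \<in> insert a (insert b (set_tree t))" for x
  proof -
    have "\<exists>e\<in>tedges a t b. x \<in> e"
      using x
    proof (induction t arbitrary: a b)
      case (Node l c r)
      show ?case using Node.IH(1)[of a c] Node.IH(2)[of c b] Node.prems by fastforce
    qed auto
    then obtain e where e: "e \<in> tedges a t b" "x \<in> e" by blast
    then have "pt x \<in> seg e" using seg_edge_Int_verts[OF e(1)] by blast
    then show ?thesis using e by blast
  qed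
  then show ?thesis by (auto simp: drawing_def straight_drawing_def)
qed

lemma triangle_facts:
  assumes "T \<in> triangles a t b"
  obtains u c v where "T = (u, c, v)" "u < c" "c < v"
    "{u, c} \<in> tedges a t b" "{c, v} \<in> tedges a t b" "{u, v} \<in> tedges a t b"
  using assms triangles_edges[OF inc] by (cases T) blast

text \<open>
  The triangles and the complement of the convex region are disjoint, open and connected and
  exhaust the complement of the drawing; this characterises its components.
\<close>

lemma faces_straight_drawing:
  "faces (straight_drawing a t b) = insert (- region a t b) (tri_region ` triangles a t b)"
  unfolding faces_def
proof (rule components_open_unique)
  have tri_in: "tri_region T \<subseteq> region a t b" if "T \<in> triangles a t b" for T
    using triangle_subset[OF inc that] inner_region_subset by blast
  show "pairwise disjnt (insert (- region a t b) (tri_region ` triangles a t b))"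
    unfolding pairwise_insert pairwise_image disjnt_def
    using tri_in triangles_disjoint[OF inc] by (fastforce simp: pairwise_def disjnt_def)
  show "\<Union>(insert (- region a t b) (tri_region ` triangles a t b)) = - drawing (straight_drawing a t b)"
  proof
    show "\<Union>(insert (- region a t b) (tri_region ` triangles a t b)) \<subseteq> - drawing (straight_drawing a t b)"
      unfolding drawing_straight_drawing
      using seg_subset_region[OF inc] triangle_seg_disjoint[OF inc] by blast
    show "- drawing (straight_drawing a t b) \<subseteq> \<Union>(insert (- region a t b) (tri_region ` triangles a t b))"
    proof
      fix z assume z: "z \<in> - drawing (straight_drawing a t b)"
      then have off: "z \<notin> seg e" if "e \<in> tedges a t b" for e
        using that unfolding drawing_straight_drawing by blast
      show "z \<in> \<Union>(insert (- region a t b) (tri_region ` triangles a t b))"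
      proof (cases "z \<in> region a t b")
        case True
        have "z \<in> inner_region a t b"
        proof (rule ccontr)
          assume "z \<notin> inner_region a t b"
          then have "z \<in> seg {a, b} \<union> (\<Union>(u, v)\<in>leaf_pairs a t b. seg {u, v})"
            using True region_boundary[OF inc] by blast
          then show False using off tedges_base[of a b t] leaf_pairs_edges[of _ _ a t b] by auto
        qed
        then show ?thesis using inner_region_covered[OF inc] off by blast
      qed simp
    qed
  qed
  fix X assume "X \<in> insert (- region a t b) (tri_region ` triangles a t b)"
  then consider "X = - region a t b" | T where "T \<in> triangles a t b" "X = tri_region T" by blast
  then show "open X \<and> connected X \<and> X \<noteq> {}"
  proof cases
    case 1
    have "Complex (a - 1) 0 \<notin> region a t b" by (simp add: region_def)
    then show ?thesis unfolding 1
      using closed_region[OF inc] connected_complement_bounded_convex[OF bounded_region[OF inc] convex_region[OF inc]]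
      by (auto simp: open_Compl)
  next
    case 2
    then obtain u c v where T: "T = (u, c, v)" "u < c" "c < v" using triangle_facts by blast
    then have i: "increasing u (Node Leaf c Leaf) v" by simp
    have X: "X = inner_region u (Node Leaf c Leaf) v" using 2 T by (simp add: tri_region_def)
    have "convex X" unfolding X interior_region[OF i, symmetric]
      by (rule convex_interior[OF convex_region[OF i]])
    then show ?thesis
      using open_inner_region[OF i] inner_region_nonempty[OF i] by (simp add: X convex_connected)
  qed
qed

text \<open>
  The boundary cycles of the triangles and of the exterior face are both given by a set \<open>X\<close> of
  edges.
\<close>

lemma bounded_by_cycle_straight:
  assumes vs: "length vs \<ge> 3" "distinct vs"
    and E: "cycle_edges vs = (\<lambda>e. pt ` e) ` X" "X \<subseteq> tedges a t b"
    and F: "frontier F = \<Union>(seg ` X)"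
  shows "bounded_by_cycle (straight_drawing a t b) F vs"
proof -
  let ?P = "straight_drawing a t b"
  let ?V = "insert a (insert b (set_tree t))"
  have ed: "edges (abstract_graph ?P) = (\<lambda>e. pt ` e) ` tedges a t b"
    and ve: "verts (abstract_graph ?P) = pt ` ?V"
    unfolding abstract_straight_drawing by (auto simp: tree_graph_def tedges_map tree.set_map)
  have ce: "{vs ! i, vs ! (Suc i mod length vs)} \<in> cycle_edges vs" if "i < length vs" for i
    using that by (auto simp: cycle_edges_def)
  have "set vs \<subseteq> pt ` ?V"
  proof
    fix x assume "x \<in> set vs"
    then obtain i where i: "i < length vs" "x = vs ! i" by (auto simp: in_set_conv_nth)
    then obtain e where e: "e \<in> X" "{vs ! i, vs ! (Suc i mod length vs)} = pt ` e" using ce E(1) by blast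
    have "pt ` e \<subseteq> pt ` ?V" using tedges_subset[of e a t b] e(1) E(2) by blast
    then show "x \<in> pt ` ?V" using e(2) i(2) by blast
  qed
  then have "is_cycle (abstract_graph ?P) vs"
    unfolding is_cycle_def ed ve using vs ce E by fastforce
  moreover have "{A \<in> parcs ?P. A \<inter> pverts ?P \<in> cycle_edges vs} = seg ` X"
  proof
    have key: "seg e \<inter> pt ` ?V = pt ` e" if "e \<in> tedges a t b" for e by (rule seg_edge_Int_verts[OF that])
    show "{A \<in> parcs ?P. A \<inter> pverts ?P \<in> cycle_edges vs} \<subseteq> seg ` X"
    proof
      fix A assume "A \<in> {A \<in> parcs ?P. A \<inter> pverts ?P \<in> cycle_edges vs}"
      then obtain e where e: "e \<in> tedges a t b" "A = seg e" "seg e \<inter> pt ` ?V \<in> (\<lambda>e. pt ` e) ` X"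
        unfolding E(1) straight_drawing_def by auto
      then obtain e' where "e' \<in> X" "pt ` e = pt ` e'" using key by auto
      then have "e \<in> X" using inj_image_eq_iff[OF inj_pt, of e e'] by simp
      then show "A \<in> seg ` X" using e(2) by blast
    qed
    show "seg ` X \<subseteq> {A \<in> parcs ?P. A \<inter> pverts ?P \<in> cycle_edges vs}"
    proof
      fix A assume "A \<in> seg ` X"
      then obtain e where e: "e \<in> X" "A = seg e" by blast
      then have "e \<in> tedges a t b" using E(2) by blast
      then show "A \<in> {A \<in> parcs ?P. A \<inter> pverts ?P \<in> cycle_edges vs}"
        unfolding E(1) straight_drawing_def using e key[of e] by simp
    qed
  qed
  ultimately show ?thesis unfolding bounded_by_cycle_def using F by simp
qed

lemma consec_map: "consec (map f xs) = (\<lambda>(p, q). (f p, f q)) ` consec xs"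
  by (induction xs rule: induct_list012) auto

theorem mop_straight_drawing:
  assumes t: "t \<noteq> Leaf"
  shows "mop (straight_drawing a t b)"
proof -
  let ?P = "straight_drawing a t b"
  let ?L = "a # inorder t @ [b]"
  have tri: "\<exists>vs. length vs = 3 \<and> bounded_by_cycle ?P F vs" if F: "F \<in> tri_region ` triangles a t b" for F
  proof -
    obtain u c v where T: "F = tri_region (u, c, v)" "u < c" "c < v"
      "{u, c} \<in> tedges a t b" "{c, v} \<in> tedges a t b" "{u, v} \<in> tedges a t b"
      using F triangle_facts by blast
    have i: "increasing u (Node Leaf c Leaf) v" using T by simp
    have "bounded_by_cycle ?P F [pt u, pt c, pt v]"
    proof (rule bounded_by_cycle_straight[where X = "{{u, c}, {c, v}, {u, v}}"])
      show "cycle_edges [pt u, pt c, pt v] = (\<lambda>e. pt ` e) ` {{u, c}, {c, v}, {u, v}}"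
        by (subst cycle_edges_consec) (auto simp: insert_commute)
      show "frontier F = \<Union>(seg ` {{u, c}, {c, v}, {u, v}})"
        unfolding T(1) tri_region_def using frontier_inner_region[OF i] region_boundary[OF i] by auto
    qed (use T in auto)
    then show ?thesis by (intro exI[of _ "[pt u, pt c, pt v]"]) simp
  qed
  have unb: "\<not> bounded (- region a t b)"
  proof
    assume "bounded (- region a t b)"
    then have "bounded (region a t b \<union> - region a t b)" using bounded_region[OF inc] by (simp only: bounded_Un)
    then show False by (simp add: Compl_partition)
  qed
  have bt: "bounded F" if "F \<in> tri_region ` triangles a t b" for F
    using that triangle_subset[OF inc] inner_region_subset bounded_region[OF inc]
    by (metis (no_types, lifting) bounded_subset imageE order_trans)
  define X where "X = insert {a, b} ((\<lambda>(u, v). {u, v}) ` leaf_pairs a t b)"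
  have frX: "frontier (- region a t b) = \<Union>(seg ` X)"
    unfolding frontier_complement frontier_region[OF inc] region_boundary[OF inc] X_def by auto
  have outer: "bounded_by_cycle ?P (- region a t b) (map pt ?L)"
  proof (rule bounded_by_cycle_straight[OF _ _ _ _ frX])
    show "length (map pt ?L) \<ge> 3" using t by (cases t) auto
    have "distinct ?L" using inc strict_sorted_iff by blast
    then show "distinct (map pt ?L)" by (simp only: distinct_map inj_pt)
    have "cycle_edges (map pt ?L) = {{p, q} | p q. (p, q) \<in> consec (map pt ?L)} \<union> {{pt b, pt a}}"
      by (subst cycle_edges_consec) simp_all
    also have "{{p, q} | p q. (p, q) \<in> consec (map pt ?L)} = (\<lambda>(u, v). {pt u, pt v}) ` leaf_pairs a t b"
      unfolding consec_map consec_inorder by force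
    also have "\<dots> \<union> {{pt b, pt a}} = (\<lambda>e. pt ` e) ` X"
      by (auto simp: X_def image_image insert_commute split_def)
    finally show "cycle_edges (map pt ?L) = (\<lambda>e. pt ` e) ` X" .
    show "X \<subseteq> tedges a t b" using leaf_pairs_edges[of _ _ a t b] tedges_base[of a b t] by (auto simp: X_def)
  qed
  have vf: "pverts ?P \<subseteq> frontier (- region a t b)"
  proof
    fix z assume "z \<in> pverts ?P"
    then obtain x where x: "z = pt x" "x \<in> set ?L" by (auto simp: straight_drawing_def)
    have "z \<in> \<Union>(seg ` X)"
    proof -
      obtain i where i: "i < length ?L" "x = ?L ! i" using x(2) by (metis in_set_conv_nth)
      have "\<exists>e\<in>X. x \<in> e"
      proof (cases "Suc i < length ?L")
        case True
        then have "(?L ! i, ?L ! Suc i) \<in> leaf_pairs a t b"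
          unfolding consec_inorder[symmetric] by (subst consec_iff_nth) blast
        then show ?thesis using i(2) by (intro bexI[of _ "{?L ! i, ?L ! Suc i}"]) (auto simp: X_def)
      next
        case False
        then have "x = last ?L" using i by (metis Suc_lessI diff_Suc_1 last_conv_nth list.distinct(1))
        then show ?thesis by (auto simp: X_def)
      qed
      then obtain e where e: "e \<in> X" "x \<in> e" by blast
      have "X \<subseteq> tedges a t b" using leaf_pairs_edges[of _ _ a t b] tedges_base[of a b t] by (auto simp: X_def)
      then have "pt x \<in> seg e" using seg_edge_Int_verts[of e] e by blast
      then show ?thesis using e x by blast
    qed
    then show "z \<in> frontier (- region a t b)" unfolding frX .
  qed
  show ?thesis
    unfolding mop_def triangulated_disc_def faces_straight_drawing
    using straight_drawing_plane tri unb bt outer vf by (auto simp del: map_eq_Cons_conv)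
qed

end

section \<open>Chains of blocks\<close>

text \<open>
  The inner vertices of a block with first vertex \<open>B\<close> are \<open>B + 1\<close> and the labels
  \<open>B + 2, \<dots>, B + m + 1\<close> of \<open>fan B m\<close>. The vertex \<open>B + 1\<close> is adjacent to all other
  vertices of the block and is thus the centre of a star with these labels as leaves. Only \<open>B\<close> and
  \<open>B + m + 2\<close> have neighbours in other blocks.
\<close>

fun fan :: "nat \<Rightarrow> nat \<Rightarrow> nat tree" where
  "fan B 0 = Leaf"
| "fan B (Suc j) = Node (fan B j) (B + 2 + j) Leaf"

definition block :: "nat \<Rightarrow> nat \<Rightarrow> nat tree" where
  "block m B = Node Leaf (B + 1) (fan B m)"

fun chain :: "nat \<Rightarrow> nat \<Rightarrow> nat tree" where
  "chain m 0 = block m 0"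
| "chain m (Suc t) = Node (Node (chain m t) (t * (m + 3) + m + 2) Leaf) (Suc t * (m + 3))
      (block m (Suc t * (m + 3)))"

lemma inorder_fan: "inorder (fan B j) = [B + 2..<B + 2 + j]"
  by (induction j) auto

text \<open>
  The boundary path of a block, and below that of a chain, visits the numbers in increasing order;
  this gives at once distinctness, the number of vertices, and the sortedness needed for the
  drawing.
\<close>

lemma block_list: "B # inorder (block m B) @ [B + m + 2] = [B..<B + m + 3]"
proof -
  have "[B..<B + m + 3] = B # (B + 1) # [B + 2..<B + m + 3]"
    by (simp add: upt_conv_Cons)
  also have "[B + 2..<B + m + 3] = [B + 2..<B + 2 + m] @ [B + m + 2]"
    by (simp add: numeral_3_eq_3 add.commute)
  finally show ?thesis by (simp add: block_def inorder_fan)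
qed

lemma chain_list: "0 # inorder (chain m t) @ [t * (m + 3) + m + 2] = [0..<Suc t * (m + 3)]"
proof (induction t)
  case 0
  then show ?case using block_list[of 0 m] by (simp add: add.commute)
next
  case (Suc t)
  let ?B = "Suc t * (m + 3)"
  have "0 # inorder (chain m (Suc t)) @ [Suc t * (m + 3) + m + 2]
      = (0 # inorder (chain m t) @ [t * (m + 3) + m + 2]) @ (?B # inorder (block m ?B) @ [?B + m + 2])"
    by simp
  also have "\<dots> = [0..<?B] @ [?B..<?B + m + 3]" unfolding Suc.IH block_list ..
  also have "\<dots> = [0..<?B + (m + 3)]" using upt_add_eq_append[of 0 ?B "m + 3"] by (simp add: add.assoc)
  finally show ?case by (simp add: add.commute add.left_commute)
qed

lemma fan_star: "x \<in> {B + 2..<B + 2 + j} \<Longrightarrow> {B + 1, x} \<in> tedges (B + 1) (fan B j) (B + 2 + j)"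
proof (induction j)
  case (Suc j)
  then consider "x \<in> {B + 2..<B + 2 + j}" | "x = B + 2 + j" by fastforce
  then show ?case
  proof cases
    case 1
    then show ?thesis using Suc.IH by simp
  next
    case 2
    then show ?thesis using tedges_base[of "B + 1" "B + 2 + j" "fan B j"] by simp
  qed
qed simp

lemma block_star:
  "x \<in> {B + 2..<B + 2 + m} \<Longrightarrow> {B + 1, x} \<in> tedges B (block m B) (B + m + 2)"
  using fan_star[of x B m] by (simp add: block_def add.commute add.left_commute)

lemma block_in_chain:
  "i \<le> t \<Longrightarrow> tedges (i * (m + 3)) (block m (i * (m + 3))) (i * (m + 3) + m + 2)
    \<subseteq> tedges 0 (chain m t) (t * (m + 3) + m + 2)"
proof (induction t)
  case (Suc t)
  show ?case
  proof (cases "i = Suc t")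
    case True
    then show ?thesis by auto
  next
    case False
    then show ?thesis using Suc by auto
  qed
qed simp

lemma block_div:
  assumes "e \<in> tedges (i * (m + 3)) (block m (i * (m + 3))) (i * (m + 3) + m + 2)" "y \<in> e"
  shows "y div (m + 3) = i"
proof -
  let ?B = "i * (m + 3)"
  have "y \<in> set (?B # inorder (block m ?B) @ [?B + m + 2])" using tedges_subset[OF assms(1)] assms(2) by auto
  then have "y \<in> {?B..<?B + m + 3}" unfolding block_list by simp
  then have "i * (m + 3) \<le> y" "y < Suc i * (m + 3)" by auto
  then show ?thesis by (intro div_nat_eqI) (simp_all only: mult.commute)
qed

text \<open>
  Positions inside a block are remainders modulo \<open>m + 3\<close>, and the number of the block is the
  quotient.
\<close>

lemma chain_local:
  "e \<in> tedges 0 (chain m t) (t * (m + 3) + m + 2) \<Longrightarrow> x \<in> e \<Longrightarrow> y \<in> e \<Longrightarrow>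
    x mod (m + 3) \<in> {1..m + 1} \<Longrightarrow> y div (m + 3) = x div (m + 3)"
proof (induction t)
  case 0
  then show ?case using block_div[of e 0 m] by simp
next
  case (Suc t)
  let ?B = "Suc t * (m + 3)"
  have mods: "(s * (m + 3) + m + 2) mod (m + 3) = m + 2" "(s * (m + 3)) mod (m + 3) = 0" for s
  proof -
    have "(s * (m + 3) + m + 2) mod (m + 3) = (s * (m + 3) + (m + 2)) mod (m + 3)" by (simp only: add.assoc)
    also have "\<dots> = m + 2" unfolding mod_mult_self3 by simp
    finally show "(s * (m + 3) + m + 2) mod (m + 3) = m + 2" .
  qed simp
  consider "e \<in> tedges 0 (chain m t) (t * (m + 3) + m + 2)" | "e \<in> tedges ?B (block m ?B) (?B + m + 2)"
    | "e \<in> {{0, ?B + m + 2}, {0, ?B}, {t * (m + 3) + m + 2, ?B}}"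
    using Suc.prems(1) by auto
  then show ?case
  proof cases
    case 1
    then show ?thesis using Suc by blast
  next
    case 2
    then show ?thesis using block_div[OF 2] Suc.prems(2,3) by metis
  next
    case 3
    then have "x mod (m + 3) = 0 \<or> x mod (m + 3) = m + 2"
      using Suc.prems(2) mods[of "Suc t"] mods[of t] by (auto simp del: mult_Suc)
    then show ?thesis using Suc.prems(4) by simp
  qed
qed

text \<open>
  A set that misses a block dominates none of its inner vertices, and these contain a star.
\<close>

lemma chain_lower:
  assumes iso: "isolating m {0..<Suc t * (m + 3)} (tedges 0 (chain m t) (t * (m + 3) + m + 2)) S"
  shows "Suc t \<le> card S"
proof -
  let ?w = "m + 3" and ?V = "{0..<Suc t * (m + 3)}" and ?E = "tedges 0 (chain m t) (t * (m + 3) + m + 2)"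
  have SV: "S \<subseteq> ?V" using iso by (simp add: isolating_def)
  then have fin: "finite S" using finite_subset by blast
  have "{0..t} \<subseteq> (\<lambda>s. s div ?w) ` S"
  proof
    fix i assume i: "i \<in> {0..t}"
    show "i \<in> (\<lambda>s. s div ?w) ` S"
    proof (rule ccontr)
      assume no: "i \<notin> (\<lambda>s. s div ?w) ` S"
      let ?B = "i * ?w"
      have X: "x div ?w = i" "x mod ?w \<in> {1..m + 1}" "x \<in> ?V" if "x \<in> {?B + 1..<?B + 2 + m}" for x
      proof -
        define y where "y = x - ?B"
        have y: "x = i * ?w + y" "1 \<le> y" "y \<le> m + 1" using that by (auto simp: y_def)
        show "x div ?w = i" "x mod ?w \<in> {1..m + 1}" using y by auto
        have "i * ?w + ?w \<le> Suc t * ?w" using i mult_le_mono1[of "Suc i" "Suc t" ?w] by simp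
        moreover have "x < i * ?w + ?w" using y by simp
        ultimately show "x \<in> ?V" by (simp only: atLeastLessThan_iff) linarith
      qed
      have und: "x \<notin> dominated ?E S" if "x \<in> {?B + 1..<?B + 2 + m}" for x
      proof
        assume "x \<in> dominated ?E S"
        then consider "x \<in> S" | s where "s \<in> S" "{s, x} \<in> ?E" by (auto simp: dominated_def)
        then show False
        proof cases
          case 1
          have "i = x div ?w" using X(1)[OF that] by simp
          then have "i \<in> (\<lambda>s. s div ?w) ` S" using 1 by (rule image_eqI)
          with no show False by contradiction
        next
          case 2
          have "s div ?w = x div ?w" by (rule chain_local[OF 2(2) _ _ X(2)[OF that]]) auto
          then have "i = s div ?w" using X(1)[OF that] by simp
          then have "i \<in> (\<lambda>s. s div ?w) ` S" using 2(1) by (rule image_eqI)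
          with no show False by contradiction
        qed
      qed
      let ?N = "{y \<in> ?V - dominated ?E S. {?B + 1, y} \<in> ?E}"
      have "{?B + 2..<?B + 2 + m} \<subseteq> ?N"
      proof
        fix x assume x: "x \<in> {?B + 2..<?B + 2 + m}"
        then have x': "x \<in> {?B + 1..<?B + 2 + m}" by auto
        have "{?B + 1, x} \<in> ?E" using block_star[OF x] block_in_chain[of i t m] i by auto
        then show "x \<in> ?N" using X(3)[OF x'] und[OF x'] by blast
      qed
      then have "card {?B + 2..<?B + 2 + m} \<le> card ?N" by (intro card_mono) auto
      then have "m \<le> card ?N" by simp
      moreover have "?B + 1 \<in> ?V - dominated ?E S" using X(3)[of "?B + 1"] und[of "?B + 1"] by auto
      then have "card ?N < m" using iso unfolding isolating_def by blast
      ultimately show False by simp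
    qed
  qed
  then have "card {0..t} \<le> card ((\<lambda>s. s div ?w) ` S)" using fin by (intro card_mono) auto
  also have "\<dots> \<le> card S" using fin by (rule card_image_le)
  finally show ?thesis by simp
qed

lemma isolating_image:
  assumes "inj f" "isolating m (f ` V) ((\<lambda>e. f ` e) ` E) (f ` S)"
  shows "isolating m V E S"
proof -
  have e: "{f x, f y} \<in> (\<lambda>e. f ` e) ` E \<longleftrightarrow> {x, y} \<in> E" for x y
  proof -
    have "{f x, f y} = f ` {x, y}" by simp
    then show ?thesis using inj_image_eq_iff[OF assms(1), of "{x, y}"] by (metis (no_types, lifting) imageE imageI)
  qed
  have mem: "f x \<in> f ` A \<longleftrightarrow> x \<in> A" for x A using inj_image_mem_iff[OF assms(1)] .
  have d: "f x \<in> dominated ((\<lambda>e. f ` e) ` E) (f ` S) \<longleftrightarrow> x \<in> dominated E S" for x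
    unfolding dominated_def using e mem by auto
  show ?thesis
    unfolding isolating_def
  proof (intro conjI ballI)
    show "S \<subseteq> V" using assms unfolding isolating_def by (simp add: inj_image_subset_iff)
    fix x assume x: "x \<in> V - dominated E S"
    let ?N = "{y \<in> V - dominated E S. {x, y} \<in> E}"
    let ?D = "dominated ((\<lambda>e. f ` e) ` E) (f ` S)"
    have img: "{y \<in> f ` V - ?D. {f x, y} \<in> (\<lambda>e. f ` e) ` E} = f ` ?N"
    proof (intro set_eqI iffI)
      fix z assume z: "z \<in> {y \<in> f ` V - ?D. {f x, y} \<in> (\<lambda>e. f ` e) ` E}"
      then obtain y where "z = f y" "y \<in> V" by blast
      moreover have "y \<notin> dominated E S" "{x, y} \<in> E"
        using z d[of y] e[of x y] unfolding \<open>z = f y\<close> by simp_all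
      ultimately show "z \<in> f ` ?N" by simp
    next
      fix z assume "z \<in> f ` ?N"
      then obtain y where y: "z = f y" "y \<in> ?N" by blast
      have "f y \<in> f ` V" "f y \<notin> ?D" "{f x, f y} \<in> (\<lambda>e. f ` e) ` E"
        using y(2) d[of y] e[of x y] by simp_all
      then show "z \<in> {y \<in> f ` V - ?D. {f x, y} \<in> (\<lambda>e. f ` e) ` E}" unfolding y(1) by simp
    qed
    have "f x \<in> f ` V - ?D" using x d by simp
    then have "card (f ` ?N) < m"
      unfolding img[symmetric] by (rule bspec[OF conjunct2[OF assms(2)[unfolded isolating_def]]])
    then show "card ?N < m"
      by (simp only: card_image[OF inj_on_subset[OF assms(1) subset_UNIV]])
  qed
qed

lemma inorder_map_tree: "inorder (map_tree f t) = map f (inorder t)"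
  by (induction t) auto

lemma chain_drawing:
  fixes k :: int
  assumes k: "k \<ge> -1"
  defines "m \<equiv> nat (k + 1)"
  shows "\<exists>P. mop P \<and> card (pverts P) = Suc t * (m + 3) \<and> Suc t \<le> iota k (abstract_graph P)"
proof -
  define e where "e = t * (m + 3) + m + 2"
  define f where "f = (\<lambda>i. pt (real i))"
  have inj: "inj f" by (auto simp: f_def inj_on_def)
  let ?t = "map_tree real (chain m t)"
  have "real 0 # inorder ?t @ [real e] = map real (0 # inorder (chain m t) @ [e])"
    by (simp add: inorder_map_tree)
  also have "\<dots> = map real [0..<Suc t * (m + 3)]" unfolding e_def chain_list ..
  finally have list: "real 0 # inorder ?t @ [real e] = map real [0..<Suc t * (m + 3)]" .
  have inc: "increasing (real 0) ?t (real e)"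
    unfolding list by (simp add: sorted_wrt_map)
  have "chain m t \<noteq> Leaf" by (cases t) (simp_all add: block_def)
  then have mop: "mop (straight_drawing (real 0) ?t (real e))" by (intro mop_straight_drawing[OF inc]) simp
  let ?P = "straight_drawing (real 0) ?t (real e)"
  let ?V = "{0..<Suc t * (m + 3)}" and ?E = "tedges 0 (chain m t) e"
  have "insert 0 (insert e (set_tree (chain m t))) = set (0 # inorder (chain m t) @ [e])" by auto
  also have "\<dots> = ?V" unfolding e_def chain_list by simp
  finally have V: "insert 0 (insert e (set_tree (chain m t))) = ?V" .
  have G: "abstract_graph ?P = \<lparr>verts = f ` ?V, edges = (\<lambda>e. f ` e) ` ?E\<rparr>"
    unfolding abstract_straight_drawing[OF inc] tree_graph_def V[symmetric] tedges_map[symmetric] f_def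
    by (simp add: tree.set_map image_image tree.map_comp comp_def)
  have pv: "pverts ?P = f ` ?V"
    using arg_cong[OF G, of verts] by (simp add: abstract_graph_def)
  have "card (pverts ?P) = Suc t * (m + 3)"
    unfolding pv using card_image[OF inj_on_subset[OF inj], of ?V] by simp
  moreover have "Suc t \<le> iota k (abstract_graph ?P)"
  proof -
    have "\<exists>n S. star_isolating k (abstract_graph ?P) S \<and> card S = n"
      using star_isolating_verts by blast
    then obtain S where S: "star_isolating k (abstract_graph ?P) S" "card S = iota k (abstract_graph ?P)"
      unfolding iota_def using LeastI_ex[of "\<lambda>n. \<exists>S. star_isolating k (abstract_graph ?P) S \<and> card S = n"] by blast
    have "is_plane_graph ?P" using mop by (simp add: mop_def triangulated_disc_def)
    then have "isolating m (f ` ?V) ((\<lambda>e. f ` e) ` ?E) S"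
      using isolating_star_isolating[OF S(1) simple_graph_abstract_graph] G by (simp add: m_def)
    moreover from this obtain S' where S': "S = f ` S'" by (auto simp: isolating_def subset_image_iff)
    ultimately have "isolating m ?V ?E S'" using isolating_image[OF inj] by blast
    then have "Suc t \<le> card S'" unfolding e_def by (rule chain_lower)
    also have "card S' = card S" unfolding S' using card_image[OF inj_on_subset[OF inj], of S'] by simp
    finally show ?thesis using S(2) by simp
  qed
  ultimately show ?thesis using mop by blast
qed

section \<open>The bound and its sharpness\<close>

lemma mop_iota_bound:
  fixes k :: int
  assumes "k \<ge> -1" "mop P" "int (card (pverts P)) \<ge> (if k \<ge> 1 then 2 * k + 3 else k + 5)"
  shows "real (iota k (abstract_graph P)) \<le> iota_bound k (card (pverts P)) (num_deg2 (abstract_graph P))"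
proof -
  obtain a t b where t: "distinct (a # inorder t @ [b])" "abstract_graph P = tree_graph a t b"
    by (rule mop_tree_graph[OF assms(2)])
  have "pverts P = verts (tree_graph a t b)" using t(2)[symmetric] by (simp add: abstract_graph_def)
  then show ?thesis using tree_graph_iota_bound[OF t(1) assms(1)] assms(3) t(2) by simp
qed

text \<open>
  Hence a mop with \<open>n = x (k + 4)\<close> vertices in which every isolating set has at least \<open>x\<close>
  elements attains the bound.
\<close>

lemma iota_bound_le_fraction:
  assumes k: "k \<ge> -1" and n: "real n = real x * (real_of_int k + 4)"
  shows "iota_bound k n n2 \<le> real x"
proof -
  let ?k = "real_of_int k"
  have k': "?k \<ge> -1" using k by simp
  have x: "real n / (?k + 4) = real x" using n k' by simp
  have low: "(real n + real n2) / (?k + 5) \<le> real x" if "real n2 \<le> real x"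
  proof -
    have "real n + real n2 \<le> real x * (?k + 5)" using n that by (simp add: algebra_simps)
    then show ?thesis using k' by (simp add: divide_le_eq)
  qed
  show ?thesis
  proof (cases "k \<ge> 1")
    case True
    have "(real n - real n2) / (?k + 2) \<le> real x" if "2 * real x \<le> real n2"
    proof -
      have "real n - real n2 \<le> real x * (?k + 2)" using n that by (simp add: algebra_simps)
      then show ?thesis using k' by (simp add: divide_le_eq)
    qed
    moreover have "2 * real n / (?k + 4) = 2 * real x" using x by simp
    ultimately show ?thesis using True low x unfolding iota_bound_def by auto
  next
    case False
    have "(real n - real n2 - ?k * indic n n2) / (?k + 3) \<le> real x" if "real x < real n2"
    proof -
      \<comment> \<open>The correction term is at most \<open>1\<close>, and it is absorbed because \<open>x\<close> and \<open>n2\<close> are integers.\<close>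
      have "x + 1 \<le> n2" using that by simp
      then have "real x + 1 \<le> real n2" by linarith
      moreover have "- ?k * indic n n2 \<le> 1" using k False by (auto simp: indic_def)
      ultimately have "real n - real n2 - ?k * indic n n2 \<le> real x * (?k + 3)"
        using n by (simp add: algebra_simps)
      then show ?thesis using k' by (simp add: divide_le_eq)
    qed
    then show ?thesis using False low x unfolding iota_bound_def by auto
  qed
qed

lemma iota_bound_attained:
  fixes k :: int
  assumes k: "k \<ge> -1"
  defines "m \<equiv> nat (k + 1)"
  shows "\<exists>P. mop P \<and> card (pverts P) = (t + 2) * (m + 3) \<and>
    real (iota k (abstract_graph P)) = iota_bound k ((t + 2) * (m + 3)) (num_deg2 (abstract_graph P))"
proof -
  obtain P where P: "mop P" "card (pverts P) = (t + 2) * (m + 3)" "t + 2 \<le> iota k (abstract_graph P)"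
    using chain_drawing[OF k, of "Suc t"] unfolding m_def by auto
  have km: "int m = k + 1" using k by (simp add: m_def)
  have "int (card (pverts P)) = (int t + 2) * (int m + 3)" unfolding P(2) by (simp add: algebra_simps)
  also have "\<dots> = (int t + 2) * (k + 4)" unfolding km by simp
  also have "\<dots> \<ge> 2 * (k + 4)" using k by (intro mult_right_mono) auto
  \<comment> \<open>Two blocks are enough for the hypotheses on the number of vertices.\<close>
  finally have n: "int (card (pverts P)) \<ge> 2 * k + 8" by simp
  have "real (iota k (abstract_graph P)) \<le> iota_bound k (card (pverts P)) (num_deg2 (abstract_graph P))"
    by (rule mop_iota_bound[OF k P(1)]) (use n k in auto)
  moreover have "iota_bound k (card (pverts P)) (num_deg2 (abstract_graph P)) \<le> real (t + 2)"
  proof (rule iota_bound_le_fraction[OF k])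
    have "real m = real_of_int k + 1" using km by linarith
    then show "real (card (pverts P)) = real (t + 2) * (real_of_int k + 4)" unfolding P(2) by (simp add: algebra_simps)
  qed
  ultimately show ?thesis using P by (intro exI[of _ P]) auto
qed

theorem theorem9:
  "(\<forall>(k::int) P. k \<ge> 1 \<and> mop P \<and> int (card (pverts P)) \<ge> 2 * k + 3 \<longrightarrow>
      real (iota k (abstract_graph P))
        \<le> iota_bound k (card (pverts P)) (num_deg2 (abstract_graph P)))
   \<and> (\<forall>(k::int) P. -1 \<le> k \<and> k \<le> 0 \<and> mop P \<and> int (card (pverts P)) \<ge> k + 5 \<longrightarrow>
      real (iota k (abstract_graph P))
        \<le> iota_bound k (card (pverts P)) (num_deg2 (abstract_graph P)))
   \<and> (\<forall>k::int. k \<ge> -1 \<longrightarrow>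
      infinite {n. \<exists>P. mop P \<and> card (pverts P) = n \<and>
        real (iota k (abstract_graph P)) = iota_bound k n (num_deg2 (abstract_graph P))})"
proof (intro conjI allI impI; (elim conjE)?)
  fix k :: int and P
  assume "k \<ge> 1" "mop P" "int (card (pverts P)) \<ge> 2 * k + 3"
  then show "real (iota k (abstract_graph P)) \<le> iota_bound k (card (pverts P)) (num_deg2 (abstract_graph P))"
    by (intro mop_iota_bound) auto
next
  fix k :: int and P
  assume "-1 \<le> k" "k \<le> 0" "mop P" "int (card (pverts P)) \<ge> k + 5"
  then show "real (iota k (abstract_graph P)) \<le> iota_bound k (card (pverts P)) (num_deg2 (abstract_graph P))"
    by (intro mop_iota_bound) auto
next
  fix k :: int
  assume k: "k \<ge> -1"
  let ?A = "{n. \<exists>P. mop P \<and> card (pverts P) = n \<and>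
        real (iota k (abstract_graph P)) = iota_bound k n (num_deg2 (abstract_graph P))}"
  have "range (\<lambda>t. (t + 2) * (nat (k + 1) + 3)) \<subseteq> ?A"
    using iota_bound_attained[OF k] by blast
  moreover have "inj (\<lambda>t. (t + 2) * (nat (k + 1) + 3))" by (auto simp: inj_on_def)
  then have "infinite (range (\<lambda>t. (t + 2) * (nat (k + 1) + 3)))" by (rule range_inj_infinite)
  ultimately show "infinite ?A" using finite_subset by blast
qed

end
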